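(* Let $$\mathcal{G}_{\mathrm{tree}}(x,q)=x^2\left(1+\sum_{i=1}^{\infty}\sum_{j=1}^{i}\frac{1}{i}\binom{2i+j}{2i+1}\binom{i}{j}q^{2i-j}x^{2i}\right)$$ and define the power series $\mathcal{G}_{\mathrm{forest}}(x,q)$ by $$x\,\mathcal{G}_{\mathrm{forest}}(x,q)=\left(\frac{x}{1+\mathcal{G}_{\mathrm{tree}}(x,q)}\right)^{\langle -1\rangle}_x,$$ where $(\cdot)^{\langle-1\rangle}_x$ denotes the compositional inverse with respect to $x$. Then for all integers $k\ge 1$ and $r\ge 0$, the number of orthogonal Grassmannian forests of type $\underline{k}$ with $\mathcal{O}$-dimension $r$ equals the coefficient $[x^{2k}q^r]\,\mathcal{G}_{\mathrm{forest}}(x,q)$. Equivalently, $$[x^{2k}]\,\mathcal{G}_{\mathrm{forest}}(x,q)=\frac{1}{2k+1}[x^{2k}]\left(1+\mathcal{G}_{\mathrm{tree}}(x,q)\right)^{2k+1}.$$ Moreover, $\mathcal{G}=\mathcal{G}_{\mathrm{forest}}(x,q)$ is algebraic of degree $4$ and satisfies $$(x^4-q^2x^2)\,\mathcal{G}^4+\big((2q^2-1)x^2+q(q+1)\big)\mathcal{G}^3+\big(x^2-q(q(x^2+3)+3)\big)\mathcal{G}^2+3q(q+1)\,\mathcal{G}-q(q+1)=0 .$$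
   Context: A planar forest on $n$ leaves is an acyclic graph properly embedded in a closed disk, considered up to homeomorphism, having $n$ boundary vertices, each of degree one, lying on the boundary of the disk and labelled $1,\dots,n$ in clockwise order; all other vertices are internal vertices, lie in the interior of the disk, and are path-connected to the boundary of the disk. A planar tree is a connected planar forest. An orthogonal Grassmannian forest (OG forest) of type $\underline{k}$ is a planar forest on $2k$ leaves in which every internal vertex $v$ has even degree $\deg(v)\ge 4$ (each internal vertex carries the helicity $h(v)=\deg(v)/2$, which is determined by its degree). Each connected component (tree) of an OG forest then has an even number of leaves and is either a single edge joining two boundary vertices or a tree with at least one internal vertex. Combinatorially, the component trees induce a non-crossing partition of $\{1,\dots,2k\}$. The $\mathcal{O}$-dimension of a component tree is $0$ if it is a single edge, and otherwise is $\sum_{v}(\deg(v)-3)$ over its internal vertices $v$. The $\mathcal{O}$-dimension of an OG forest is the sum of the $\mathcal{O}$-dimensions of its component trees. "Algebraic of degree $4$" means algebraic of degree $4$ over $\mathbb{Q}(x,q)$. *)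

theory Defs
  imports
    "Graph_Theory.Pair_Digraph"
    "Graph_Theory.Digraph_Component"
    "HOL-Combinatorics.Orbits"
    "HOL-Computational_Algebra.Formal_Laurent_Series"
    "HOL-Computational_Algebra.Polynomial_FPS"
begin

section \<open>Planar forests in a disk\<close>

text \<open>
  A graph embedded in an oriented surface is given, up to orientation preserving homeomorphism,
  by a combinatorial map: the graph together with, at every vertex \<open>v\<close>, the cyclic clockwise order
  of its neighbours (parallel edges cannot occur here). \<open>rot F v w\<close> is the neighbour of \<open>v\<close>
  that follows \<open>w\<close> clockwise, and \<open>leaf F i\<close> is the boundary vertex labelled \<open>i\<close>. Graphs
  are symmetric digraphs, so an undirected edge is a pair of opposite arcs.
\<close>

record 'a disk_graph =
  gr :: "'a pair_pre_digraph"
  rot :: "'a \<Rightarrow> 'a \<Rightarrow> 'a"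
  leaf :: "nat \<Rightarrow> 'a"

abbreviation deg :: "'a disk_graph \<Rightarrow> 'a \<Rightarrow> nat" where
  "deg F v \<equiv> out_degree (with_proj (gr F)) v"

definition boundary :: "nat \<Rightarrow> 'a disk_graph \<Rightarrow> 'a set" where
  "boundary n F = leaf F ` {1..n}"

definition internal :: "nat \<Rightarrow> 'a disk_graph \<Rightarrow> 'a set" where
  "internal n F = pverts (gr F) - boundary n F"

text \<open>The faces of a combinatorial map are the orbits of \<open>(u, v) \<mapsto> (v, \<sigma> v u)\<close> on its arcs.\<close>

definition faces :: "'a pair_pre_digraph \<Rightarrow> ('a \<Rightarrow> 'a \<Rightarrow> 'a) \<Rightarrow> ('a \<times> 'a) set set" where
  "faces G \<sigma> = orbit (\<lambda>(u, v). (v, \<sigma> v u)) ` parcs G"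

definition euler_char :: "'a pair_pre_digraph \<Rightarrow> ('a \<Rightarrow> 'a \<Rightarrow> 'a) \<Rightarrow> int" where
  "euler_char G \<sigma> = int (card (pverts G)) - int (card (parcs G) div 2) + int (card (faces G \<sigma>))"

text \<open>
  Glue a second disk to the boundary circle, put a vertex \<open>None\<close> in it and join this vertex to the
  \<open>n\<close> boundary vertices. The labels increase clockwise around the original disk, hence they
  decrease clockwise around \<open>None\<close>. A combinatorial map is properly embedded in the disk, with its
  boundary vertices in this order, iff the resulting map is embedded in the sphere.
\<close>

definition cap_graph :: "nat \<Rightarrow> 'a disk_graph \<Rightarrow> 'a option pair_pre_digraph" where
  "cap_graph n F =
     \<lparr> pverts = insert None (Some ` pverts (gr F)),
       parcs = map_prod Some Some ` parcs (gr F)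
               \<union> {None} \<times> Some ` boundary n F \<union> Some ` boundary n F \<times> {None} \<rparr>"

fun cap_rot :: "nat \<Rightarrow> 'a disk_graph \<Rightarrow> 'a option \<Rightarrow> 'a option \<Rightarrow> 'a option" where
  "cap_rot n F None (Some w) =
     (let i = inv_into {1..n} (leaf F) w in Some (leaf F (if i = 1 then n else i - 1)))"
| "cap_rot n F (Some v) (Some w) = (if v \<in> boundary n F then None else Some (rot F v w))"
| "cap_rot n F (Some v) None = Some (THE w. (v, w) \<in> parcs (gr F))"
| "cap_rot n F None None = None"

text \<open>
  In a symmetric digraph going back and forth along an edge is a cycle of length 2; these are the
  only ones of length at most 2, and the remaining ones are the cycles of the undirected graph.
  The definition is meant for \<open>n \<ge> 1\<close>; the capped map is then connected, so Euler characteristic 2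
  characterises the sphere.
\<close>

definition planar_forest :: "nat \<Rightarrow> 'a disk_graph \<Rightarrow> bool" where
  "planar_forest n F \<longleftrightarrow>
     pair_graph (gr F) \<and>
     (\<forall>p. pre_digraph.cycle (with_proj (gr F)) p \<longrightarrow> length p \<le> 2) \<and>
     inj_on (leaf F) {1..n} \<and> boundary n F \<subseteq> pverts (gr F) \<and>
     (\<forall>v \<in> boundary n F. deg F v = 1) \<and>
     (\<forall>v \<in> pverts (gr F). \<exists>w \<in> boundary n F. v \<rightarrow>\<^sup>*\<^bsub>with_proj (gr F)\<^esub> w) \<and>
     (\<forall>v \<in> pverts (gr F). cyclic_on (rot F v) {w. (v, w) \<in> parcs (gr F)}) \<and>
     euler_char (cap_graph n F) (cap_rot n F) = 2"

text \<open>Induced by an orientation preserving homeomorphism of disks that preserves the labels.\<close>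

definition forest_iso :: "nat \<Rightarrow> ('a \<Rightarrow> 'b) \<Rightarrow> 'a disk_graph \<Rightarrow> 'b disk_graph \<Rightarrow> bool" where
  "forest_iso n f F F' \<longleftrightarrow>
     inj_on f (pverts (gr F)) \<and> pverts (gr F') = f ` pverts (gr F) \<and>
     parcs (gr F') = map_prod f f ` parcs (gr F) \<and>
     (\<forall>(v, w) \<in> parcs (gr F). rot F' (f v) (f w) = f (rot F v w)) \<and>
     (\<forall>i \<in> {1..n}. leaf F' i = f (leaf F i))"

definition homeomorphic_forests :: "nat \<Rightarrow> 'a disk_graph \<Rightarrow> 'b disk_graph \<Rightarrow> bool" where
  "homeomorphic_forests n F F' \<longleftrightarrow> (\<exists>f. forest_iso n f F F')"

lemma forest_isoD:
  assumes "forest_iso n f F F'"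
  shows "inj_on f (pverts (gr F))" "pverts (gr F') = f ` pverts (gr F)"
    "parcs (gr F') = map_prod f f ` parcs (gr F)"
    "\<And>v w. (v, w) \<in> parcs (gr F) \<Longrightarrow> rot F' (f v) (f w) = f (rot F v w)"
    "\<And>i. i \<in> {1..n} \<Longrightarrow> leaf F' i = f (leaf F i)"
  using assms unfolding forest_iso_def by auto


section \<open>Orthogonal Grassmannian forests\<close>

definition og_forest :: "nat \<Rightarrow> 'a disk_graph \<Rightarrow> bool" where
  "og_forest k F \<longleftrightarrow>
     planar_forest (2 * k) F \<and> (\<forall>v \<in> internal (2 * k) F. even (deg F v) \<and> deg F v \<ge> 4)"

text \<open>\<open>C\<close> is the vertex set of a component; a single edge has no internal vertex and gets 0.\<close>

definition odim_tree :: "nat \<Rightarrow> 'a disk_graph \<Rightarrow> 'a set \<Rightarrow> nat" where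
  "odim_tree k F C = (\<Sum>v \<in> C \<inter> internal (2 * k) F. deg F v - 3)"

definition odim :: "nat \<Rightarrow> 'a disk_graph \<Rightarrow> nat" where
  "odim k F = (\<Sum>C \<in> pre_digraph.sccs_verts (with_proj (gr F)). odim_tree k F C)"

text \<open>
  OG forests of type \<open>k\<close> and dimension \<open>r\<close> up to homeomorphism. Every finite graph has a copy with
  vertices in \<^typ>\<open>nat\<close>, so all homeomorphism types occur.
\<close>

definition og_forests :: "nat \<Rightarrow> nat \<Rightarrow> nat disk_graph set" where
  "og_forests k r = {F. og_forest k F \<and> odim k F = r}"

definition og_forest_types :: "nat \<Rightarrow> nat \<Rightarrow> nat disk_graph set set" where
  "og_forest_types k r =
     og_forests k r // {(F, F') \<in> og_forests k r \<times> og_forests k r. homeomorphic_forests (2 * k) F F'}"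

lemma planar_forest_rot_in:
  assumes "planar_forest n F" "(v, w) \<in> parcs (gr F)"
  shows "rot F v w \<in> pverts (gr F)"
proof -
  interpret pair_graph "gr F" using assms(1) by (simp add: planar_forest_def)
  have "v \<in> pverts (gr F)" using assms(2) by (rule in_arcsD1)
  then obtain s where s: "{w. (v, w) \<in> parcs (gr F)} = orbit (rot F v) s"
    using assms(1) unfolding planar_forest_def cyclic_on_def by blast
  then have "w \<in> orbit (rot F v) s" using assms(2) by blast
  then have "rot F v w \<in> orbit (rot F v) s" by (rule orbit.step)
  then have "(v, rot F v w) \<in> parcs (gr F)" using s by blast
  then show ?thesis by (rule in_arcsD2)
qed

lemma forest_iso_id: "forest_iso n id F F"
  by (simp add: forest_iso_def map_prod.id)

lemma forest_iso_comp:
  assumes "forest_iso n f F F'" "forest_iso n g F' F''"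
  shows "forest_iso n (g \<circ> f) F F''"
proof -
  note f = forest_isoD[OF assms(1)] and g = forest_isoD[OF assms(2)]
  have "inj_on (g \<circ> f) (pverts (gr F))" using f(1) g(1) unfolding f(2) by (rule comp_inj_on)
  moreover have "pverts (gr F'') = (g \<circ> f) ` pverts (gr F)" unfolding g(2) f(2) by (rule image_comp)
  moreover have "parcs (gr F'') = map_prod (g \<circ> f) (g \<circ> f) ` parcs (gr F)"
    unfolding g(3) f(3) by (simp add: image_comp map_prod_compose)
  moreover have "rot F'' ((g \<circ> f) v) ((g \<circ> f) w) = (g \<circ> f) (rot F v w)"
    if "(v, w) \<in> parcs (gr F)" for v w
  proof -
    have "map_prod f f (v, w) \<in> parcs (gr F')" unfolding f(3) using that by (rule imageI)
    then show ?thesis using f(4)[OF that] g(4)[of "f v" "f w"] by simp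
  qed
  moreover have "\<forall>i \<in> {1..n}. leaf F'' i = (g \<circ> f) (leaf F i)" using f(5) g(5) by simp
  ultimately show ?thesis unfolding forest_iso_def by blast
qed

lemma forest_iso_inv:
  assumes "planar_forest n F" "forest_iso n f F F'"
  shows "forest_iso n (inv_into (pverts (gr F)) f) F' F"
proof -
  interpret pair_graph "gr F" using assms(1) by (simp add: planar_forest_def)
  note f = forest_isoD[OF assms(2)]
  define g where "g = inv_into (pverts (gr F)) f"
  have g: "g (f v) = v" if "v \<in> pverts (gr F)" for v
    using f(1) that by (simp add: g_def)
  have "inj_on g (pverts (gr F'))" unfolding f(2) g_def by (rule inj_on_inv_into) simp
  moreover have "pverts (gr F) = g ` pverts (gr F')"
    unfolding f(2) image_image using g by simp
  moreover have "parcs (gr F) = map_prod g g ` parcs (gr F')"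
  proof -
    have "map_prod g g (map_prod f f e) = e" if "e \<in> parcs (gr F)" for e
      using g[OF arc_fst_in_verts[OF that]] g[OF arc_snd_in_verts[OF that]]
      by (cases e) simp
    then show ?thesis unfolding f(3) image_image by simp
  qed
  moreover have "rot F (g v') (g w') = g (rot F' v' w')" if "(v', w') \<in> parcs (gr F')" for v' w'
  proof -
    have "\<exists>e \<in> parcs (gr F). (v', w') = map_prod f f e"
      using that unfolding f(3) by (simp only: image_iff)
    then obtain v w where vw: "(v, w) \<in> parcs (gr F)" and e: "v' = f v" "w' = f w"
      by (metis map_prod_simp old.prod.exhaust prod.inject)
    show ?thesis
      unfolding e using g[OF in_arcsD1[OF vw]] g[OF in_arcsD2[OF vw]]
        g[OF planar_forest_rot_in[OF assms(1) vw]] f(4)[OF vw] by simp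
  qed
  moreover have "leaf F i = g (leaf F' i)" if "i \<in> {1..n}" for i
  proof -
    have "leaf F i \<in> pverts (gr F)"
      using assms(1) that unfolding planar_forest_def boundary_def by blast
    then show ?thesis using g f(5)[OF that] by simp
  qed
  ultimately show ?thesis unfolding forest_iso_def g_def by blast
qed

lemma equiv_homeomorphic_forests:
  "equiv (og_forests k r)
     {(F, F') \<in> og_forests k r \<times> og_forests k r. homeomorphic_forests (2 * k) F F'}"
proof (rule equivI)
  show "refl_on (og_forests k r)
     {(F, F') \<in> og_forests k r \<times> og_forests k r. homeomorphic_forests (2 * k) F F'}"
    unfolding refl_on_def homeomorphic_forests_def using forest_iso_id by blast
  show "sym {(F, F') \<in> og_forests k r \<times> og_forests k r. homeomorphic_forests (2 * k) F F'}"
    unfolding sym_def homeomorphic_forests_def og_forests_def og_forest_def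
    using forest_iso_inv by blast
  show "trans {(F, F') \<in> og_forests k r \<times> og_forests k r. homeomorphic_forests (2 * k) F F'}"
    unfolding trans_def homeomorphic_forests_def using forest_iso_comp by blast
qed auto


section \<open>Generating functions\<close>

text \<open>
  Power series in \<open>x\<close> over the field of Laurent series in \<open>q\<close>; over a field the compositional
  inverse in \<open>x\<close> is \<^const>\<open>fps_inv\<close>. Thus \<open>fls_nth (fps_nth A n) (int r)\<close> is the
  coefficient of \<open>x^n q^r\<close> in \<open>A\<close>, with \<open>x = fps_X\<close> and \<open>q = fps_const fls_X\<close>.
\<close>

type_synonym xq_series = "rat fls fps"

definition G_tree :: xq_series where
  "G_tree = fps_X ^ 2 *
     (1 + (Abs_fps (\<lambda>i. \<Sum>j = 1..i. (1 / of_nat i) * of_nat ((2 * i + j) choose (2 * i + 1))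
                                * of_nat (i choose j) * fls_X ^ (2 * i - j)) oo fps_X ^ 2))"

definition G_forest :: xq_series where
  "G_forest = fps_shift 1 (fps_inv (fps_X / (1 + G_tree)))"

lemma fps_X_mult_G_forest: "fps_X * G_forest = fps_inv (fps_X / (1 + G_tree))"
  by (rule fps_ext) (simp add: G_forest_def fps_inv_def split: nat.splits)

lemma G_forest_inverse:
  "(fps_X / (1 + G_tree)) oo (fps_X * G_forest) = fps_X"
  "(fps_X * G_forest) oo (fps_X / (1 + G_tree)) = fps_X"
proof -
  have u: "fps_nth (1 + G_tree) 0 = 1" by (simp add: G_tree_def fps_mult_nth)
  then have eq: "fps_X / (1 + G_tree) = fps_X * inverse (1 + G_tree)"
    by (intro fps_divide_unit) simp
  have n: "fps_nth (fps_X / (1 + G_tree)) 0 = 0" "fps_nth (fps_X / (1 + G_tree)) 1 \<noteq> 0"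
    using u by (simp_all add: eq)
  show "(fps_X / (1 + G_tree)) oo (fps_X * G_forest) = fps_X"
    unfolding fps_X_mult_G_forest by (rule fps_inv_right[OF n])
  show "(fps_X * G_forest) oo (fps_X / (1 + G_tree)) = fps_X"
    unfolding fps_X_mult_G_forest by (rule fps_inv[OF n])
qed

text \<open>The field \<open>\<rat>(x, q)\<close> inside the field of Laurent series in \<open>x\<close> over those in \<open>q\<close>.\<close>

definition xq_poly :: "rat poly poly \<Rightarrow> rat fls fls" where
  "xq_poly f = fps_to_fls (fps_of_poly (map_poly (\<lambda>c. fps_to_fls (fps_of_poly c)) f))"

definition rational_functions_xq :: "rat fls fls set" where
  "rational_functions_xq = {xq_poly f / xq_poly g | f g. g \<noteq> 0}"

definition algebraic_of_degree :: "'a :: field set \<Rightarrow> nat \<Rightarrow> 'a \<Rightarrow> bool" where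
  "algebraic_of_degree K d y \<longleftrightarrow>
     (\<exists>p. p \<noteq> 0 \<and> (\<forall>i. coeff p i \<in> K) \<and> poly p y = 0 \<and> degree p = d) \<and>
     (\<forall>p. p \<noteq> 0 \<and> (\<forall>i. coeff p i \<in> K) \<and> poly p y = 0 \<longrightarrow> d \<le> degree p)"

end

theory Submission
  imports Defs "HOL-Library.Sublist"
    "HOL-Computational_Algebra.Polynomial_Factorial" "HOL-Computational_Algebra.Field_as_Ring"
begin

text \<open>
  Reading the leaves \<open>1, ..., n\<close> clockwise parses a planar forest with the grammar
  \<open>F = 1 + x F U\<close>, \<open>U = x F + q U^3 + q^3 U^5 + ...\<close>: a forest is empty or starts with a leaf, followed by
  the branch \<open>U\<close> hanging at that leaf and by the remaining forest; a branch ends in a leaf, preceded by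
  the forest lying in the gap before that leaf, or it is an internal vertex with its subbranches.
  With \<open>T = x + q T^3 + q^3 T^5 + ...\<close> this gives \<open>U = T(x F)\<close>, and Lagrange inversion yields both
  \<open>x T = G_tree\<close> and \<open>F = G_forest\<close>.

  That every planar forest is parsed is where Euler characteristic 2 enters. Let \<open>\<alpha> i\<close> be the leaf that
  follows \<open>i\<close> on a walk around its tree. The faces of the capped map are the orbits of
  \<open>\<beta> i = \<alpha> i - 1\<close>. The largest leaf of each tree satisfies \<open>\<alpha> i \<le> i\<close>, and the smallest leaf of each face
  satisfies \<open>i \<le> \<beta> i\<close>; as the indices of these two kinds number at most \<open>n + 1\<close> together, the Euler
  characteristic is at most 2, with equality iff each tree and each face has exactly one of them. Hence in
  the equality case \<open>\<alpha>\<close> increases along each tree, and \<open>\<beta>\<close> descends from \<open>\<alpha> i - 1\<close> to \<open>i\<close>,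
  jumping over one tree at a time: this fills each gap with a forest.

  Irreducibility of the quartic: at \<open>q = -1\<close> it becomes \<open>x^2 Y^3 ((x^2 - 1) Y + 1)\<close>, so an Eisenstein
  argument excludes quadratic factors; at \<open>x = 1, q = -1/2\<close> it has no real root, so there is no linear factor.
\<close>

section \<open>Parse trees of planar forests\<close>

text \<open>Rooting each tree at its least leaf and listing neighbours clockwise from the parent
  removes all choice: an OG forest has exactly one parse, and once vertex names are erased (type
  \<open>unit\<close>) equality of terms is homeomorphism. Counting types becomes counting terms of
  a datatype. The obstacle is that planarity is given as one global number. The bound
  \<open>euler_le\<close> needs no planarity and works in both directions: its equality case
  produces the parse, and in the converse, that a drawn term is planar, it leaves only the task of
  exhibiting enough faces. These are found by labelling every arc with the gap along which it runs
  and checking that the face permutation preserves labels. Parsing controls only the leaves; that no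
  internal vertex is met twice is a separate argument, resting on degree at least 4. For the degree
  over the rational functions, Gauss's lemma reduces the claim to factorisations with polynomial
  coefficients.\<close>

text \<open>
  In \<open>Tree v b g\<close> the leaf \<open>v\<close> has the least label in its tree. In \<open>Tip g v\<close> the forest \<open>g\<close> fills the gap
  between the leaf \<open>v\<close> and the preceding leaf of the same tree.
\<close>

datatype 'a pforest = Empty | Tree 'a "'a branch" "'a pforest"
  and 'a branch = Tip "'a pforest" 'a | Node 'a "'a branch list"

fun apex :: "'a branch \<Rightarrow> 'a" where
  "apex (Tip g v) = v"
| "apex (Node v bs) = v"

primrec leaves_f :: "'a pforest \<Rightarrow> 'a list" and leaves_b :: "'a branch \<Rightarrow> 'a list" where
  "leaves_f Empty = []"
| "leaves_f (Tree v b g) = v # leaves_b b @ leaves_f g"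
| "leaves_b (Tip g v) = leaves_f g @ [v]"
| "leaves_b (Node v bs) = concat (map leaves_b bs)"

primrec verts_f :: "'a pforest \<Rightarrow> 'a list" and verts_b :: "'a branch \<Rightarrow> 'a list" where
  "verts_f Empty = []"
| "verts_f (Tree v b g) = v # verts_b b @ verts_f g"
| "verts_b (Tip g v) = v # verts_f g"
| "verts_b (Node v bs) = v # concat (map verts_b bs)"

text \<open>The openers are the leaves with the least label in their tree.\<close>

primrec openers_f :: "'a pforest \<Rightarrow> 'a list" and openers_b :: "'a branch \<Rightarrow> 'a list" where
  "openers_f Empty = []"
| "openers_f (Tree v b g) = v # openers_b b @ openers_f g"
| "openers_b (Tip g v) = openers_f g"
| "openers_b (Node v bs) = concat (map openers_b bs)"

primrec tips_f :: "'a pforest \<Rightarrow> 'a list" and tips_b :: "'a branch \<Rightarrow> 'a list" where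
  "tips_f Empty = []"
| "tips_f (Tree v b g) = tips_b b @ tips_f g"
| "tips_b (Tip g v) = v # tips_f g"
| "tips_b (Node v bs) = concat (map tips_b bs)"

fun edges_f :: "'a pforest \<Rightarrow> ('a \<times> 'a) list" and edges_b :: "'a \<Rightarrow> 'a branch \<Rightarrow> ('a \<times> 'a) list" where
  "edges_f Empty = []"
| "edges_f (Tree v b g) = edges_b v b @ edges_f g"
| "edges_b p (Tip g v) = (p, v) # edges_f g"
| "edges_b p (Node v bs) = (p, v) # concat (map (edges_b v) bs)"

text \<open>The neighbours of each vertex in clockwise order, starting with the parent.\<close>

fun nbrs_f :: "'a pforest \<Rightarrow> ('a \<times> 'a list) list"
  and nbrs_b :: "'a \<Rightarrow> 'a branch \<Rightarrow> ('a \<times> 'a list) list" where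
  "nbrs_f Empty = []"
| "nbrs_f (Tree v b g) = (v, [apex b]) # nbrs_b v b @ nbrs_f g"
| "nbrs_b p (Tip g v) = (v, [p]) # nbrs_f g"
| "nbrs_b p (Node v bs) = (v, p # map apex bs) # concat (map (nbrs_b v) bs)"

text \<open>The parent is one more neighbour besides the subbranches, so even degree at least 4
  becomes an odd number of subbranches, at least 3.\<close>

primrec ok_f :: "'a pforest \<Rightarrow> bool" and ok_b :: "'a branch \<Rightarrow> bool" where
  "ok_f Empty \<longleftrightarrow> True"
| "ok_f (Tree v b g) \<longleftrightarrow> ok_b b \<and> ok_f g"
| "ok_b (Tip g v) \<longleftrightarrow> ok_f g"
| "ok_b (Node v bs) \<longleftrightarrow> odd (length bs) \<and> 3 \<le> length bs \<and> list_all ok_b bs"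

text \<open>A node has degree \<open>length bs + 1\<close>, so \<open>length bs - 2\<close> is the
  degree minus 3; under \<open>ok_b\<close> the subtraction does not truncate.\<close>

primrec dim_f :: "'a pforest \<Rightarrow> nat" and dim_b :: "'a branch \<Rightarrow> nat" where
  "dim_f Empty = 0"
| "dim_f (Tree v b g) = dim_b b + dim_f g"
| "dim_b (Tip g v) = dim_f g"
| "dim_b (Node v bs) = length bs - 2 + sum_list (map dim_b bs)"

lemma pforest_branch_induct [case_names Empty Tree Tip Node]:
  assumes "P Empty" "\<And>v b g. Q b \<Longrightarrow> P g \<Longrightarrow> P (Tree v b g)"
    "\<And>g v. P g \<Longrightarrow> Q (Tip g v)" "\<And>v bs. (\<And>b. b \<in> set bs \<Longrightarrow> Q b) \<Longrightarrow> Q (Node v bs)"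
  shows "P f" "Q b"
  using pforest_branch.induct[of P Q f b, OF assms] by blast+

section \<open>Relabelling parse trees and counting their vertices\<close>

lemma root_map [simp]: "apex (map_branch \<phi> b) = \<phi> (apex b)"
  by (cases b) auto

lemma leaves_map [simp]:
  fixes f :: "'a pforest" and b :: "'a branch"
  shows
  "leaves_f (map_pforest \<phi> f) = map \<phi> (leaves_f f)"
  "leaves_b (map_branch \<phi> b) = map \<phi> (leaves_b b)"
  by (induct f and b rule: pforest_branch_induct)
    (auto simp: map_concat comp_def intro!: arg_cong[of _ _ concat])

lemma verts_map [simp]:
  fixes f :: "'a pforest" and b :: "'a branch"
  shows
  "verts_f (map_pforest \<phi> f) = map \<phi> (verts_f f)"
  "verts_b (map_branch \<phi> b) = map \<phi> (verts_b b)"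
  by (induct f and b rule: pforest_branch_induct)
    (auto simp: map_concat comp_def intro!: arg_cong[of _ _ concat])

lemma nbrs_map [simp]:
  fixes f :: "'a pforest" and b :: "'a branch"
  shows
  "nbrs_f (map_pforest \<phi> f) = map (map_prod \<phi> (map \<phi>)) (nbrs_f f)"
  "nbrs_b (\<phi> p) (map_branch \<phi> b) = map (map_prod \<phi> (map \<phi>)) (nbrs_b p b)"
  by (induct f and b arbitrary: and p rule: pforest_branch_induct)
    (auto simp: map_concat comp_def intro!: arg_cong[of _ _ concat])

lemma ok_map [simp]:
  fixes f :: "'a pforest" and b :: "'a branch"
  shows
  "ok_f (map_pforest \<phi> f) = ok_f f" "ok_b (map_branch \<phi> b) = ok_b b"
  by (induct f and b rule: pforest_branch_induct) (auto simp: list_all_iff)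

lemma dim_map [simp]:
  fixes f :: "'a pforest" and b :: "'a branch"
  shows
  "dim_f (map_pforest \<phi> f) = dim_f f" "dim_b (map_branch \<phi> b) = dim_b b"
  by (induct f and b rule: pforest_branch_induct)
    (auto simp: comp_def intro!: arg_cong[of _ _ sum_list])

lemma mset_concat_map: "mset (concat (map h xs)) = (\<Sum>x\<leftarrow>xs. mset (h x))"
  by (induct xs) auto

lemma sum_list_mset_add:
  "(\<Sum>x\<leftarrow>xs. (h x :: 'a multiset) + k x) = (\<Sum>x\<leftarrow>xs. h x) + (\<Sum>x\<leftarrow>xs. k x)"
  by (induct xs) auto

text \<open>Every vertex except the openers is the lower end of exactly one edge, the one to its
  parent. Taking sizes, vertices exceed edges by the number of trees.\<close>

lemma mset_verts_edges:
  fixes f :: "'a pforest" and b :: "'a branch"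
  shows
  "mset (verts_f f) = mset (openers_f f) + mset (map snd (edges_f f))"
  "mset (verts_b b) = mset (openers_b b) + mset (map snd (edges_b p b))"
proof (induct f and b arbitrary: and p rule: pforest_branch_induct)
  case (Tree v b g)
  then show ?case using Tree(1)[of v] by simp
next
  case (Node v bs)
  have "(\<Sum>b\<leftarrow>bs. mset (verts_b b)) = (\<Sum>b\<leftarrow>bs. mset (openers_b b) + mset (map snd (edges_b v b)))"
    using Node by (intro arg_cong[of _ _ sum_list] map_cong) auto
  then show ?case by (simp add: map_concat mset_concat_map comp_def sum_list_mset_add)
qed auto

lemma mset_leaves:
  fixes f :: "'a pforest" and b :: "'a branch"
  shows
  "mset (leaves_f f) = mset (openers_f f) + mset (tips_f f)"
  "mset (leaves_b b) = mset (openers_b b) + mset (tips_b b)"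
proof (induct f and b rule: pforest_branch_induct)
  case (Node v bs)
  have "(\<Sum>b\<leftarrow>bs. mset (leaves_b b)) = (\<Sum>b\<leftarrow>bs. mset (openers_b b) + mset (tips_b b))"
    using Node by (intro arg_cong[of _ _ sum_list] map_cong) auto
  then show ?case by (simp add: mset_concat_map sum_list_mset_add)
qed auto

lemma subset_mset_concat_map:
  "(\<And>x. x \<in> set xs \<Longrightarrow> mset (h x) \<subseteq># mset (k x)) \<Longrightarrow> mset (concat (map h xs)) \<subseteq># mset (concat (map k xs))"
  by (induct xs) (auto intro: subset_mset.add_mono)

lemma mset_leaves_verts:
  fixes f :: "'a pforest" and b :: "'a branch"
  shows
  "mset (leaves_f f) \<subseteq># mset (verts_f f)" "mset (leaves_b b) \<subseteq># mset (verts_b b)"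
proof (induct f and b rule: pforest_branch_induct)
  case (Node v bs)
  then have "mset (concat (map leaves_b bs)) \<subseteq># mset (concat (map verts_b bs))"
    by (rule subset_mset_concat_map)
  moreover have "\<dots> \<subseteq># mset (verts_b (Node v bs))"
    by (simp add: mset_subset_eq_add_mset_cancel subset_mset.less_imp_le)
  ultimately show ?case using subset_mset.order_trans by fastforce
qed (auto intro: subset_mset.add_mono)

lemma set_leaves_verts:
  fixes f :: "'a pforest" and b :: "'a branch"
  shows
    "set (leaves_f f) \<subseteq> set (verts_f f)" "set (leaves_b b) \<subseteq> set (verts_b b)"
  using mset_leaves_verts set_mset_mono by fastforce+

lemma distinct_leaves: "distinct (verts_f f) \<Longrightarrow> distinct (leaves_f f)"
  using mset_leaves_verts(1)[of f] by (metis mset_subset_eq_exists_conv distinct_append ex_mset mset_append mset_eq_imp_distinct_iff)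

lemma root_in_verts [simp]: "apex b \<in> set (verts_b b)"
  by (cases b) auto

lemma map_fst_nbrs:
  fixes f :: "'a pforest" and b :: "'a branch"
  shows
    "map fst (nbrs_f f) = verts_f f" "map fst (nbrs_b p b) = verts_b b"
  by (induct f and b arbitrary: and p rule: pforest_branch_induct)
    (auto simp: map_concat comp_def intro!: arg_cong[of _ _ concat])

definition arcs_of :: "('a \<times> 'a list) list \<Rightarrow> ('a \<times> 'a) set" where
  "arcs_of N = {(v, w). \<exists>ns. (v, ns) \<in> set N \<and> w \<in> set ns}"

lemma arcs_of_simps [simp]:
  "arcs_of [] = {}" "arcs_of ((v, ns) # N) = {v} \<times> set ns \<union> arcs_of N"
  "arcs_of (N @ N') = arcs_of N \<union> arcs_of N'" "arcs_of (concat Ns) = (\<Union>N \<in> set Ns. arcs_of N)"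
  by (auto simp: arcs_of_def)

text \<open>The arc from \<open>p\<close> down to the branch stands in the neighbour list of
  \<open>p\<close>, outside the branch; hence the inserted pair in the second part.\<close>

lemma arcs_of_nbrs:
  fixes f :: "'a pforest" and b :: "'a branch"
  shows
  "arcs_of (nbrs_f f) = set (edges_f f) \<union> (set (edges_f f))\<inverse>"
  "insert (p, apex b) (arcs_of (nbrs_b p b)) = set (edges_b p b) \<union> (set (edges_b p b))\<inverse>"
proof (induct f and b arbitrary: and p rule: pforest_branch_induct)
  case (Tree v b g)
  then show ?case using Tree(1)[of v] by auto
next
  case (Node v bs)
  have "arcs_of (nbrs_b p (Node v bs)) = {(v, p)} \<union> (\<Union>b \<in> set bs. insert (v, apex b) (arcs_of (nbrs_b v b)))"
    by auto
  also have "\<dots> = {(v, p)} \<union> (\<Union>b \<in> set bs. set (edges_b v b) \<union> (set (edges_b v b))\<inverse>)"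
    using Node[of _ v] by simp
  also have "\<dots> = {(v, p)} \<union> (\<Union>b \<in> set bs. set (edges_b v b)) \<union> (\<Union>b \<in> set bs. set (edges_b v b))\<inverse>"
    by blast
  finally have "insert (p, apex (Node v bs)) (arcs_of (nbrs_b p (Node v bs))) =
      {(p, v)} \<union> ({(v, p)} \<union> (\<Union>b \<in> set bs. set (edges_b v b)) \<union> (\<Union>b \<in> set bs. set (edges_b v b))\<inverse>)"
    by (simp add: insert_commute)
  moreover have "set (edges_b p (Node v bs)) = {(p, v)} \<union> (\<Union>b \<in> set bs. set (edges_b v b))" by simp
  moreover have "{(p, v)} \<union> ({(v, p)} \<union> A \<union> A\<inverse>) = ({(p, v)} \<union> A) \<union> ({(p, v)} \<union> A)\<inverse>"
    for A :: "('a \<times> 'a) set" by auto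
  ultimately show ?case by (simp only:)
qed auto

text \<open>The shape fixes which places of the vertex list belong to which part of the term. Vertex
  lists of equal shapes therefore correspond entry by entry and determine the relabelling.\<close>

lemma shape_relabel:
  fixes f :: "'a pforest" and b :: "'a branch" and f' :: "'b pforest" and b' :: "'b branch"
  shows "map_pforest (\<lambda>_. ()) f = map_pforest (\<lambda>_. ()) f' \<Longrightarrow>
     length (verts_f f) = length (verts_f f') \<and> (map \<phi> (verts_f f) = verts_f f' \<longrightarrow> f' = map_pforest \<phi> f)"
  "map_branch (\<lambda>_. ()) b = map_branch (\<lambda>_. ()) b' \<Longrightarrow>
     length (verts_b b) = length (verts_b b') \<and> (map \<phi> (verts_b b) = verts_b b' \<longrightarrow> b' = map_branch \<phi> b)"
proof (induct f and b arbitrary: f' and b' rule: pforest_branch_induct)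
  case Empty
  then show ?case by (cases f') auto
next
  case (Tree v b g)
  then obtain v' b1 g' where [simp]: "f' = Tree v' b1 g'" by (cases f') auto
  show ?case using Tree(1)[of b1] Tree(2)[of g'] Tree(3) by auto
next
  case (Tip g v)
  then obtain v' g' where [simp]: "b' = Tip g' v'" by (cases b') auto
  show ?case using Tip(1)[of g'] Tip(2) by auto
next
  case (Node v bs)
  then obtain v' bs' where [simp]: "b' = Node v' bs'" by (cases b') auto
  have "length (concat (map verts_b bs)) = length (concat (map verts_b bs')) \<and>
    (map \<phi> (concat (map verts_b bs)) = concat (map verts_b bs') \<longrightarrow> bs' = map (map_branch \<phi>) bs)"
    if "map (map_branch (\<lambda>_. ())) bs = map (map_branch (\<lambda>_. ())) bs'"
    using that Node(1)
  proof (induct bs arbitrary: bs')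
    case (Cons a bs)
    then obtain a' cs' where [simp]: "bs' = a' # cs'" by (cases bs') auto
    show ?case using Cons(1)[of cs'] Cons(2) Cons(3)[of a a'] Cons(3) by auto
  qed auto
  then show ?case using Node(2) by auto
qed

lemma same_shape_relabel:
  assumes "map_pforest (\<lambda>_. ()) f = map_pforest (\<lambda>_. ()) f'" "distinct (verts_f f)"
  obtains \<phi> where "f' = map_pforest \<phi> f"
proof -
  define \<phi> where "\<phi> x = the (map_of (zip (verts_f f) (verts_f f')) x)" for x
  have len: "length (verts_f f) = length (verts_f f')" using shape_relabel(1)[OF assms(1)] by blast
  have "map \<phi> (verts_f f) = verts_f f'"
    using len assms(2) by (intro nth_equalityI) (auto simp: \<phi>_def map_of_zip_nth)
  then show ?thesis using shape_relabel(1)[OF assms(1), of \<phi>] that by blast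
qed

text \<open>Consecutive numbers are distinct names, as needed to draw a given shape as a graph on
  natural numbers.\<close>

lemma exists_labelling:
  fixes f :: "unit pforest" and b :: "unit branch"
  shows
  "\<exists>f'. map_pforest (\<lambda>_. ()) f' = f \<and> verts_f f' = [k..<k + length (verts_f f)]"
  "\<exists>b'. map_branch (\<lambda>_. ()) b' = b \<and> verts_b b' = [k..<k + length (verts_b b)]"
proof (induct f and b arbitrary: k and k rule: pforest_branch_induct)
  case Empty
  then show ?case by (intro exI[of _ Empty]) simp
next
  case (Tree v b g)
  obtain b' where "map_branch (\<lambda>_. ()) b' = b" "verts_b b' = [k + 1..<k + 1 + length (verts_b b)]"
    using Tree(1) by blast
  moreover obtain g' where "map_pforest (\<lambda>_. ()) g' = g" "verts_f g' = [k + 1 + length (verts_b b)..<k + 1 + length (verts_b b) + length (verts_f g)]"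
    using Tree(2) by blast
  moreover have "[k..<k + length (verts_f (Tree v b g))] = k # [k + 1..<k + 1 + length (verts_b b)]
      @ [k + 1 + length (verts_b b)..<k + 1 + length (verts_b b) + length (verts_f g)]"
    by (subst upt_add_eq_append[symmetric]) (auto simp: upt_conv_Cons add.assoc simp del: upt_Suc)
  ultimately show ?case by (intro exI[of _ "Tree k b' g'"]) (simp del: upt_Suc)
next
  case (Tip g v)
  obtain g' where "map_pforest (\<lambda>_. ()) g' = g" "verts_f g' = [k + 1..<k + 1 + length (verts_f g)]"
    using Tip(1) by blast
  then show ?case by (intro exI[of _ "Tip g' k"]) (simp add: upt_conv_Cons del: upt_Suc)
next
  case (Node v bs)
  have "\<exists>bs'. map (map_branch (\<lambda>_. ())) bs' = bs \<and> concat (map verts_b bs') = [j..<j + length (concat (map verts_b bs))]" for j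
    using Node
  proof (induct bs arbitrary: j)
    case (Cons b bs)
    obtain b' where b': "map_branch (\<lambda>_. ()) b' = b" "verts_b b' = [j..<j + length (verts_b b)]"
      using Cons(2)[of b] by auto
    obtain bs' where bs': "map (map_branch (\<lambda>_. ())) bs' = bs"
      "concat (map verts_b bs') = [j + length (verts_b b)..<j + length (verts_b b) + length (concat (map verts_b bs))]"
      using Cons(1)[of "j + length (verts_b b)"] Cons(2) by auto
    have "[j..<j + length (concat (map verts_b (b # bs)))] = [j..<j + length (verts_b b)]
      @ [j + length (verts_b b)..<j + length (verts_b b) + length (concat (map verts_b bs))]"
      by (subst upt_add_eq_append[symmetric]) (auto simp: add.assoc simp del: upt_Suc)
    then show ?case using b' bs' by (intro exI[of _ "b' # bs'"]) simp
  qed auto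
  then obtain bs' where "map (map_branch (\<lambda>_. ())) bs' = bs" "concat (map verts_b bs') = [k + 1..<k + 1 + length (concat (map verts_b bs))]"
    by blast
  then show ?case by (intro exI[of _ "Node k bs'"]) (simp add: upt_conv_Cons del: upt_Suc)
qed

section \<open>Forests drawn in the disk\<close>

text \<open>The equation with \<open>rotate1\<close> says that \<open>ns\<close> is one full
  clockwise turn: the rotation sends each entry to the next and the last to the first.\<close>

definition draws :: "nat \<Rightarrow> 'a disk_graph \<Rightarrow> 'a pforest \<Rightarrow> bool" where
  "draws n F f \<longleftrightarrow> distinct (verts_f f) \<and> pverts (gr F) = set (verts_f f) \<and>
     parcs (gr F) = arcs_of (nbrs_f f) \<and> map (leaf F) [1..<Suc n] = leaves_f f \<and>
     (\<forall>(v, ns) \<in> set (nbrs_f f). map (rot F v) ns = rotate1 ns)"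

lemma drawsD:
  assumes "draws n F f"
  shows "distinct (verts_f f)" "pverts (gr F) = set (verts_f f)"
    "parcs (gr F) = arcs_of (nbrs_f f)" "map (leaf F) [1..<Suc n] = leaves_f f"
    "\<And>v ns. (v, ns) \<in> set (nbrs_f f) \<Longrightarrow> map (rot F v) ns = rotate1 ns"
  using assms unfolding draws_def by auto

lemma arcs_of_map: "arcs_of (map (map_prod \<phi> (map \<phi>)) N) = map_prod \<phi> \<phi> ` arcs_of N"
  by (induct N) (auto simp: image_Un)

lemma draws_forest_iso:
  assumes "draws n F f" "forest_iso n \<phi> F F'"
  shows "draws n F' (map_pforest \<phi> f)"
proof -
  note f = drawsD[OF assms(1)] and i = forest_isoD[OF assms(2)]
  have "map (leaf F') [1..<Suc n] = map \<phi> (map (leaf F) [1..<Suc n])"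
    using i(5) by (auto simp del: upt_Suc)
  then have "map (leaf F') [1..<Suc n] = leaves_f (map_pforest \<phi> f)"
    unfolding f(4) by simp
  moreover have "map (rot F' (\<phi> v)) (map \<phi> ns) = rotate1 (map \<phi> ns)" if "(v, ns) \<in> set (nbrs_f f)" for v ns
  proof -
    have "map (rot F' (\<phi> v)) (map \<phi> ns) = map \<phi> (map (rot F v) ns)"
      using i(4) that unfolding f(3) arcs_of_def by auto
    then show ?thesis using f(5)[OF that] by (simp add: rotate1_map)
  qed
  ultimately show ?thesis unfolding draws_def using f(1-3) i(1)
    by (auto simp: distinct_map i(2,3) arcs_of_map simp del: upt_Suc)
qed

lemma draws_same_shape:
  assumes "draws n F f" "draws n F' (map_pforest \<phi> f)"
  shows "forest_iso n \<phi> F F'"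
proof -
  note f = drawsD[OF assms(1)] and f' = drawsD[OF assms(2)]
  have "rot F' (\<phi> v) (\<phi> w) = \<phi> (rot F v w)" if vw: "(v, w) \<in> parcs (gr F)" for v w
  proof -
    obtain ns where ns: "(v, ns) \<in> set (nbrs_f f)" "w \<in> set ns"
      using vw unfolding f(3) arcs_of_def by auto
    have "(\<phi> v, map \<phi> ns) \<in> set (nbrs_f (map_pforest \<phi> f))" using ns(1) by force
    then have "map (rot F' (\<phi> v)) (map \<phi> ns) = map \<phi> (map (rot F v) ns)"
      using f'(5) f(5)[OF ns(1)] by (metis rotate1_map)
    then show ?thesis using ns(2) by simp
  qed
  moreover have "map (leaf F') [1..<Suc n] = map (\<lambda>i. \<phi> (leaf F i)) [1..<Suc n]"
    unfolding f'(4) leaves_map f(4)[symmetric] by simp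
  then have "leaf F' i = \<phi> (leaf F i)" if "i \<in> {1..n}" for i
    using that by (auto simp del: upt_Suc)
  ultimately show ?thesis unfolding forest_iso_def
    using f(1) f'(1,2,3) f(2,3) by (auto simp: distinct_map arcs_of_map)
qed

section \<open>Uniqueness of the parse\<close>

lemma distinct_roots: "distinct (concat (map verts_b bs)) \<Longrightarrow> distinct (map apex bs)"
proof (induct bs)
  case (Cons b bs)
  have "apex b \<notin> apex ` set bs"
  proof
    assume "apex b \<in> apex ` set bs"
    then obtain b' where "b' \<in> set bs" "apex b \<in> set (verts_b b')" using root_in_verts by force
    then show False using Cons(2) root_in_verts[of b] by (auto simp: disjoint_iff)
  qed
  then show ?case using Cons by auto
qed auto

lemma distinct_nbrs:
  fixes f :: "'a pforest" and b :: "'a branch"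
  shows "distinct (verts_f f) \<Longrightarrow> (v, ns) \<in> set (nbrs_f f) \<Longrightarrow> distinct ns"
  "distinct (verts_b b) \<Longrightarrow> p \<notin> set (verts_b b) \<Longrightarrow> (v, ns) \<in> set (nbrs_b p b) \<Longrightarrow> distinct ns"
proof (induct f and b arbitrary: and p rule: pforest_branch_induct)
  case (Tree u b g)
  then show ?case using Tree(1)[of u] by auto
next
  case (Node u bs)
  have r: "distinct (map apex bs)" "p \<notin> apex ` set bs"
    using Node(2,3) distinct_roots[of bs] root_in_verts by fastforce+
  show ?case
  proof (cases "(v, ns) = (u, p # map apex bs)")
    case False
    then obtain b where "b \<in> set bs" "(v, ns) \<in> set (nbrs_b u b)" using Node(4) by auto
    moreover have "distinct (verts_b b)" "u \<notin> set (verts_b b)"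
      using Node(2) \<open>b \<in> set bs\<close> by (auto simp: distinct_concat_iff)
    ultimately show ?thesis using Node(1) by blast
  qed (use r in auto)
qed auto

lemma nbrs_unique: "distinct (verts_f f) \<Longrightarrow> (v, ns) \<in> set (nbrs_f f) \<Longrightarrow> (v, ns') \<in> set (nbrs_f f) \<Longrightarrow> ns = ns'"
  using map_fst_nbrs(1)[of f] by (metis eq_key_imp_eq_value)

lemma draws_nbrs:
  assumes "draws n F f" "(v, ns) \<in> set (nbrs_f f)"
  shows "distinct ns" "set ns = {w. (v, w) \<in> parcs (gr F)}"
proof -
  show "distinct ns" using distinct_nbrs(1)[OF drawsD(1)[OF assms(1)] assms(2)] .
  have "(v, w) \<in> parcs (gr F) \<longleftrightarrow> w \<in> set ns" for w
    using nbrs_unique[OF drawsD(1)[OF assms(1)] assms(2)] assms(2)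
    unfolding drawsD(3)[OF assms(1)] arcs_of_def mem_Collect_eq prod.case by metis
  then show "set ns = {w. (v, w) \<in> parcs (gr F)}" by blast
qed

text \<open>Each entry is the image of its predecessor, so the first entry determines the list. In a
  parse the first entry is the parent, already known, which forces the order of the
  children.\<close>

lemma rotate1_unique:
  assumes "map r xs = rotate1 xs" "map r ys = rotate1 ys" "distinct xs" "distinct ys"
    "set xs = set ys" "hd xs = hd ys"
  shows "xs = ys"
proof (rule nth_equalityI)
  show len: "length xs = length ys" using assms(3-5) by (metis distinct_card)
  show "xs ! i = ys ! i" if "i < length xs" for i
    using that
  proof (induct i)
    case 0
    then show ?case using assms(6) len by (metis hd_conv_nth length_0_conv less_nat_zero_code)
  next
    case (Suc i)
    have "zs ! Suc i = r (zs ! i)" if "map r zs = rotate1 zs" "Suc i < length zs" for zs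
    proof -
      have "r (zs ! i) = rotate1 zs ! i" using that by (metis Suc_lessD nth_map)
      then show ?thesis using that by (simp add: nth_rotate1)
    qed
    then show ?case using Suc assms(1,2) len by simp
  qed
qed

text \<open>Reading is deterministic: a vertex with one neighbour must be a \<open>Tip\<close>, any
  other a \<open>Node\<close> whose children are forced by the rotation. In the second part
  \<open>s\<close> and \<open>s'\<close> are the unread leaves, so that the claim also says that
  both readings stop at the same place.\<close>

lemma deterministic_aux:
  fixes f f' :: "'a pforest" and b b' :: "'a branch"
  assumes C: "\<And>v ns. C (v, ns) \<Longrightarrow> distinct ns \<and> set ns = nb v \<and> map (r v) ns = rotate1 ns"
  shows "ok_f f \<Longrightarrow> ok_f f' \<Longrightarrow> \<forall>x \<in> set (nbrs_f f). C x \<Longrightarrow> \<forall>x \<in> set (nbrs_f f'). C x \<Longrightarrow>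
      distinct (leaves_f f) \<Longrightarrow> leaves_f f = leaves_f f' \<Longrightarrow> f = f'"
    "ok_b b \<Longrightarrow> ok_b b' \<Longrightarrow> \<forall>x \<in> set (nbrs_b p b). C x \<Longrightarrow> \<forall>x \<in> set (nbrs_b p b'). C x \<Longrightarrow>
      apex b = apex b' \<Longrightarrow> distinct (leaves_b b @ s) \<Longrightarrow> leaves_b b @ s = leaves_b b' @ s' \<Longrightarrow> b = b' \<and> s = s'"
proof (induct f and b arbitrary: f' and b' p s s' rule: pforest_branch_induct)
  case Empty
  then show ?case by (cases f') auto
next
  case (Tree v b g)
  then obtain v' b1 g' where f': "f' = Tree v' b1 g'" by (cases f') auto
  have v: "v' = v" using Tree(8) f' by simp
  have rb: "apex b = apex b1"
    using C[of v "[apex b]"] C[of v "[apex b1]"] Tree(5,6) by (auto simp: f' v)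
  have "b = b1 \<and> leaves_f g = leaves_f g'"
  proof (rule Tree(1)[of b1 v])
    show "distinct (leaves_b b @ leaves_f g)" using Tree(7) by simp
    show "leaves_b b @ leaves_f g = leaves_b b1 @ leaves_f g'" using Tree(8) by (simp add: f')
  qed (use Tree(3-6) rb in \<open>auto simp: f' v\<close>)
  then show ?case using Tree(2)[of g'] Tree(3-8) by (simp add: f' v)
next
  case (Tip g v)
  show ?case
  proof (cases b')
    case (Tip g' v')
    have eq: "leaves_f g @ v # s = leaves_f g' @ v # s'" using Tip.prems(5,7) by (simp add: Tip)
    have d: "distinct (leaves_f g @ v # s)" using Tip.prems(6) by simp
    \<comment> \<open>The leaf \<open>v\<close> occurs only once, so in both readings it marks the
      end of the gap forest.\<close>
    have "v \<notin> set (leaves_f g)" "v \<notin> set s" using d by auto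
    then have "leaves_f g = leaves_f g'" "s = s'"
      using eq append_Cons_eq_iff[of v "leaves_f g" s] by auto
    then show ?thesis using Tip.hyps[of g'] Tip.prems(1-6) by (auto simp: Tip)
  next
    case (Node v' bs')
    have "C (v, [p])" "C (v, p # map apex bs')" using Tip.prems(3-5) by (simp_all add: Node)
    then have "length [p] = length (p # map apex bs')" using C distinct_card by metis
    then show ?thesis using Tip.prems(2) by (simp add: Node)
  qed
next
  case (Node v bs)
  show ?case
  proof (cases b')
    case (Tip g' v')
    have "C (v, [p])" "C (v, p # map apex bs)" using Node.prems(3-5) by (simp_all add: Tip)
    then have "length [p] = length (p # map apex bs)" using C distinct_card by metis
    then show ?thesis using Node.prems(1) by simp
  next
    case (Node v' bs')
    have "C (v, p # map apex bs)" "C (v, p # map apex bs')" using Node.prems(3-5) by (simp_all add: Node)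
    then have "p # map apex bs = p # map apex bs'" using C rotate1_unique by (metis list.sel(1))
    then have rt: "map apex bs = map apex bs'" by simp
    have "list_all ok_b bs" "list_all ok_b bs'" "\<forall>b \<in> set bs. \<forall>x \<in> set (nbrs_b v b). C x"
      "\<forall>b \<in> set bs'. \<forall>x \<in> set (nbrs_b v b). C x"
      using Node.prems(1-5) by (simp_all add: Node)
    moreover have "distinct (concat (map leaves_b bs) @ s)" using Node.prems(6) by simp
    moreover have "concat (map leaves_b bs) @ s = concat (map leaves_b bs') @ s'"
      using Node.prems(7) by (simp add: Node)
    ultimately have "bs = bs' \<and> s = s'" using rt Node.hyps
    proof (induct bs arbitrary: bs')
      case Nil
      show ?case using Nil(6,7) by simp
    next
      case (Cons a bs)
      obtain a' cs where bs': "bs' = a' # cs" using Cons.prems(7) by (cases bs') simp_all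
      have "a = a' \<and> concat (map leaves_b bs) @ s = concat (map leaves_b cs) @ s'"
      proof (rule Cons.prems(8)[of a a' v])
        show "distinct (leaves_b a @ concat (map leaves_b bs) @ s)" using Cons.prems(5) by simp
        show "leaves_b a @ concat (map leaves_b bs) @ s = leaves_b a' @ concat (map leaves_b cs) @ s'"
          using Cons.prems(6) by (simp add: bs')
      qed (use Cons.prems(1-4,7) in \<open>auto simp: bs'\<close>)
      moreover from this have "bs = cs \<and> s = s'"
      proof (intro Cons.hyps[of cs])
        show "distinct (concat (map leaves_b bs) @ s)" using Cons.prems(5) by simp
        show "b = b' \<and> s = s'" if "b \<in> set bs" "ok_b b" "ok_b b'" "\<forall>x \<in> set (nbrs_b p b). C x"
          "\<forall>x \<in> set (nbrs_b p b'). C x" "apex b = apex b'" "distinct (leaves_b b @ s)"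
          "leaves_b b @ s = leaves_b b' @ s'" for b b' p s s'
          using that by (intro Cons.prems(8)) simp_all
      qed (use Cons.prems(1-4,7) in \<open>simp_all add: bs'\<close>)
      ultimately show ?case by (simp add: bs')
    qed
    then show ?thesis using Node.prems(5) by (simp add: Node)
  qed
qed

lemma draws_unique:
  assumes "draws n F f" "draws n F f'" "ok_f f" "ok_f f'"
  shows "f = f'"
proof (rule deterministic_aux(1))
  let ?C = "\<lambda>x. x \<in> set (nbrs_f f) \<or> x \<in> set (nbrs_f f')"
  show "distinct ns \<and> set ns = {w. (v, w) \<in> parcs (gr F)} \<and> map (rot F v) ns = rotate1 ns"
    if "?C (v, ns)" for v ns
    using that draws_nbrs[OF assms(1)] draws_nbrs[OF assms(2)] drawsD(5)[OF assms(1)] drawsD(5)[OF assms(2)]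
    by blast
  show "\<forall>x \<in> set (nbrs_f f). ?C x" "\<forall>x \<in> set (nbrs_f f'). ?C x" by simp_all
  show "distinct (leaves_f f)" using drawsD(1)[OF assms(1)] by (rule distinct_leaves)
  show "leaves_f f = leaves_f f'" using drawsD(4)[OF assms(1)] drawsD(4)[OF assms(2)] by simp
qed fact+

section \<open>Tours of the trees\<close>

lemma cyclic_on_list:
  assumes "cyclic_on f S" "p \<in> S"
  obtains ws where "distinct (p # ws)" "set (p # ws) = S" "map f (p # ws) = rotate1 (p # ws)"
proof -
  have S: "S = orbit f p" using orbit_cyclic_eq3[OF assms] by simp
  then have p: "p \<in> orbit f p" using assms(2) by simp
  obtain k where k: "funpow_dist1 f p p = Suc k" by blast
  let ?k = "Suc k"
  let ?ns = "map (\<lambda>i. (f ^^ i) p) [0..<?k]"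
  have ns: "?ns = p # map (\<lambda>i. (f ^^ i) p) [1..<?k]"
    by (simp add: upt_conv_Cons del: upt_Suc)
  have "distinct ?ns" using inj_on_funpow_dist1[OF p] unfolding k by (simp add: distinct_map del: upt_Suc)
  moreover have "set ?ns = S" unfolding S using orbit_conv_funpow_dist1[OF p] unfolding k by (simp del: upt_Suc)
  moreover have "map f ?ns = map (\<lambda>i. (f ^^ i) p) (map Suc [0..<?k])" by (simp del: upt_Suc)
  then have "map f ?ns = map (\<lambda>i. (f ^^ i) p) [1..<?k] @ [(f ^^ ?k) p]"
    by (simp add: map_Suc_upt del: funpow.simps)
  then have "map f ?ns = rotate1 ?ns"
    unfolding funpow_dist1_prop[OF p, unfolded k] unfolding ns rotate1.simps by simp
  ultimately show thesis using that[of "map (\<lambda>i. (f ^^ i) p) [1..<?k]"] unfolding ns by blast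
qed

text \<open>The Euler characteristic is kept apart: walks and faces are studied here both in order
  to exploit the value 2 and in order to prove it for drawn terms.\<close>

locale disk_forest =
  fixes n :: nat and F :: "'a disk_graph"
  assumes graph: "pair_graph (gr F)"
    and acyclic: "\<And>p. pre_digraph.cycle (with_proj (gr F)) p \<Longrightarrow> length p \<le> 2"
    and inj_leaf: "inj_on (leaf F) {1..n}"
    and boundary_sub: "boundary n F \<subseteq> pverts (gr F)"
    and deg_boundary: "\<And>v. v \<in> boundary n F \<Longrightarrow> deg F v = 1"
    and reach_boundary: "\<And>v. v \<in> pverts (gr F) \<Longrightarrow> \<exists>w \<in> boundary n F. v \<rightarrow>\<^sup>*\<^bsub>with_proj (gr F)\<^esub> w"
    and cyclic_rot: "\<And>v. v \<in> pverts (gr F) \<Longrightarrow> cyclic_on (rot F v) {w. (v, w) \<in> parcs (gr F)}"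
    and n_pos: "1 \<le> n"
    and deg_internal: "\<And>v. v \<in> internal n F \<Longrightarrow> 4 \<le> deg F v"
begin

sublocale G: pair_graph "gr F" by (rule graph)

abbreviation "A \<equiv> parcs (gr F)"
abbreviation "V \<equiv> pverts (gr F)"
abbreviation "B \<equiv> boundary n F"
abbreviation "N v \<equiv> {w. (v, w) \<in> parcs (gr F)}"

lemma arc_sym: "(v, w) \<in> A \<Longrightarrow> (w, v) \<in> A"
  using G.pair_sym_arcs by (auto simp: symmetric_def sym_def)

lemma arc_verts: "(v, w) \<in> A \<Longrightarrow> v \<in> V \<and> w \<in> V \<and> v \<noteq> w"
  using G.wellformed' G.no_loops' by blast

lemma finite_V: "finite V" and finite_A: "finite A"
  using G.pair_finite_verts G.pair_finite_arcs .

lemma finite_N: "finite (N v)"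
  by (rule finite_subset[OF _ finite_V]) (use arc_verts in auto)

lemma deg_card: "deg F v = card (N v)"
proof -
  have "out_arcs (with_proj (gr F)) v = Pair v ` N v" by (auto simp: out_arcs_def)
  then show ?thesis by (simp add: out_degree_def card_image inj_on_def)
qed

lemma boundary_N: "v \<in> B \<Longrightarrow> (v, w) \<in> A \<Longrightarrow> N v = {w}"
  using deg_boundary[of v] unfolding deg_card by (metis card_1_singletonE mem_Collect_eq singletonD)

definition nb :: "'a \<Rightarrow> 'a" where "nb v = (THE w. (v, w) \<in> A)"

lemma nb_eq: "v \<in> B \<Longrightarrow> (v, w) \<in> A \<Longrightarrow> nb v = w"
  using boundary_N unfolding nb_def by blast

lemma nb_arc: assumes "v \<in> B" shows "(v, nb v) \<in> A"
proof -
  have "N v \<noteq> {}" using deg_boundary[OF assms] unfolding deg_card by (metis card.empty zero_neq_one)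
  then obtain w where "(v, w) \<in> A" by blast
  then show ?thesis using nb_eq[OF assms] by simp
qed

lemma internal_N: "v \<in> V \<Longrightarrow> v \<notin> B \<Longrightarrow> 4 \<le> card (N v)"
  using deg_internal[of v] unfolding deg_card internal_def by blast

lemma rot_arc: "(v, w) \<in> A \<Longrightarrow> (v, rot F v w) \<in> A"
  using cyclic_rot[of v] cyclic_on_inI[of "rot F v" "N v" w] arc_verts by blast

lemma rot_inj: assumes "v \<in> V" shows "inj_on (rot F v) (N v)"
proof (rule eq_card_imp_inj_on[OF finite_N])
  have "rot F v ` N v = N v"
  proof
    show "rot F v ` N v \<subseteq> N v" using rot_arc by blast
    show "N v \<subseteq> rot F v ` N v"
    proof
      fix w assume "w \<in> N v"
      then have "w \<in> orbit (rot F v) w" "orbit (rot F v) w = N v"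
        using cyclic_rot[OF assms] orbit_cyclic_eq3 by fastforce+
      then show "w \<in> rot F v ` N v" by (metis (no_types, lifting) image_eqI orbit.cases orbit.simps)
    qed
  qed
  then show "card (rot F v ` N v) = card (N v)" by simp
qed

lemma rot_list:
  assumes "(v, p) \<in> A"
  obtains ws where "distinct (p # ws)" "set (p # ws) = N v" "map (rot F v) (p # ws) = rotate1 (p # ws)"
  using cyclic_on_list[OF cyclic_rot[of v], of p] assms arc_verts by blast


section \<open>Walks without backtracking\<close>

definition nbwalk :: "'a list \<Rightarrow> bool" where
  "nbwalk xs \<longleftrightarrow> (\<forall>i. Suc i < length xs \<longrightarrow> (xs ! i, xs ! Suc i) \<in> A) \<and>
     (\<forall>i. Suc (Suc i) < length xs \<longrightarrow> xs ! i \<noteq> xs ! Suc (Suc i))"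

lemma awalk_of_arcs:
  assumes "i \<le> j" "\<And>t. i \<le> t \<Longrightarrow> t < j \<Longrightarrow> (s t, s (Suc t)) \<in> A" "s i \<in> V"
  shows "G.awalk (s i) (map (\<lambda>t. (s t, s (Suc t))) [i..<j]) (s j) \<and>
    pawalk_verts (s i) (map (\<lambda>t. (s t, s (Suc t))) [i..<j]) = map s [i..<Suc j]"
  using assms
proof (induct "j - i" arbitrary: i)
  case 0
  then show ?case by (simp add: G.awalk_Nil_iff)
next
  case (Suc k)
  then have *: "[i..<j] = i # [Suc i..<j]" "[i..<Suc j] = i # [Suc i..<Suc j]"
    by (auto simp: upt_conv_Cons)
  have "(s i, s (Suc i)) \<in> A" using Suc by simp
  moreover have "G.awalk (s (Suc i)) (map (\<lambda>t. (s t, s (Suc t))) [Suc i..<j]) (s j) \<and>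
      pawalk_verts (s (Suc i)) (map (\<lambda>t. (s t, s (Suc t))) [Suc i..<j]) = map s [Suc i..<Suc j]"
    using Suc arc_verts[OF \<open>(s i, s (Suc i)) \<in> A\<close>] by (intro Suc(1)) auto
  ultimately show ?case
    unfolding * by (auto simp: G.awalk_Cons_iff simp del: upt_Suc)
qed

text \<open>The stretch between a repeated vertex and its earlier occurrence would be a cycle;
  without loops and backtracking its length is at least 3, against acyclicity.\<close>

lemma nbwalk_distinct:
  assumes "nbwalk xs"
  shows "distinct xs"
proof (rule ccontr)
  assume "\<not> distinct xs"
  then have "\<exists>j. j < length xs \<and> (\<exists>i<j. xs ! i = xs ! j)"
    by (metis distinct_conv_nth linorder_neqE_nat)
  \<comment> \<open>Minimality of \<open>j\<close> keeps all vertices before it pairwise different,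
    so only the two ends of the closed stretch coincide.\<close>
  define j where "j = (LEAST j. j < length xs \<and> (\<exists>i<j. xs ! i = xs ! j))"
  have j: "j < length xs \<and> (\<exists>i<j. xs ! i = xs ! j)"
    unfolding j_def using \<open>\<exists>j. _\<close> by (rule LeastI_ex)
  then obtain i where i: "i < j" "xs ! i = xs ! j" by blast
  have min: "xs ! s \<noteq> xs ! t" if "s < t" "t < j" for s t
    using not_less_Least[of t "\<lambda>j. j < length xs \<and> (\<exists>i<j. xs ! i = xs ! j)"] that j
    unfolding j_def[symmetric] by auto
  have arc: "(xs ! t, xs ! Suc t) \<in> A" if "t < j" for t
    using assms that j unfolding nbwalk_def by auto
  have "j \<noteq> Suc i" using arc[OF i(1)] i arc_verts by fastforce
  moreover have "j \<noteq> Suc (Suc i)" using assms i j unfolding nbwalk_def by auto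
  ultimately have len: "3 \<le> j - i" using i by simp
  let ?p = "map (\<lambda>t. (xs ! t, xs ! Suc t)) [i..<j]"
  have w: "G.awalk (xs ! i) ?p (xs ! j)" "pawalk_verts (xs ! i) ?p = map ((!) xs) [i..<Suc j]"
    using awalk_of_arcs[of i j "(!) xs"] i arc arc_verts[OF arc[OF i(1)]] by (auto simp del: upt_Suc)
  have "tl [i..<Suc j] = [Suc i..<Suc j]" using i by (simp add: upt_conv_Cons del: upt_Suc)
  then have tl: "tl (pawalk_verts (xs ! i) ?p) = map ((!) xs) [Suc i..<Suc j]"
    unfolding w(2) by (simp add: map_tl[symmetric] del: upt_Suc)
  have "inj_on ((!) xs) {Suc i..<Suc j}"
  proof (rule linorder_inj_onI)
    fix s t assume st: "s < t" "s \<in> {Suc i..<Suc j}" "t \<in> {Suc i..<Suc j}"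
    show "xs ! s \<noteq> xs ! t"
      using st min[of s t] min[of i s] i by (cases "t = j") auto
  qed auto
  then have "distinct (tl (pawalk_verts (xs ! i) ?p))" unfolding tl by (simp add: distinct_map del: upt_Suc)
  then have "G.cycle ?p" unfolding G.cycle_def using w(1) i len by auto
  then show False using acyclic[of ?p] len by simp
qed

definition child :: "(('a \<times> 'a) \<times> ('a \<times> 'a)) set" where
  "child = {((v, w), (u, v')). v = v' \<and> (u, v) \<in> A \<and> (v, w) \<in> A \<and> w \<noteq> u}"

text \<open>Passing on to a continuing arc never backtracks, so an infinite descent would visit more
  than \<open>card V\<close> different vertices. The recursion that builds branches runs along this
  relation.\<close>

lemma wf_child: "wf child"
proof (rule ccontr)
  assume "\<not> wf child"
  then obtain f where f: "\<And>i. (f (Suc i), f i) \<in> child"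
    unfolding wf_iff_no_infinite_down_chain by blast
  define s where "s i = fst (f i)" for i
  have fs: "f i = (s i, s (Suc i))" for i
    using f[of i] by (cases "f i"; cases "f (Suc i)") (auto simp: child_def s_def)
  have arc: "(s i, s (Suc i)) \<in> A" and ne: "s (Suc (Suc i)) \<noteq> s i" for i
    using f[of i] unfolding fs child_def by auto
  let ?xs = "map s [0..<Suc (card V)]"
  have "nbwalk ?xs" unfolding nbwalk_def using arc ne by (auto simp del: upt_Suc) metis
  then have "distinct ?xs" by (rule nbwalk_distinct)
  then have "card (set ?xs) = Suc (card V)" by (metis distinct_card length_map length_upt minus_nat.diff_0)
  moreover have "set ?xs \<subseteq> V" using arc arc_verts by fastforce
  then have "card (set ?xs) \<le> card V" by (rule card_mono[OF finite_V])
  ultimately show False by simp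
qed

end

text \<open>The leaves that belong to the branch itself and not to the forests in its gaps.\<close>

primrec own :: "'a branch \<Rightarrow> 'a list" where
  "own (Tip g v) = [v]"
| "own (Node v bs) = concat (map own bs)"

lemma branch_induct [case_names Tip Node]:
  assumes "\<And>g v. P (Tip g v)" "\<And>v bs. (\<And>b. b \<in> set bs \<Longrightarrow> P b) \<Longrightarrow> P (Node v bs)"
  shows "P b"
  using assms by (rule pforest_branch_induct(2)[where P = "\<lambda>_. True", OF TrueI TrueI])

lemma own_leaves: "set (own b) \<subseteq> set (leaves_b b)"
  by (induct b rule: branch_induct) auto

lemma successively_concat:
  assumes "\<And>xs. xs \<in> set xss \<Longrightarrow> xs \<noteq> [] \<and> successively R xs"
    "successively (\<lambda>xs ys. R (last xs) (hd ys)) xss"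
  shows "successively R (concat xss)"
  using assms
proof (induct xss)
  case (Cons xs xss)
  then show ?case
    by (cases xss) (auto simp: successively_append_iff)
qed auto

section \<open>Branches cut out of a map and the walk around them\<close>

context disk_forest
begin

text \<open>Agreement with the map is checked vertex by vertex. Which leaves the gap forest of a
  \<open>Tip\<close> contains is left open, so that gaps can be filled after the branches are
  built.\<close>

fun good_f :: "'a pforest \<Rightarrow> bool" and good_b :: "'a \<Rightarrow> 'a branch \<Rightarrow> bool" where
  "good_f Empty \<longleftrightarrow> True"
| "good_f (Tree v b g) \<longleftrightarrow> v \<in> B \<and> (v, apex b) \<in> A \<and> good_b v b \<and> good_f g"
| "good_b p (Tip g v) \<longleftrightarrow> v \<in> B \<and> good_f g"
| "good_b p (Node v bs) \<longleftrightarrow> v \<notin> B \<and> distinct (p # map apex bs) \<and> set (p # map apex bs) = N v \<and>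
     map (rot F v) (p # map apex bs) = rotate1 (p # map apex bs) \<and> (\<forall>b \<in> set bs. good_b v b)"

lemma rot_boundary: "v \<in> B \<Longrightarrow> (v, w) \<in> A \<Longrightarrow> rot F v w = w"
  using boundary_N rot_arc by blast

lemma exists_branch: "(u, v) \<in> A \<Longrightarrow> \<exists>b. apex b = v \<and> good_b u b"
proof (induct "(u, v)" arbitrary: u v rule: wf_induct_rule[OF wf_child])
  case (1 u v)
  show ?case
  proof (cases "v \<in> B")
    case True
    \<comment> \<open>Gaps stay empty at this stage; \<open>fill\<close> puts forests into them
      later.\<close>
    then show ?thesis by (intro exI[of _ "Tip Empty v"]) simp
  next
    case False
    obtain ws where ws: "distinct (u # ws)" "set (u # ws) = N v" "map (rot F v) (u # ws) = rotate1 (u # ws)"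
      using rot_list[OF arc_sym[OF 1(2)]] by blast
    have "\<forall>w \<in> set ws. \<exists>b. apex b = w \<and> good_b v b"
    proof
      fix w assume "w \<in> set ws"
      then have "(v, w) \<in> A" "w \<noteq> u" using ws(1,2) by auto
      moreover from this have "((v, w), (u, v)) \<in> child" using 1(2) by (simp add: child_def)
      ultimately show "\<exists>b. apex b = w \<and> good_b v b" using 1(1) by blast
    qed
    then obtain h where h: "\<forall>w \<in> set ws. apex (h w) = w \<and> good_b v (h w)" by metis
    then have r: "map apex (map h ws) = ws" by (simp add: map_idI)
    have "good_b u (Node v (map h ws))"
      unfolding good_b.simps r using False ws h by auto
    then show ?thesis by (intro exI[of _ "Node v (map h ws)"]) simp
  qed
qed

text \<open>\<open>nxt u v x\<close>: walking around the tree through the arc from \<open>u\<close> to \<open>v\<close>, the first leaf met is \<open>x\<close>.\<close>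

inductive nxt :: "'a \<Rightarrow> 'a \<Rightarrow> 'a \<Rightarrow> bool" where
  nxt_boundary: "v \<in> B \<Longrightarrow> nxt u v v"
| nxt_internal: "v \<notin> B \<Longrightarrow> nxt v (rot F v u) x \<Longrightarrow> nxt u v x"

lemma nxt_unique: "nxt u v x \<Longrightarrow> nxt u v y \<Longrightarrow> x = y"
proof (induct arbitrary: y rule: nxt.induct)
  case (nxt_boundary v u)
  then show ?case using nxt.cases by metis
next
  case (nxt_internal v u x)
  then show ?case using nxt.cases by metis
qed

lemma nxt_in_boundary: "nxt u v x \<Longrightarrow> x \<in> B"
  by (induct rule: nxt.induct) auto

lemma nxt_reachable: "nxt u v x \<Longrightarrow> (u, v) \<in> A \<Longrightarrow> u \<rightarrow>\<^sup>*\<^bsub>with_proj (gr F)\<^esub> x"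
proof (induct rule: nxt.induct)
  case (nxt_boundary v u)
  then show ?case by (simp add: G.reachable_adjI)
next
  case (nxt_internal v u x)
  then show ?case using rot_arc arc_sym G.adj_reachable_trans by blast
qed

definition succ_leaf :: "'a \<Rightarrow> 'a \<Rightarrow> bool" where "succ_leaf x y \<longleftrightarrow> nxt x (nb x) y"

lemma good_children:
  assumes "good_b p (Node v bs)" "(p, v) \<in> A"
  shows "3 \<le> length bs" "rot F v p = apex (hd bs)" "rot F v (apex (last bs)) = p"
    "successively (\<lambda>b b'. rot F v (apex b) = apex b') bs"
proof -
  have "card (N v) = Suc (length bs)"
    using assms(1) distinct_card[of "p # map apex bs"] by simp
  then show len: "3 \<le> length bs" using internal_N[of v] assms arc_verts by fastforce
  then have bs: "bs \<noteq> []" by auto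
  have r: "rot F v p # map (rot F v \<circ> apex) bs = map apex bs @ [p]" using assms(1) by simp
  then show "rot F v p = apex (hd bs)" using bs by (cases bs) auto
  show "rot F v (apex (last bs)) = p"
    using arg_cong[OF r, of last] bs by (simp add: last_map)
  show "successively (\<lambda>b b'. rot F v (apex b) = apex b') bs"
    unfolding successively_conv_nth
  proof (intro allI impI)
    fix i assume i: "Suc i < length bs"
    have "(map apex bs @ [p]) ! Suc i = (rot F v p # map (rot F v \<circ> apex) bs) ! Suc i" using r by simp
    then show "rot F v (apex (bs ! i)) = apex (bs ! Suc i)" using i by (simp add: nth_append)
  qed
qed

text \<open>The walk meets the own leaves of the branch in order and leaves along the arc back to
  \<open>p\<close>. What comes next depends on the surroundings, hence the clause over all
  \<open>z\<close>; it is what joins the walks through consecutive subbranches.\<close>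

lemma tour:
  "good_b p b \<Longrightarrow> (p, apex b) \<in> A \<Longrightarrow> own b \<noteq> [] \<and> nxt p (apex b) (hd (own b)) \<and>
     successively succ_leaf (own b) \<and> (\<forall>z. nxt (apex b) p z \<longrightarrow> succ_leaf (last (own b)) z)"
proof (induct b arbitrary: p rule: branch_induct)
  case (Tip g v)
  then have "nb v = p" using nb_eq arc_sym by simp
  then show ?case using Tip nxt_boundary by (auto simp: succ_leaf_def)
next
  case (Node v bs)
  note c = good_children[OF Node(2) Node(3)[simplified]]
  have bs: "bs \<noteq> []" using c(1) by auto
  have v: "v \<notin> B" using Node(2) by simp
  have arc: "(v, apex b) \<in> A" if "b \<in> set bs" for b
    using Node(2) that by auto
  have IH: "own b \<noteq> [] \<and> nxt v (apex b) (hd (own b)) \<and> successively succ_leaf (own b) \<and>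
      (\<forall>z. nxt (apex b) v z \<longrightarrow> succ_leaf (last (own b)) z)" if "b \<in> set bs" for b
    using Node(1)[OF that _ arc[OF that]] Node(2) that by simp
  have step: "nxt (apex b) v z" if "nxt v (rot F v (apex b)) z" for b z
    using v that by (rule nxt_internal)
  have "hd (concat (map own bs)) = hd (own (hd bs))" using bs IH[of "hd bs"] by (cases bs) auto
  moreover have "nxt p v (hd (own (hd bs)))" using nxt_internal[OF v] c(2) IH[of "hd bs"] bs by simp
  moreover have "last (concat (map own bs)) = last (own (last bs))"
    using bs IH[of "last bs"] by (cases bs rule: rev_cases) auto
  moreover have "succ_leaf (last (own (last bs))) z" if "nxt v p z" for z
    using IH[of "last bs"] step[of "last bs" z] c(3) bs that by simp
  moreover have "successively succ_leaf (concat (map own bs))"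
  proof (rule successively_concat)
    show "xs \<noteq> [] \<and> successively succ_leaf xs" if "xs \<in> set (map own bs)" for xs using that IH by auto
    have "succ_leaf (last (own (bs ! i))) (hd (own (bs ! Suc i)))" if "Suc i < length bs" for i
      using that IH[of "bs ! i"] IH[of "bs ! Suc i"] step[of "bs ! i" "hd (own (bs ! Suc i))"]
        c(4)[unfolded successively_conv_nth]
      by auto
    then show "successively (\<lambda>xs ys. succ_leaf (last xs) (hd ys)) (map own bs)"
      by (simp add: successively_conv_nth)
  qed
  ultimately show ?case using bs IH[of "hd bs"] by (cases bs) auto
qed

lemma own_boundary: "good_b p b \<Longrightarrow> set (own b) \<subseteq> B"
  by (induct b arbitrary: p rule: branch_induct) fastforce+

lemma nbwalk_snoc:
  assumes "nbwalk (xs @ [p])" "(p, v) \<in> A" "xs \<noteq> [] \<Longrightarrow> last xs \<noteq> v"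
  shows "nbwalk (xs @ [p, v])"
proof -
  have "((xs @ [p, v]) ! i, (xs @ [p, v]) ! Suc i) \<in> A" if "Suc i < length (xs @ [p, v])" for i
    using assms(1,2) that unfolding nbwalk_def by (cases "Suc i < length (xs @ [p])") (auto simp: nth_append not_less less_Suc_eq)
  moreover have "(xs @ [p, v]) ! i \<noteq> (xs @ [p, v]) ! Suc (Suc i)" if "Suc (Suc i) < length (xs @ [p, v])" for i
  proof (cases "Suc (Suc i) < length (xs @ [p])")
    case True
    then show ?thesis using assms(1) unfolding nbwalk_def by (auto simp: nth_append less_Suc_eq split: if_splits)
  next
    case False
    then have "i = length xs - 1" "xs \<noteq> []" using that by auto
    then show ?thesis using assms(3) by (auto simp: nth_append last_conv_nth)
  qed
  ultimately show ?thesis unfolding nbwalk_def by blast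
qed

text \<open>Descending through the branch prolongs the given walk without backtracking, and such a
  walk has distinct vertices.\<close>

lemma own_path:
  "good_b p b \<Longrightarrow> nbwalk (xs @ [p, apex b]) \<Longrightarrow> x \<in> set (own b) \<Longrightarrow> x \<notin> set (xs @ [p])"
proof (induct b arbitrary: p xs rule: branch_induct)
  case (Tip g v)
  then show ?case using nbwalk_distinct[OF Tip(2)] by auto
next
  case (Node v bs)
  then obtain b where b: "b \<in> set bs" "x \<in> set (own b)" by auto
  have "nbwalk ((xs @ [p]) @ [v, apex b])"
    using Node b by (intro nbwalk_snoc) auto
  then have "x \<notin> set ((xs @ [p]) @ [v])" using Node b by (intro Node(1)) auto
  then show ?case by simp
qed

lemma own_not_parent: "good_b p b \<Longrightarrow> (p, apex b) \<in> A \<Longrightarrow> p \<notin> set (own b)"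
  using own_path[of p b "[]" p] nbwalk_snoc[of "[]" p "apex b"] by (auto simp: nbwalk_def)

end

section \<open>The Euler characteristic of the capped map\<close>

lemma orbit_inj_on:
  assumes "finite C" "f ` C \<subseteq> C" "inj_on f C" "x \<in> C"
  shows "orbit f (f x) = orbit f x" "x \<in> orbit f x"
proof -
  \<comment> \<open>Extended by the identity outside \<open>C\<close>, \<open>f\<close> becomes a
    permutation with the same orbits inside \<open>C\<close>.\<close>
  define g where "g y = (if y \<in> C then f y else y)" for y
  have fC: "f ` C = C" using assms(1-3) by (simp add: endo_inj_surj)
  have "bij_betw g C C" unfolding bij_betw_def using assms(3) fC by (auto simp: g_def inj_on_def)
  then have "g permutes C" by (rule bij_imp_permutes) (simp add: g_def)
  then have g: "permutation g" using assms(1) permutation_permutes by blast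
  have o: "orbit f y = orbit g y" if "y \<in> C" for y
    by (rule orbit_cong0[OF that]) (use assms(2) in \<open>auto simp: g_def\<close>)
  have "f x \<in> C" "g x = f x" using assms by (auto simp: g_def)
  then show "orbit f (f x) = orbit f x" using permutation_orbit_step[OF g, of x] o assms(4) by simp
  show "x \<in> orbit f x" using permutation_self_in_orbit[OF g] o assms(4) by simp
qed

text \<open>Each vertex outside \<open>R\<close> has an arc to a vertex closer to \<open>R\<close>.
  These arcs and their reverses are all different, so twice their number is at most
  \<open>card A\<close>.\<close>

lemma card_verts_le_edges_roots:
  assumes "finite V" "finite A" "sym A" "R \<subseteq> V" "A \<subseteq> V \<times> V"
    "\<And>v. v \<in> V \<Longrightarrow> \<exists>r \<in> R. (v, r) \<in> A\<^sup>*"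
  shows "card V \<le> card A div 2 + card R"
proof -
  define d where "d v = (LEAST k. \<exists>r \<in> R. (v, r) \<in> A ^^ k)" for v
  have ex: "\<exists>k. \<exists>r \<in> R. (v, r) \<in> A ^^ k" if "v \<in> V" for v
    using assms(6)[OF that] rtrancl_imp_relpow by blast
  have "\<exists>w. (v, w) \<in> A \<and> d w < d v" if v: "v \<in> V - R" for v
  proof -
    obtain r where r: "r \<in> R" "(v, r) \<in> A ^^ d v"
      using LeastI_ex[OF ex[of v]] v unfolding d_def by blast
    then have "d v \<noteq> 0" using v by (metis DiffD2 relpow_0_E)
    then obtain m where m: "d v = Suc m" by (cases "d v") auto
    then obtain w where w: "(v, w) \<in> A" "(w, r) \<in> A ^^ m" using r(2) by (metis relpow_Suc_E2)
    have "d w \<le> m" unfolding d_def by (rule Least_le) (use w r in blast)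
    then show ?thesis using w(1) m by auto
  qed
  then obtain h where h: "\<And>v. v \<in> V - R \<Longrightarrow> (v, h v) \<in> A \<and> d (h v) < d v" by metis
  define P where "P = (\<lambda>v. (v, h v)) ` (V - R)"
  have P: "finite P" "card P = card (V - R)" using assms(1) by (auto simp: P_def card_image inj_on_def)
  have P_d: "d b < d a" if "(a, b) \<in> P" for a b using that h by (auto simp: P_def)
  have "P \<inter> P\<inverse> = {}"
  proof (rule equals0I)
    fix e assume "e \<in> P \<inter> P\<inverse>"
    then show False using P_d[of "fst e" "snd e"] P_d[of "snd e" "fst e"] by (cases e) auto
  qed
  then have "card (P \<union> P\<inverse>) = 2 * card (V - R)" using P by (simp add: card_Un_disjoint)
  moreover have "P \<union> P\<inverse> \<subseteq> A" unfolding P_def using h assms(3) by (auto simp: sym_def)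
  ultimately have "2 * card (V - R) \<le> card A" using card_mono[OF assms(2)] by metis
  moreover have "card (V - R) = card V - card R" using assms(1,4) by (simp add: card_Diff_subset finite_subset)
  ultimately show ?thesis by linarith
qed

section \<open>Faces of the capped map\<close>

context disk_forest
begin

abbreviation "idx v \<equiv> inv_into {1..n} (leaf F) v"

lemma leaf_boundary: "i \<in> {1..n} \<Longrightarrow> leaf F i \<in> B"
  by (simp add: boundary_def)

lemma boundary_idx: "v \<in> B \<Longrightarrow> idx v \<in> {1..n} \<and> leaf F (idx v) = v"
  unfolding boundary_def using inv_into_into f_inv_into_f by metis

lemma idx_leaf: "i \<in> {1..n} \<Longrightarrow> idx (leaf F i) = i"
  using inj_leaf by simp

lemma leaf_eq: "i \<in> {1..n} \<Longrightarrow> j \<in> {1..n} \<Longrightarrow> leaf F i = leaf F j \<longleftrightarrow> i = j"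
  by (rule inj_on_eq_iff[OF inj_leaf])

definition \<alpha> :: "nat \<Rightarrow> nat" where "\<alpha> i = idx (THE x. succ_leaf (leaf F i) x)"

lemma nxt_exists: assumes "(u, v) \<in> A" shows "\<exists>x. nxt u v x"
  using exists_branch[OF assms] tour assms by blast

lemma succ_leaf_unique: "succ_leaf x y \<Longrightarrow> succ_leaf x z \<Longrightarrow> y = z"
  unfolding succ_leaf_def by (rule nxt_unique)

lemma alpha_iff:
  assumes "i \<in> {1..n}" "j \<in> {1..n}"
  shows "\<alpha> i = j \<longleftrightarrow> succ_leaf (leaf F i) (leaf F j)"
proof -
  obtain x where x: "succ_leaf (leaf F i) x"
    using nxt_exists[OF nb_arc[OF leaf_boundary[OF assms(1)]]] unfolding succ_leaf_def by blast
  then have "(THE x. succ_leaf (leaf F i) x) = x" using succ_leaf_unique by blast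
  then have "\<alpha> i = idx x" by (simp add: \<alpha>_def)
  moreover have "x \<in> B" using x nxt_in_boundary unfolding succ_leaf_def by blast
  ultimately show ?thesis
    using x succ_leaf_unique boundary_idx idx_leaf[OF assms(2)] by metis
qed

lemma alpha_in: "i \<in> {1..n} \<Longrightarrow> \<alpha> i \<in> {1..n}"
proof -
  assume i: "i \<in> {1..n}"
  obtain x where x: "succ_leaf (leaf F i) x"
    using nxt_exists[OF nb_arc[OF leaf_boundary[OF i]]] unfolding succ_leaf_def by blast
  then have "(THE x. succ_leaf (leaf F i) x) = x" using succ_leaf_unique by blast
  moreover have "x \<in> B" using x nxt_in_boundary unfolding succ_leaf_def by blast
  ultimately show ?thesis using boundary_idx by (simp add: \<alpha>_def)
qed

text \<open>The predecessor of a leaf is the last own leaf of the branch hanging at it: on leaving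
  that branch the walk arrives at the leaf.\<close>

lemma alpha_surj: assumes "j \<in> {1..n}" shows "\<exists>i \<in> {1..n}. \<alpha> i = j"
proof -
  let ?v = "leaf F j"
  have v: "?v \<in> B" "(?v, nb ?v) \<in> A" using leaf_boundary[OF assms] nb_arc by auto
  obtain b where b: "apex b = nb ?v" "good_b ?v b" using exists_branch[OF v(2)] by blast
  then have t: "own b \<noteq> []" "\<And>z. nxt (apex b) ?v z \<Longrightarrow> succ_leaf (last (own b)) z"
    using tour[OF b(2)] v by auto
  have "succ_leaf (last (own b)) ?v" by (rule t(2)) (rule nxt_boundary[OF v(1)])
  moreover have "last (own b) \<in> B" using own_boundary[OF b(2)] t(1) by auto
  ultimately show ?thesis using alpha_iff assms boundary_idx by metis
qed

lemma alpha_inj: "inj_on \<alpha> {1..n}"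
proof (rule eq_card_imp_inj_on)
  have "\<alpha> ` {1..n} = {1..n}" using alpha_in alpha_surj by blast
  then show "card (\<alpha> ` {1..n}) = card {1..n}" by simp
qed simp

abbreviation "C \<equiv> parcs (cap_graph n F)"

lemma cap_arcs [simp]:
  "(Some u, Some v) \<in> C \<longleftrightarrow> (u, v) \<in> A" "(None, Some v) \<in> C \<longleftrightarrow> v \<in> B"
  "(Some v, None) \<in> C \<longleftrightarrow> v \<in> B" "(None, None) \<notin> C"
  unfolding cap_graph_def by force+

lemma finite_B: "finite B" and card_B: "card B = n"
  unfolding boundary_def using card_image[OF inj_leaf] by auto

lemma finite_C: "finite C"
  unfolding cap_graph_def using finite_A finite_B by simp

lemma card_C: "card C = card A + 2 * n"
proof -
  define P Q where "P = {None :: 'a option} \<times> Some ` B" and "Q = Some ` B \<times> {None :: 'a option}"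
  have C: "C = map_prod Some Some ` A \<union> (P \<union> Q)"
    unfolding cap_graph_def P_def Q_def by auto
  have "card (map_prod Some Some ` A) = card A" by (rule card_image) (auto simp: inj_on_def)
  moreover have "card P = n" "card Q = n"
    using card_B by (simp_all add: P_def Q_def card_cartesian_product card_image)
  moreover have "card (P \<union> Q) = card P + card Q"
    by (rule card_Un_disjoint) (use finite_B in \<open>auto simp: P_def Q_def\<close>)
  moreover have "card C = card (map_prod Some Some ` A) + card (P \<union> Q)" unfolding C
    by (rule card_Un_disjoint) (use finite_A finite_B in \<open>auto simp: P_def Q_def\<close>)
  ultimately show ?thesis by simp
qed

definition \<psi> :: "'a option \<times> 'a option \<Rightarrow> 'a option \<times> 'a option" where
  "\<psi> = (\<lambda>(u, v). (v, cap_rot n F v u))"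

definition prv :: "nat \<Rightarrow> nat" where "prv j = (if j = 1 then n else j - 1)"

lemma prv: "j \<in> {1..n} \<Longrightarrow> prv j \<in> {1..n}" "inj_on prv {1..n}"
  by (auto simp: prv_def inj_on_def split: if_splits)

lemma psi_simps:
  "v \<in> B \<Longrightarrow> \<psi> (Some u, Some v) = (Some v, None)"
  "v \<notin> B \<Longrightarrow> \<psi> (Some u, Some v) = (Some v, Some (rot F v u))"
  "\<psi> (None, Some v) = (Some v, Some (nb v))"
  "j \<in> {1..n} \<Longrightarrow> \<psi> (Some (leaf F j), None) = (None, Some (leaf F (prv j)))"
  using idx_leaf[of j] by (simp_all add: \<psi>_def nb_def prv_def Let_def)

lemma psi_None: "v \<in> B \<Longrightarrow> \<psi> (Some v, None) = (None, Some (leaf F (prv (idx v))))"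
  using psi_simps(4)[of "idx v"] boundary_idx by simp

lemma psi_C: "\<psi> ` C \<subseteq> C"
proof
  fix a assume "a \<in> \<psi> ` C"
  then obtain u v where uv: "(u, v) \<in> C" "a = \<psi> (u, v)" by auto
  show "a \<in> C"
  proof (cases u; cases v)
    fix u' v' assume [simp]: "u = Some u'" "v = Some v'"
    show ?thesis using uv psi_simps(1,2) rot_arc arc_sym by (cases "v' \<in> B") auto
  next
    fix v' assume [simp]: "u = None" "v = Some v'"
    show ?thesis using uv psi_simps(3) nb_arc by simp
  next
    fix u' assume [simp]: "u = Some u'" "v = None"
    show ?thesis using uv psi_None prv(1) boundary_idx leaf_boundary by simp
  qed (use uv in simp)
qed

lemma psi_inj: "inj_on \<psi> C"
proof (rule inj_onI)
  fix a b assume ab: "a \<in> C" "b \<in> C" "\<psi> a = \<psi> b"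
  obtain u v u' where a: "a = (u, v)" and b: "b = (u', v)" using ab(3) by (cases a; cases b) (auto simp: \<psi>_def)
  show "a = b"
  proof (cases v)
    case None
    then obtain x y where xy: "u = Some x" "u' = Some y" "x \<in> B" "y \<in> B" using ab a b by (cases u; cases u') auto
    then have "leaf F (prv (idx x)) = leaf F (prv (idx y))" using ab(3) psi_None None by (simp add: a b)
    then have "prv (idx x) = prv (idx y)" using leaf_eq prv(1) boundary_idx xy by blast
    then have "idx x = idx y" using prv(2) boundary_idx xy unfolding inj_on_def by blast
    then show ?thesis using boundary_idx xy a b by metis
  next
    case (Some w)
    show ?thesis
    proof (cases "w \<in> B")
      case True
      then have "x = y" if "(w, x) \<in> A" "(w, y) \<in> A" for x y
        using boundary_N that by blast
      then show ?thesis using True ab psi_simps(1,3)[of w]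
        by (cases u; cases u') (auto simp: a b Some dest: arc_sym)
    next
      case False
      then obtain x y where xy: "u = Some x" "u' = Some y" using ab by (cases u; cases u') (auto simp: a b Some)
      then have "(w, x) \<in> A" "(w, y) \<in> A" "rot F w x = rot F w y"
        using ab psi_simps(2)[OF False] arc_sym by (auto simp: a b Some)
      then show ?thesis using rot_inj[of w] arc_verts unfolding inj_on_def a b xy by blast
    qed
  qed
qed

abbreviation "face a \<equiv> orbit \<psi> a"

lemma face_psi: "a \<in> C \<Longrightarrow> face (\<psi> a) = face a" and face_self: "a \<in> C \<Longrightarrow> a \<in> face a"
  using orbit_inj_on[OF finite_C psi_C psi_inj] by blast+

text \<open>At internal vertices \<open>\<psi>\<close> turns exactly as the walk of
  \<open>nxt\<close> does; at the first leaf it crosses to the cap.\<close>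

lemma nxt_face: "nxt u v x \<Longrightarrow> (u, v) \<in> A \<Longrightarrow> face (Some u, Some v) = face (Some x, None)"
proof (induct rule: nxt.induct)
  case (nxt_boundary v u)
  then show ?case using face_psi[of "(Some u, Some v)"] psi_simps(1)[of v u] by simp
next
  case (nxt_internal v u x)
  then show ?case using face_psi[of "(Some u, Some v)"] psi_simps(2)[of v u] rot_arc arc_sym by simp
qed

definition leaf_face :: "nat \<Rightarrow> ('a option \<times> 'a option) set" where
  "leaf_face i = face (None, Some (leaf F i))"

definition \<beta> :: "nat \<Rightarrow> nat" where "\<beta> i = prv (\<alpha> i)"

lemma beta_in: "i \<in> {1..n} \<Longrightarrow> \<beta> i \<in> {1..n}"
  unfolding \<beta>_def using prv(1) alpha_in by blast

lemma face_None: "j \<in> {1..n} \<Longrightarrow> face (Some (leaf F j), None) = leaf_face (prv j)"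
  using face_psi[of "(Some (leaf F j), None)"] psi_simps(4)[of j] leaf_boundary unfolding leaf_face_def by simp

text \<open>From the cap the face enters leaf \<open>i\<close>, runs along its tree to leaf
  \<open>\<alpha> i\<close>, exits to the cap and re-enters at the preceding label.\<close>

lemma leaf_face_beta: assumes "i \<in> {1..n}" shows "leaf_face (\<beta> i) = leaf_face i"
proof -
  let ?v = "leaf F i"
  have v: "?v \<in> B" using leaf_boundary[OF assms] .
  have "leaf_face i = face (Some ?v, Some (nb ?v))"
    using face_psi[of "(None, Some ?v)"] psi_simps(3)[of ?v] v unfolding leaf_face_def by simp
  also have "\<dots> = face (Some (leaf F (\<alpha> i)), None)"
    using alpha_iff[OF assms alpha_in[OF assms]] nxt_face[OF _ nb_arc[OF v]] unfolding succ_leaf_def by simp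
  also have "\<dots> = leaf_face (\<beta> i)" unfolding \<beta>_def using face_None alpha_in[OF assms] by simp
  finally show ?thesis by simp
qed

text \<open>Every walk along a tree reaches a leaf and crosses to the cap, so no face avoids the
  arcs that leave \<open>None\<close>.\<close>

lemma faces_eq: "faces (cap_graph n F) (cap_rot n F) = leaf_face ` {1..n}"
proof -
  have "faces (cap_graph n F) (cap_rot n F) = face ` C" unfolding faces_def \<psi>_def by simp
  also have "\<dots> = leaf_face ` {1..n}"
  proof
    show "leaf_face ` {1..n} \<subseteq> face ` C" using leaf_boundary by (auto simp: leaf_face_def)
    have None: "face (Some x, None) \<in> leaf_face ` {1..n}" if "x \<in> B" for x
      using face_None[of "idx x"] boundary_idx[OF that] prv(1) by force
    show "face ` C \<subseteq> leaf_face ` {1..n}"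
    proof
      fix X assume "X \<in> face ` C"
      then obtain u v where uv: "(u, v) \<in> C" "X = face (u, v)" by auto
      show "X \<in> leaf_face ` {1..n}"
      proof (cases u; cases v)
        fix u' v' assume [simp]: "u = Some u'" "v = Some v'"
        obtain x where "nxt u' v' x" using nxt_exists uv by auto
        then show ?thesis using nxt_face nxt_in_boundary None uv by auto
      next
        fix v' assume [simp]: "u = None" "v = Some v'"
        show ?thesis using uv boundary_idx[of v'] by (auto simp: leaf_face_def intro!: image_eqI[of _ _ "idx v'"])
      qed (use uv None in auto)
    qed
  qed
  finally show ?thesis .
qed

section \<open>Counting trees and faces by indices of leaves\<close>

definition exc :: "nat set" where "exc = {i \<in> {1..n}. i \<le> \<beta> i}"
definition desc :: "nat set" where "desc = {i \<in> {1..n}. \<alpha> i \<le> i}"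
definition maxima :: "nat set" where
  "maxima = {i \<in> {1..n}. \<forall>j \<in> {1..n}. leaf F i \<rightarrow>\<^sup>*\<^bsub>with_proj (gr F)\<^esub> leaf F j \<longrightarrow> j \<le> i}"

lemma faces_exc: "faces (cap_graph n F) (cap_rot n F) = leaf_face ` exc"
proof -
  have "leaf_face i \<in> leaf_face ` exc" if i: "i \<in> {1..n}" for i
  proof -
    let ?S = "{j \<in> {1..n}. leaf_face j = leaf_face i}"
    have S: "finite ?S" "?S \<noteq> {}" using i by auto
    have m: "Min ?S \<in> ?S" by (rule Min_in[OF S])
    then have "\<beta> (Min ?S) \<in> ?S" using leaf_face_beta beta_in by auto
    then have "Min ?S \<in> exc" using m Min_le[OF S(1)] by (simp add: exc_def)
    then show ?thesis using m by (intro image_eqI[of _ _ "Min ?S"]) auto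
  qed
  then show ?thesis unfolding faces_eq exc_def by auto
qed

lemma desc_sub: "desc \<subseteq> {1..n}"
  by (auto simp: desc_def)

lemma card_exc: "card exc + card desc \<le> Suc n"
proof -
  \<comment> \<open>Unless \<open>\<alpha> i = 1\<close>, \<open>\<beta> i\<close> is
    \<open>\<alpha> i - 1\<close> and the conditions of \<open>exc\<close> and \<open>desc\<close>
    exclude each other. The single exception \<open>i1\<close> accounts for the extra 1 in the
    bound.\<close>
  obtain i1 where i1: "i1 \<in> {1..n}" "\<alpha> i1 = 1" using alpha_surj[of 1] n_pos by auto
  have "exc \<subseteq> insert i1 ({1..n} - desc)"
  proof
    fix i assume i: "i \<in> exc"
    show "i \<in> insert i1 ({1..n} - desc)"
    proof (cases "\<alpha> i = 1")
      case True
      then have "i = i1" using inj_onD[OF alpha_inj, of i i1] i i1 by (simp add: exc_def)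
      then show ?thesis by simp
    next
      case False
      then show ?thesis using i alpha_in[of i] unfolding exc_def desc_def \<beta>_def prv_def by auto
    qed
  qed
  then have "card exc \<le> card (insert i1 ({1..n} - desc))" by (rule card_mono[rotated]) simp
  also have "\<dots> \<le> Suc (card ({1..n} - desc))" by (simp add: card_insert_if)
  finally have "card exc \<le> Suc (card ({1..n} - desc))" .
  moreover have "card ({1..n} - desc) = n - card desc" "card desc \<le> n"
    using card_Diff_subset[of desc "{1..n}"] card_mono[of "{1..n}" desc]
      finite_subset[of desc "{1..n}"] desc_sub by auto
  ultimately show ?thesis by linarith
qed

lemma leaf_reach_alpha: "i \<in> {1..n} \<Longrightarrow> leaf F i \<rightarrow>\<^sup>*\<^bsub>with_proj (gr F)\<^esub> leaf F (\<alpha> i)"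
  using alpha_iff[of i "\<alpha> i"] alpha_in nxt_reachable nb_arc leaf_boundary unfolding succ_leaf_def by blast

lemma maxima_desc: "maxima \<subseteq> desc"
  unfolding maxima_def desc_def using leaf_reach_alpha alpha_in by blast

lemma reach_rtrancl: "u \<rightarrow>\<^sup>*\<^bsub>with_proj (gr F)\<^esub> v \<Longrightarrow> (u, v) \<in> A\<^sup>*"
  using reachable_rtranclI by fastforce

text \<open>The largest leaves serve as roots: every vertex reaches some leaf, hence also the
  largest leaf of its tree.\<close>

lemma card_V: "card V \<le> card A div 2 + card maxima"
proof -
  have "card V \<le> card A div 2 + card (leaf F ` maxima)"
  proof (rule card_verts_le_edges_roots[OF finite_V finite_A])
    show "sym A" using arc_sym by (auto simp: sym_def)
    show "leaf F ` maxima \<subseteq> V" using leaf_boundary boundary_sub by (auto simp: maxima_def)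
    show "A \<subseteq> V \<times> V" using arc_verts by auto
    show "\<exists>r \<in> leaf F ` maxima. (v, r) \<in> A\<^sup>*" if v: "v \<in> V" for v
    proof -
      let ?S = "{j \<in> {1..n}. v \<rightarrow>\<^sup>*\<^bsub>with_proj (gr F)\<^esub> leaf F j}"
      obtain w where "w \<in> B" "v \<rightarrow>\<^sup>*\<^bsub>with_proj (gr F)\<^esub> w" using reach_boundary[OF v] by blast
      then have "idx w \<in> ?S" using boundary_idx by simp
      then have S: "finite ?S" "?S \<noteq> {}" by auto
      have m: "Max ?S \<in> ?S" by (rule Max_in[OF S])
      have "Max ?S \<in> maxima" unfolding maxima_def
      proof (intro CollectI conjI ballI impI)
        show "Max ?S \<in> {1..n}" using m by blast
        fix j assume j: "j \<in> {1..n}" "leaf F (Max ?S) \<rightarrow>\<^sup>*\<^bsub>with_proj (gr F)\<^esub> leaf F j"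
        then have "v \<rightarrow>\<^sup>*\<^bsub>with_proj (gr F)\<^esub> leaf F j" using m G.reachable_trans by blast
        then show "j \<le> Max ?S" using j(1) by (intro Max_ge[OF S(1)]) simp
      qed
      then show ?thesis using m reach_rtrancl by blast
    qed
  qed
  moreover have "card (leaf F ` maxima) \<le> card maxima"
    by (rule card_image_le) (simp add: maxima_def)
  ultimately show ?thesis by linarith
qed

lemma euler_formula:
  "euler_char (cap_graph n F) (cap_rot n F) = int (card V) + 1 - int (card A div 2) - int n
     + int (card (faces (cap_graph n F) (cap_rot n F)))"
proof -
  have "pverts (cap_graph n F) = insert None (Some ` V)" by (simp add: cap_graph_def)
  then have "card (pverts (cap_graph n F)) = Suc (card V)"
    using finite_V by (simp add: card_image)
  moreover have "card C div 2 = card A div 2 + n" by (simp add: card_C)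
  ultimately show ?thesis unfolding euler_char_def by simp
qed

lemma finite_index_sets: "finite exc" "finite desc" "finite maxima"
  by (simp_all add: exc_def desc_def maxima_def)

lemma euler_le: "euler_char (cap_graph n F) (cap_rot n F) \<le> 2"
  using card_V card_exc card_mono[OF finite_index_sets(2) maxima_desc]
    card_image_le[OF finite_index_sets(1), of leaf_face]
  unfolding euler_formula faces_exc by linarith

text \<open>The value 2 leaves no slack in any inequality behind \<open>euler_le\<close>: a subset
  of full size is the whole set, and an image of full size makes the map injective.\<close>

lemma euler_eq:
  assumes "euler_char (cap_graph n F) (cap_rot n F) = 2"
  shows "maxima = desc" "inj_on leaf_face exc"
proof -
  note e = assms[unfolded euler_formula faces_exc] card_V card_exc
    card_mono[OF finite_index_sets(2) maxima_desc] card_image_le[OF finite_index_sets(1), of leaf_face]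
  have "card maxima = card desc" using e by linarith
  then show "maxima = desc" using card_subset_eq[OF finite_index_sets(2) maxima_desc] by simp
  have "card (leaf_face ` exc) = card exc" using e by linarith
  then show "inj_on leaf_face exc" by (rule eq_card_imp_inj_on[OF finite_index_sets(1)])
qed

end

section \<open>Planar forests can be parsed\<close>

fun append_f :: "'a pforest \<Rightarrow> 'a pforest \<Rightarrow> 'a pforest" where
  "append_f Empty g = g"
| "append_f (Tree v b f) g = Tree v b (append_f f g)"

lemma leaves_append [simp]: "leaves_f (append_f f g) = leaves_f f @ leaves_f g"
  by (induct f g rule: append_f.induct) auto

primrec fill :: "('a \<Rightarrow> 'a pforest) \<Rightarrow> 'a branch \<Rightarrow> 'a branch" where
  "fill \<gamma> (Tip g v) = Tip (\<gamma> v) v"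
| "fill \<gamma> (Node v bs) = Node v (map (fill \<gamma>) bs)"

lemma root_fill [simp]: "apex (fill \<gamma> b) = apex b"
  by (cases b) auto

lemma leaves_fill: "leaves_b (fill \<gamma> b) = concat (map (\<lambda>v. leaves_f (\<gamma> v) @ [v]) (own b))"
proof (induct b rule: branch_induct)
  case (Node v bs)
  then have "concat (map (\<lambda>b. leaves_b (fill \<gamma> b)) bs) = concat (map (\<lambda>v. leaves_f (\<gamma> v) @ [v]) (concat (map own bs)))"
    by (induct bs) auto
  then show ?case by (simp add: comp_def)
qed simp

lemma distinct_concat_disjoint:
  "distinct (concat (map h xs)) \<Longrightarrow> x \<in> set xs \<Longrightarrow> y \<in> set xs \<Longrightarrow> x \<noteq> y \<Longrightarrow> set (h x) \<inter> set (h y) = {}"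
  by (induct xs) (auto simp: disjoint_iff)

lemma successively_strengthen:
  assumes "successively P xs" "\<And>x y. x \<in> set xs \<Longrightarrow> y \<in> set (tl xs) \<Longrightarrow> P x y \<Longrightarrow> Q x y"
  shows "successively Q xs"
  unfolding successively_conv_nth
proof (intro allI impI)
  fix i assume i: "Suc i < length xs"
  then have "tl xs ! i = xs ! Suc i" "i < length (tl xs)" by (simp_all add: nth_tl)
  then have "xs ! Suc i \<in> set (tl xs)" by (metis nth_mem)
  then show "Q (xs ! i) (xs ! Suc i)"
    using assms i unfolding successively_conv_nth by simp
qed

lemma nbrs_closed:
  fixes f :: "'a pforest" and b :: "'a branch"
  shows "(v, ns) \<in> set (nbrs_f f) \<Longrightarrow> set ns \<subseteq> set (verts_f f)"
    "(v, ns) \<in> set (nbrs_b p b) \<Longrightarrow> set ns \<subseteq> insert p (set (verts_b b))"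
proof (induct f and b arbitrary: and p rule: pforest_branch_induct)
  case (Tree u b g)
  then show ?case using Tree(1)[of u] root_in_verts[of b] by auto
next
  case (Node u bs)
  show ?case
  proof (cases "(v, ns) = (u, p # map apex bs)")
    case True
    then show ?thesis using root_in_verts by fastforce
  next
    case False
    then obtain b where "b \<in> set bs" "(v, ns) \<in> set (nbrs_b u b)" using Node(2) by auto
    then show ?thesis using Node(1)[of b u] by auto
  qed
qed auto

lemma successively_less_last: "successively (<) (y # ys) \<Longrightarrow> y \<le> last (y # (ys :: nat list))"
proof (induct ys arbitrary: y)
  case (Cons z zs)
  have "y < z" "z \<le> last (z # zs)" using Cons(1)[of z] Cons(2) by simp_all
  then show ?case by simp
qed simp

lemma successively_less_first: "successively (<) (y # ys) \<Longrightarrow> x \<in> set (y # ys) \<Longrightarrow> y \<le> (x :: nat)"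
proof (induct ys arbitrary: y)
  case (Cons z zs)
  show ?case
  proof (cases "x = y")
    case False
    then have "z \<le> x" using Cons by simp
    then show ?thesis using Cons(2) by simp
  qed simp
qed simp

lemma upt_split: "i \<le> j \<Longrightarrow> j \<le> k \<Longrightarrow> [i..<k] = [i..<j] @ [j..<k]"
  using upt_add_eq_append[of i j "k - j"] by simp

text \<open>Each leaf together with the forest before it covers the labels after the previous own
  leaf; these pieces telescope.\<close>

lemma concat_chain:
  assumes "successively (\<lambda>x y. x < y \<and> h (l y) = map l [Suc x..<y]) (m # ys)"
  shows "concat (map (\<lambda>v. h v @ [v]) (map l ys)) = map l [Suc m..<Suc (last (m # ys))]"
  using assms
proof (induct ys arbitrary: m)
  case (Cons y ys)
  have y: "m < y" "h (l y) = map l [Suc m..<y]" "successively (\<lambda>x y. x < y \<and> h (l y) = map l [Suc x..<y]) (y # ys)"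
    using Cons(2) by auto
  have "successively (<) (y # ys)" using y(3) by (rule successively_mono) auto
  then have le: "y \<le> last (y # ys)" by (rule successively_less_last)
  have "[Suc m..<Suc (last (y # ys))] = [Suc m..<y] @ [y] @ [Suc y..<Suc (last (y # ys))]"
    using y(1) le by (subst upt_split[of _ y]) (auto simp: upt_conv_Cons simp del: upt_Suc)
  then have "map l [Suc m..<Suc (last (y # ys))] = map l [Suc m..<y] @ [l y] @ map l [Suc y..<Suc (last (y # ys))]"
    by (simp only: map_append list.map)
  then show ?case using Cons(1)[OF y(3)] y(2) by simp
qed simp

section \<open>Filling the gaps of a planar forest\<close>

locale planar_disk_forest = disk_forest +
  assumes euler: "euler_char (cap_graph n F) (cap_rot n F) = 2"
begin

lemma desc_max:
  assumes "b \<in> desc" "j \<in> {1..n}" "leaf F b \<rightarrow>\<^sup>*\<^bsub>with_proj (gr F)\<^esub> leaf F j"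
  shows "j \<le> b"
  using assms euler_eq(1)[OF euler] unfolding maxima_def by blast

text \<open>\<open>gap i b\<close>: the leaves \<open>i + 1, ..., b\<close> split into intervals \<open>\<alpha> c, ..., c\<close>, each spanned by one tree.\<close>

inductive gap :: "nat \<Rightarrow> nat \<Rightarrow> bool" where
  gap_refl: "gap i i"
| gap_step: "b \<in> {1..n} \<Longrightarrow> \<alpha> b \<le> b \<Longrightarrow> gap i (\<alpha> b - 1) \<Longrightarrow> gap i b"

lemma gap_le: "gap i b \<Longrightarrow> i \<le> b"
  by (induct rule: gap.induct) auto

text \<open>The face of \<open>i\<close> contains no other index of \<open>exc\<close>, so from
  every other index of it \<open>\<beta>\<close> goes down, each step skipping the interval of one
  tree. If \<open>\<alpha> i = 1\<close>, the face is the outer one, and the chain passes also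
  through the tree spanning \<open>1, ..., i\<close> and ends at 0.\<close>

lemma gap_chain:
  assumes "i \<in> exc"
  shows "b \<in> {1..n} \<Longrightarrow> leaf_face b = leaf_face i \<Longrightarrow> gap (if \<alpha> i = 1 then 0 else i) b"
proof (induct b rule: less_induct)
  case (less b)
  show ?case
  proof (cases "b = i")
    case True
    show ?thesis
    proof (cases "\<alpha> i = 1")
      case one: True
      have "gap 0 b" by (rule gap_step[of b 0]) (use less(2) one True in \<open>simp_all add: gap_refl\<close>)
      then show ?thesis using True one by simp
    qed (simp add: True gap_refl)
  next
    case False
    then have "b \<notin> exc" using inj_onD[OF euler_eq(2)[OF euler] less(3)] assms by blast
    then have b: "\<beta> b < b" using less(2) by (simp add: exc_def)
    have "\<alpha> b \<noteq> 1"
    proof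
      assume "\<alpha> b = 1"
      then have "\<beta> b = n" by (simp add: \<beta>_def prv_def)
      then show False using b less(2) by simp
    qed
    then have *: "\<alpha> b \<noteq> 1" "\<beta> b = \<alpha> b - 1" by (simp_all add: \<beta>_def prv_def)
    have "gap (if \<alpha> i = 1 then 0 else i) (\<beta> b)"
      using less(1)[OF b beta_in[OF less(2)]] leaf_face_beta[OF less(2)] less(3) by simp
    then have g: "gap (if \<alpha> i = 1 then 0 else i) (\<alpha> b - 1)" unfolding *(2) .
    have "\<alpha> b \<le> b" using b *(2) by simp
    then show ?thesis by (rule gap_step[OF less(2) _ g])
  qed
qed

lemma gap_alpha:
  assumes "i \<in> {1..n}" "i < \<alpha> i"
  shows "gap i (\<alpha> i - 1)"
proof -
  have "\<alpha> i \<noteq> 1" "\<beta> i = \<alpha> i - 1" using assms unfolding \<beta>_def prv_def by auto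
  moreover from this have "i \<in> exc" using assms by (simp add: exc_def)
  ultimately show ?thesis using gap_chain[of i "\<beta> i"] beta_in[OF assms(1)] leaf_face_beta[OF assms(1)] by simp
qed

lemma gap_top: "gap 0 n"
proof -
  obtain i where i: "i \<in> {1..n}" "\<alpha> i = 1" using alpha_surj[of 1] n_pos by auto
  then have "\<beta> i = n" by (simp add: \<beta>_def prv_def)
  then show ?thesis using gap_chain[of i n] i n_pos leaf_face_beta[OF i(1)] by (simp add: exc_def)
qed

lemma own_reachable:
  "good_b p b \<Longrightarrow> (p, apex b) \<in> A \<Longrightarrow> x \<in> set (own b) \<Longrightarrow> p \<rightarrow>\<^sup>*\<^bsub>with_proj (gr F)\<^esub> x"
proof (induct b arbitrary: p rule: branch_induct)
  case (Tip g v)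
  then show ?case by (simp add: G.reachable_adjI)
next
  case (Node v bs)
  then obtain b where b: "b \<in> set bs" "x \<in> set (own b)" by auto
  have "(v, apex b) \<in> A" using Node(2) b by auto
  then have "v \<rightarrow>\<^sup>*\<^bsub>with_proj (gr F)\<^esub> x" using Node(1)[of b v] Node(2) b by simp
  then show ?case using Node(3) G.adj_reachable_trans by simp
qed

lemma reach_sym: "u \<rightarrow>\<^sup>*\<^bsub>with_proj (gr F)\<^esub> v \<Longrightarrow> v \<rightarrow>\<^sup>*\<^bsub>with_proj (gr F)\<^esub> u"
  using symmetric_reachable[OF G.sym_arcs] .

text \<open>If \<open>\<alpha>\<close> failed to increase at some \<open>x\<close> before the end of
  the tour, \<open>x\<close> would be a descent, hence the largest leaf \<open>b\<close> of the
  tree. But the successor of \<open>b\<close> is \<open>m\<close>, and \<open>m\<close> does not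
  recur among the own leaves.\<close>

lemma tree_leaves:
  assumes "m \<in> {1..n}" "b \<in> {1..n}" "\<alpha> b = m" "m \<le> b"
    "good_b (leaf F m) t" "apex t = nb (leaf F m)"
  obtains as where "own t = map (leaf F) as" "set as \<subseteq> {1..n}" "\<And>a. a \<in> set as \<Longrightarrow> a \<le> b"
    "last (m # as) = b" "successively (\<lambda>x y. \<alpha> x = y \<and> x < y) (m # as)"
proof -
  let ?v = "leaf F m"
  have v: "?v \<in> B" "(?v, apex t) \<in> A" using leaf_boundary[OF assms(1)] nb_arc assms(6) by auto
  define as where "as = map idx (own t)"
  have ownB: "set (own t) \<subseteq> B" using own_boundary[OF assms(5)] .
  then have own: "own t = map (leaf F) as"
    unfolding as_def map_map using boundary_idx by (intro map_idI[symmetric]) auto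
  have as: "set as \<subseteq> {1..n}" unfolding as_def using ownB boundary_idx by auto
  note t = tour[OF assms(5) v(2)]
  have ne: "as \<noteq> []" using t by (simp add: as_def)
  have "successively succ_leaf (leaf F m # own t)"
    using t assms(6) by (cases "own t") (auto simp: succ_leaf_def)
  then have "successively succ_leaf (map (leaf F) (m # as))" unfolding own by simp
  then have "successively (\<lambda>x y. succ_leaf (leaf F x) (leaf F y)) (m # as)" unfolding successively_map .
  then have chain: "successively (\<lambda>x y. \<alpha> x = y) (m # as)"
  proof (rule successively_strengthen)
    fix x y assume "x \<in> set (m # as)" "y \<in> set (tl (m # as))" "succ_leaf (leaf F x) (leaf F y)"
    moreover from this have "x \<in> {1..n}" "y \<in> {1..n}" using assms(1) as by auto
    ultimately show "\<alpha> x = y" using alpha_iff by blast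
  qed
  have "succ_leaf (last (own t)) ?v" using t nxt_boundary[OF v(1)] by blast
  then have "succ_leaf (leaf F (last as)) (leaf F m)" unfolding own using ne by (simp add: last_map)
  moreover have las: "last as \<in> {1..n}" using as ne last_in_set by blast
  ultimately have "\<alpha> (last as) = m" using alpha_iff assms(1) by blast
  then have last: "last as = b" using inj_onD[OF alpha_inj, of "last as" b] las assms(2,3) by simp
  have m: "m \<notin> set as"
    using own_not_parent[OF assms(5) v(2)] unfolding own by auto
  have bd: "b \<in> desc" using assms(2-4) by (simp add: desc_def)
  have reach: "?v \<rightarrow>\<^sup>*\<^bsub>with_proj (gr F)\<^esub> leaf F x" if "x \<in> set (m # as)" for x
    using that own_reachable[OF assms(5) v(2)] G.reachable_refl v(1) boundary_sub unfolding own by auto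
  have reachb: "leaf F b \<rightarrow>\<^sup>*\<^bsub>with_proj (gr F)\<^esub> ?v"
    using reach_sym[OF reach[of b]] last ne last_in_set[of as] by auto
  have le: "x \<le> b" if "x \<in> set (m # as)" for x
    using desc_max[OF bd, of x] G.reachable_trans[OF reachb reach[OF that]] that as assms(1) by auto
  have "successively (\<lambda>x y. \<alpha> x = y \<and> x < y) (m # as)"
  proof (rule successively_strengthen[OF chain])
    fix x y assume x: "x \<in> set (m # as)" "y \<in> set (tl (m # as))" "\<alpha> x = y"
    have xn: "x \<in> {1..n}" using x(1) as assms(1) by auto
    have "x < y"
    proof (rule ccontr)
      assume "\<not> x < y"
      then have "x \<in> desc" using x(3) xn by (simp add: desc_def)
      moreover have "leaf F x \<rightarrow>\<^sup>*\<^bsub>with_proj (gr F)\<^esub> leaf F b"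
        using G.reachable_trans[OF reach_sym[OF reach[OF x(1)]] reach_sym[OF reachb]] .
      ultimately have "b \<le> x" using desc_max assms(2) by blast
      then have "x = b" using le[OF x(1)] by simp
      then show False using x(2,3) assms(3) m by simp
    qed
    then show "\<alpha> x = y \<and> x < y" using x(3) by simp
  qed
  then show thesis using that[of as] own as le last ne by simp
qed

lemma good_append: "good_f (append_f f g) \<longleftrightarrow> good_f f \<and> good_f g"
  by (induct f g rule: append_f.induct) auto

lemma good_fill: "good_b p b \<Longrightarrow> \<forall>v \<in> set (own b). good_f (\<gamma> v) \<Longrightarrow> good_b p (fill \<gamma> b)"
proof (induct b arbitrary: p rule: branch_induct)
  case (Node v bs)
  have r: "map apex (map (fill \<gamma>) bs) = map apex bs" by simp
  show ?case unfolding fill.simps good_b.simps r using Node by auto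
qed simp

text \<open>Induction on the number of leaves to cover. The last interval
  \<open>\<alpha> b, ..., b\<close> belongs to one tree; what lies before it and what lies between
  consecutive leaves of that tree are shorter gaps.\<close>

lemma gap_forest:
  "gap i b \<Longrightarrow> b \<le> n \<Longrightarrow> \<exists>g. good_f g \<and> leaves_f g = map (leaf F) [Suc i..<Suc b]"
proof (induct "b - i" arbitrary: i b rule: less_induct)
  case less
  show ?case using less(2)
  proof cases
    case gap_refl
    then show ?thesis by (intro exI[of _ Empty]) simp
  next
    case gap_step
    define m where "m = \<alpha> b"
    have m: "m \<in> {1..n}" "m \<le> b" using alpha_in gap_step by (auto simp: m_def)
    have im: "i < m" using gap_le[OF gap_step(3)] m by (auto simp: m_def)
    obtain g where g: "good_f g" "leaves_f g = map (leaf F) [Suc i..<Suc (m - 1)]"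
    proof -
      have "m - 1 - i < b - i" "m - 1 \<le> n" using im m less(3) by (linarith, linarith)
      then show thesis using less(1)[of "m - 1" i] gap_step(3) that unfolding m_def[symmetric] by blast
    qed
    have v: "(leaf F m, nb (leaf F m)) \<in> A" using nb_arc leaf_boundary m by blast
    obtain t where t: "apex t = nb (leaf F m)" "good_b (leaf F m) t" using exists_branch[OF v] by blast
    obtain as where as: "own t = map (leaf F) as" "set as \<subseteq> {1..n}" "\<And>a. a \<in> set as \<Longrightarrow> a \<le> b"
      "last (m # as) = b" "successively (\<lambda>x y. \<alpha> x = y \<and> x < y) (m # as)"
      using tree_leaves[OF m(1) gap_step(1) m_def[symmetric] m(2) t(2,1)] by blast
    \<comment> \<open>Forests are indexed by the leaf \<open>y\<close> that closes the gap; with its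
      predecessor \<open>x\<close> quantified inside, one choice function serves the whole
      tree.\<close>
    have "\<forall>y \<in> set as. \<exists>g. good_f g \<and>
        (\<forall>x \<in> {1..n}. \<alpha> x = y \<and> m \<le> x \<and> x < y \<longrightarrow> leaves_f g = map (leaf F) [Suc x..<y])"
    proof
      fix y assume y: "y \<in> set as"
      obtain x where x: "x \<in> {1..n}" "\<alpha> x = y" using alpha_surj[of y] as(2) y by blast
      have ux: "x' = x" if "x' \<in> {1..n}" "\<alpha> x' = y" for x'
        using inj_onD[OF alpha_inj, of x' x] that x by simp
      show "\<exists>g. good_f g \<and> (\<forall>x \<in> {1..n}. \<alpha> x = y \<and> m \<le> x \<and> x < y \<longrightarrow> leaves_f g = map (leaf F) [Suc x..<y])"
      proof (cases "m \<le> x \<and> x < y")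
        case True
        have "\<exists>g. good_f g \<and> leaves_f g = map (leaf F) [Suc x..<Suc (y - 1)]"
        proof (rule less(1))
          have "y \<le> b" using as(3) y .
          then show "y - 1 - x < b - i" "y - 1 \<le> n" using True im less(3) by (linarith, linarith)
          show "gap x (y - 1)" using gap_alpha[of x] x True by simp
        qed
        then show ?thesis using True ux by auto
      next
        case False
        show ?thesis
        proof (intro exI conjI ballI impI)
          \<comment> \<open>No predecessor of \<open>y\<close> meets the conditions, so the demand
            on the leaves is vacuous and any good forest will do.\<close>
          show "good_f Empty" by simp
          fix x' assume "x' \<in> {1..n}" "\<alpha> x' = y \<and> m \<le> x' \<and> x' < y"
          then show "leaves_f Empty = map (leaf F) [Suc x'..<y]" using ux[of x'] False by blast
        qed
      qed
    qed
    then obtain h where h: "\<And>y. y \<in> set as \<Longrightarrow> good_f (h y) \<and>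
        (\<forall>x \<in> {1..n}. \<alpha> x = y \<and> m \<le> x \<and> x < y \<longrightarrow> leaves_f (h y) = map (leaf F) [Suc x..<y])"
      by metis
    define \<gamma> where "\<gamma> v = h (idx v)" for v
    have hg: "\<gamma> (leaf F y) = h y" if "y \<in> set as" for y
      using idx_leaf[of y] as(2) that unfolding \<gamma>_def by auto
    have mx: "m \<le> x" if "x \<in> set (m # as)" for x
    proof -
      have "successively (<) (m # as)" using as(5) by (rule successively_mono) auto
      then show ?thesis using successively_less_first that by blast
    qed
    have "successively (\<lambda>x y. x < y \<and> leaves_f (\<gamma> (leaf F y)) = map (leaf F) [Suc x..<y]) (m # as)"
    proof (rule successively_strengthen[OF as(5)])
      fix x y assume x: "x \<in> set (m # as)" "y \<in> set (tl (m # as))" "\<alpha> x = y \<and> x < y"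
      then have "x \<in> {1..n}" "y \<in> set as" using m as(2) by auto
      then show "x < y \<and> leaves_f (\<gamma> (leaf F y)) = map (leaf F) [Suc x..<y]"
        using h[of y] hg x mx[OF x(1)] by simp
    qed
    then have "leaves_b (fill \<gamma> t) = map (leaf F) [Suc m..<Suc b]"
      using concat_chain[of "\<lambda>v. leaves_f (\<gamma> v)" "leaf F" m as] as(4) unfolding leaves_fill as(1) by simp
    moreover have "good_b (leaf F m) (fill \<gamma> t)"
      using h hg as(1) by (intro good_fill[OF t(2)]) auto
    moreover have "[Suc i..<Suc (m - 1)] @ m # [Suc m..<Suc b] = [Suc i..<Suc b]"
      using im m(2) by (subst upt_split[of "Suc i" m]) (auto simp: upt_conv_Cons simp del: upt_Suc)
    then have "map (leaf F) [Suc i..<Suc b] = map (leaf F) [Suc i..<Suc (m - 1)] @ leaf F m # map (leaf F) [Suc m..<Suc b]"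
      by (metis list.simps(9) map_append)
    ultimately show ?thesis
      using g v t(1) leaf_boundary[OF m(1)]
      by (intro exI[of _ "append_f g (Tree (leaf F m) (fill \<gamma> t) Empty)"]) (simp add: good_append del: upt_Suc)
  qed
qed

end

lemma distinct_concat_map:
  assumes "distinct (concat (map h xs))" "\<And>x. x \<in> set xs \<Longrightarrow> distinct (k x)"
    "\<And>x y. x \<in> set xs \<Longrightarrow> y \<in> set xs \<Longrightarrow> set (h x) \<inter> set (h y) = {} \<Longrightarrow> set (k x) \<inter> set (k y) = {}"
  shows "distinct (concat (map k xs))"
  using assms
proof (induct xs)
  case (Cons x xs)
  have "set (k x) \<inter> set (k y) = {}" if "y \<in> set xs" for y
    by (rule Cons(4)) (use that Cons(2) in auto)
  moreover have "distinct (concat (map k xs))" by (rule Cons(1)) (use Cons(2-4) in auto)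
  ultimately show ?case using Cons(3)[of x] by auto
qed simp

section \<open>No vertex is parsed twice\<close>

context planar_disk_forest
begin

text \<open>Two disjoint parts of the picture cannot share an internal vertex \<open>v\<close>: among its at least
  three neighbours there would be one lying beyond \<open>v\<close> in both parts, hence a common leaf.\<close>

definition anchor :: "'a \<Rightarrow> 'a set \<Rightarrow> bool" where
  "anchor v Ls \<longleftrightarrow> (v \<in> B \<longrightarrow> v \<in> Ls) \<and>
     (v \<notin> B \<longrightarrow> v \<in> V \<and> (\<exists>p. \<forall>w \<in> N v - {p}. \<exists>x \<in> Ls. nxt v w x))"

definition anchored :: "'a set \<Rightarrow> 'a set \<Rightarrow> bool" where
  "anchored Vs Ls \<longleftrightarrow> (\<forall>v \<in> Vs. anchor v Ls)"

lemma anchor_mono: "anchor v L1 \<Longrightarrow> L1 \<subseteq> L2 \<Longrightarrow> anchor v L2"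
  unfolding anchor_def by (meson subsetD)

lemma three_neighbours:
  assumes "v \<in> V" "v \<notin> B"
  obtains w where "w \<in> N v" "w \<noteq> p" "w \<noteq> p'" "w \<noteq> p''"
proof -
  have "\<not> N v \<subseteq> {p, p', p''}"
  proof
    assume "N v \<subseteq> {p, p', p''}"
    then have "card (N v) \<le> card {p, p', p''}" by (rule card_mono[rotated]) simp
    also have "\<dots> \<le> 3" by (simp add: card_insert_if)
    finally show False using internal_N[OF assms] by simp
  qed
  then show thesis using that by blast
qed

lemma anchored_disjoint:
  assumes "anchored V1 L1" "anchored V2 L2" "L1 \<inter> L2 = {}"
  shows "V1 \<inter> V2 = {}"
proof (rule equals0I)
  fix v assume v: "v \<in> V1 \<inter> V2"
  show False
  proof (cases "v \<in> B")
    case True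
    then show False using v assms unfolding anchored_def anchor_def by blast
  next
    case False
    then obtain p1 p2 where p: "v \<in> V" "\<forall>w \<in> N v - {p1}. \<exists>x \<in> L1. nxt v w x" "\<forall>w \<in> N v - {p2}. \<exists>x \<in> L2. nxt v w x"
      using v assms(1,2) unfolding anchored_def anchor_def by (metis IntD1 IntD2)
    obtain w where "w \<in> N v" "w \<noteq> p1" "w \<noteq> p2" using three_neighbours[OF p(1) False] by metis
    then obtain x y where "x \<in> L1" "nxt v w x" "y \<in> L2" "nxt v w y" using p(2,3) by blast
    then show False using nxt_unique assms(3) by blast
  qed
qed

lemma anchored_mono: "anchored V1 L1 \<Longrightarrow> L1 \<subseteq> L2 \<Longrightarrow> anchored V1 L2"
  unfolding anchored_def using anchor_mono by blast

lemma anchored_Un: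
  assumes "anchored V1 L1" "anchored V2 L2"
  shows "anchored (V1 \<union> V2) (L1 \<union> L2)"
  using anchored_mono[OF assms(1), of "L1 \<union> L2"] anchored_mono[OF assms(2), of "L1 \<union> L2"]
  unfolding anchored_def by blast

lemma anchored_UN:
  assumes "\<And>b. b \<in> S \<Longrightarrow> anchored (f b) (g b)"
  shows "anchored (\<Union>b \<in> S. f b) (\<Union>b \<in> S. g b)"
  unfolding anchored_def
proof
  fix v assume "v \<in> (\<Union>b \<in> S. f b)"
  then obtain b where b: "b \<in> S" "v \<in> f b" by blast
  then have "anchor v (g b)" using assms unfolding anchored_def by blast
  then show "anchor v (\<Union>b \<in> S. g b)" by (rule anchor_mono) (use b(1) in blast)
qed

lemma anchored_boundary: "v \<in> B \<Longrightarrow> v \<in> L \<Longrightarrow> anchored {v} L"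
  unfolding anchored_def anchor_def by blast

lemma good_child_arc: "good_b p (Node v bs) \<Longrightarrow> b \<in> set bs \<Longrightarrow> (v, apex b) \<in> A \<and> good_b v b"
  by auto

lemma good_anchored:
  "good_f f \<Longrightarrow> anchored (set (verts_f f)) (set (leaves_f f))"
  "good_b p b \<Longrightarrow> (p, apex b) \<in> A \<Longrightarrow> anchored (set (verts_b b)) (set (leaves_b b))"
proof (induct f and b arbitrary: and p rule: pforest_branch_induct)
  case Empty
  then show ?case by (simp add: anchored_def)
next
  case (Tree v b g)
  have "anchored {v} {v}" using Tree(3) by (intro anchored_boundary) auto
  moreover have "anchored (set (verts_b b)) (set (leaves_b b))" using Tree(1)[of v] Tree(3) by simp
  ultimately have "anchored ({v} \<union> (set (verts_b b) \<union> set (verts_f g))) ({v} \<union> (set (leaves_b b) \<union> set (leaves_f g)))"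
    using Tree(2,3) by (intro anchored_Un) auto
  then show ?case by simp
next
  case (Tip g v)
  have "anchored {v} {v}" using Tip(2) by (intro anchored_boundary) auto
  then have "anchored ({v} \<union> set (verts_f g)) ({v} \<union> set (leaves_f g))"
    using Tip(1,2) by (intro anchored_Un) auto
  then show ?case by simp
next
  case (Node v bs)
  have v: "v \<notin> B" "v \<in> V" using Node(2,3) arc_verts by auto
  have c: "(v, apex b) \<in> A \<and> good_b v b" if "b \<in> set bs" for b
    using good_child_arc[OF Node(2) that] .
  have "anchored (\<Union>b \<in> set bs. set (verts_b b)) (\<Union>b \<in> set bs. set (leaves_b b))"
    using Node(1) c by (intro anchored_UN) blast
  \<comment> \<open>The exempt neighbour of \<open>v\<close> is its parent \<open>p\<close>; beyond
    any child, the first leaf met is an own leaf of that subbranch.\<close>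
  moreover have "anchored {v} (\<Union>b \<in> set bs. set (leaves_b b))"
    unfolding anchored_def anchor_def
  proof (intro ballI conjI impI)
    fix u assume u: "u \<in> {v}"
    then show "u \<in> V" using v by simp
    show "u \<in> (\<Union>b \<in> set bs. set (leaves_b b))" if "u \<in> B" using u v that by simp
    have "\<exists>x \<in> (\<Union>b \<in> set bs. set (leaves_b b)). nxt v w x" if w: "w \<in> N v - {p}" for w
    proof -
      have "insert p (apex ` set bs) = N v" using Node(2) by simp
      then obtain b where b: "b \<in> set bs" "w = apex b" using w by blast
      then have "own b \<noteq> []" "nxt v w (hd (own b))" using tour[of v b] c by auto
      moreover have "hd (own b) \<in> set (leaves_b b)" using \<open>own b \<noteq> []\<close> own_leaves by force
      ultimately show ?thesis using b(1) by blast
    qed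
    then show "\<exists>p. \<forall>w \<in> N u - {p}. \<exists>x \<in> (\<Union>b \<in> set bs. set (leaves_b b)). nxt u w x" using u by blast
  qed
  ultimately have "anchored ({v} \<union> (\<Union>b \<in> set bs. set (verts_b b))) (\<Union>b \<in> set bs. set (leaves_b b))"
    using anchored_Un by (metis Un_absorb)
  then show ?case by simp
qed

lemma good_distinct:
  "good_f f \<Longrightarrow> distinct (leaves_f f) \<Longrightarrow> distinct (verts_f f)"
  "good_b p b \<Longrightarrow> (p, apex b) \<in> A \<Longrightarrow> distinct (leaves_b b) \<Longrightarrow> distinct (verts_b b)"
proof (induct f and b arbitrary: and p rule: pforest_branch_induct)
  case (Tree v b g)
  have a: "anchored {v} {v}" "anchored (set (verts_b b)) (set (leaves_b b))" "anchored (set (verts_f g)) (set (leaves_f g))"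
    using good_anchored(1)[of g] good_anchored(2)[of v b] Tree(3) by (auto intro: anchored_boundary)
  have "{v} \<inter> set (verts_b b) = {}" "{v} \<inter> set (verts_f g) = {}" "set (verts_b b) \<inter> set (verts_f g) = {}"
    using anchored_disjoint[OF a(1,2)] anchored_disjoint[OF a(1,3)] anchored_disjoint[OF a(2,3)] Tree(4) by auto
  moreover have "distinct (verts_b b)" "distinct (verts_f g)" using Tree by auto
  ultimately show ?case by simp
next
  case (Tip g v)
  have "{v} \<inter> set (verts_f g) = {}"
    using anchored_disjoint[OF anchored_boundary[of v "{v}"] good_anchored(1)[of g]] Tip(2,4) by simp
  then show ?case using Tip by simp
next
  case (Node v bs)
  have v: "v \<notin> B" "v \<in> V" using Node(2,3) arc_verts by auto
  have c: "(v, apex b) \<in> A \<and> good_b v b" if "b \<in> set bs" for b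
    using good_child_arc[OF Node(2) that] .
  have d: "distinct (concat (map leaves_b bs))" using Node(4) by simp
  have a: "anchored (set (verts_b b)) (set (leaves_b b))" if "b \<in> set bs" for b
    using good_anchored(2) c[OF that] by blast
  have "distinct (concat (map verts_b bs))"
  proof (rule distinct_concat_map[OF d])
    fix b assume b: "b \<in> set bs"
    then have "distinct (leaves_b b)" using d by (auto simp: distinct_concat_iff)
    then show "distinct (verts_b b)" using Node(1)[OF b] c[OF b] by blast
    fix b' assume "b' \<in> set bs" "set (leaves_b b) \<inter> set (leaves_b b') = {}"
    then show "set (verts_b b) \<inter> set (verts_b b') = {}" using anchored_disjoint[OF a[OF b] a] by blast
  qed
  moreover have "v \<notin> set (verts_b b)" if b: "b \<in> set bs" for b
  proof
    assume "v \<in> set (verts_b b)"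
    then obtain p' where p': "\<forall>w \<in> N v - {p'}. \<exists>x \<in> set (leaves_b b). nxt v w x"
      using a[OF b] v unfolding anchored_def anchor_def by blast
    \<comment> \<open>Degree 4 is used in full: besides the parent and the exempt \<open>p'\<close>,
      the apex of \<open>b\<close> is avoided too, so that the branch \<open>b'\<close> beyond
      \<open>w\<close> differs from \<open>b\<close> and yet shares a leaf with it.\<close>
    obtain w where w: "w \<in> N v" "w \<noteq> p" "w \<noteq> p'" "w \<noteq> apex b" using three_neighbours[OF v(2,1)] by metis
    have "insert p (apex ` set bs) = N v" using Node(2) by simp
    then obtain b' where b': "b' \<in> set bs" "w = apex b'" using w(1,2) by blast
    then have "own b' \<noteq> []" "nxt v w (hd (own b'))" using tour[of v b'] c by auto
    moreover have "hd (own b') \<in> set (leaves_b b')" using \<open>own b' \<noteq> []\<close> own_leaves by force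
    moreover obtain x where "x \<in> set (leaves_b b)" "nxt v w x" using p' w by blast
    ultimately have "hd (own b') \<in> set (leaves_b b) \<inter> set (leaves_b b')" using nxt_unique by blast
    moreover have "b \<noteq> b'" using w(4) b'(2) by blast
    ultimately show False using distinct_concat_disjoint[OF d b b'(1)] by blast
  qed
  ultimately show ?case by simp
qed simp

lemma good_nbrs:
  "good_f f \<Longrightarrow> (v, ns) \<in> set (nbrs_f f) \<Longrightarrow> v \<in> V \<and> set ns = N v \<and> map (rot F v) ns = rotate1 ns"
  "good_b p b \<Longrightarrow> (p, apex b) \<in> A \<Longrightarrow> (v, ns) \<in> set (nbrs_b p b) \<Longrightarrow>
     v \<in> V \<and> set ns = N v \<and> map (rot F v) ns = rotate1 ns"
proof (induct f and b arbitrary: and p rule: pforest_branch_induct)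
  case (Tree u b g)
  show ?case
  proof (cases "(v, ns) = (u, [apex b])")
    case True
    then show ?thesis using Tree(3) boundary_N[of u "apex b"] rot_boundary[of u "apex b"] arc_verts by auto
  next
    case False
    then show ?thesis using Tree(1)[of u] Tree(2-4) by auto
  qed
next
  case (Tip g u)
  show ?case
  proof (cases "(v, ns) = (u, [p])")
    case True
    then show ?thesis using Tip(2,3) boundary_N[of u p] rot_boundary[of u p] arc_verts arc_sym[of p u] by auto
  next
    case False
    then show ?thesis using Tip by auto
  qed
next
  case (Node u bs)
  show ?case
  proof (cases "(v, ns) = (u, p # map apex bs)")
    case True
    have "set (p # map apex bs) = N u" "map (rot F u) (p # map apex bs) = rotate1 (p # map apex bs)" "u \<in> V"
      using Node(2,3) arc_verts unfolding good_b.simps by auto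
    then show ?thesis using True by (simp only: prod.inject)
  next
    case False
    then obtain b where "b \<in> set bs" "(v, ns) \<in> set (nbrs_b u b)" using Node(4) by auto
    then show ?thesis using Node(1) good_child_arc[OF Node(2)] by blast
  qed
qed auto

text \<open>The vertices of the term filling the outermost gap are closed under adjacency, because
  each is listed with all its neighbours. As every vertex of the map reaches a leaf, none is
  missing.\<close>

theorem exists_drawing: "\<exists>f. draws n F f \<and> good_f f"
proof -
  obtain f where f: "good_f f" "leaves_f f = map (leaf F) [1..<Suc n]"
    using gap_forest[OF gap_top] by auto
  have "inj_on (leaf F) (set [1..<Suc n])" using inj_leaf by (simp add: atLeastLessThanSuc_atLeastAtMost del: upt_Suc)
  then have "distinct (leaves_f f)" unfolding f(2) by (simp add: distinct_map del: upt_Suc)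
  then have d: "distinct (verts_f f)" using good_distinct(1) f(1) by blast
  note nbr = good_nbrs(1)[OF f(1)]
  have vn: "\<exists>ns. (v, ns) \<in> set (nbrs_f f)" if "v \<in> set (verts_f f)" for v
  proof -
    have "v \<in> fst ` set (nbrs_f f)" using that map_fst_nbrs(1)[of f] by (metis set_map)
    then show ?thesis by force
  qed
  have closed: "w \<in> set (verts_f f)" if vw: "v \<in> set (verts_f f)" "(v, w) \<in> A" for v w
  proof -
    obtain ns where ns: "(v, ns) \<in> set (nbrs_f f)" using vn[OF vw(1)] by blast
    then have "w \<in> set ns" using nbr[OF ns] vw(2) by simp
    then show ?thesis using nbrs_closed(1)[OF ns] by blast
  qed
  have V: "V = set (verts_f f)"
  proof
    show "set (verts_f f) \<subseteq> V" using vn nbr by blast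
    show "V \<subseteq> set (verts_f f)"
    proof
      fix v assume "v \<in> V"
      then obtain w where w: "w \<in> B" "v \<rightarrow>\<^sup>*\<^bsub>with_proj (gr F)\<^esub> w" using reach_boundary by blast
      have "w \<in> set (leaves_f f)" using w(1) unfolding f(2) boundary_def
        by (simp add: atLeastLessThanSuc_atLeastAtMost del: upt_Suc)
      then have "w \<in> set (verts_f f)" using set_leaves_verts(1)[of f] by blast
      have "(w, v) \<in> A\<^sup>*" using reach_rtrancl reach_sym w(2) by blast
      then show "v \<in> set (verts_f f)"
      proof (induct rule: rtrancl_induct)
        case base
        show ?case by fact
      next
        case (step y z)
        then show ?case using closed by blast
      qed
    qed
  qed
  moreover have "A = arcs_of (nbrs_f f)"
  proof (rule set_eqI)
    fix e :: "'a \<times> 'a"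
    obtain v w where e: "e = (v, w)" by force
    have "(v, w) \<in> A \<longleftrightarrow> (\<exists>ns. (v, ns) \<in> set (nbrs_f f) \<and> w \<in> set ns)"
    proof
      assume vw: "(v, w) \<in> A"
      then obtain ns where ns: "(v, ns) \<in> set (nbrs_f f)" using vn[of v] arc_verts[OF vw] V by blast
      then show "\<exists>ns. (v, ns) \<in> set (nbrs_f f) \<and> w \<in> set ns" using nbr[OF ns] vw by auto
    next
      assume "\<exists>ns. (v, ns) \<in> set (nbrs_f f) \<and> w \<in> set ns"
      then obtain ns where ns: "(v, ns) \<in> set (nbrs_f f)" "w \<in> set ns" by blast
      then show "(v, w) \<in> A" using nbr[OF ns(1)] by auto
    qed
    then show "e \<in> A \<longleftrightarrow> e \<in> arcs_of (nbrs_f f)" by (simp add: e arcs_of_def)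
  qed
  moreover have "\<forall>(v, ns) \<in> set (nbrs_f f). map (rot F v) ns = rotate1 ns" using nbr by blast
  ultimately have "draws n F f" unfolding draws_def using d f(2)[symmetric] by (intro conjI)
  then show ?thesis using f(1) by blast
qed

end

section \<open>Parse trees draw planar forests\<close>

lemma subseq_concat_map: "x \<in> set xs \<Longrightarrow> subseq (h x) (concat (map h xs))"
proof (induct xs)
  case (Cons y ys)
  then show ?case
    by (cases "x = y") (auto intro: list_emb_append2)
qed simp

text \<open>A parent precedes its children in the vertex list; the position in the list then serves
  as the height function in \<open>unique_parent_acyclic\<close>.\<close>

lemma edges_subseq:
  fixes f :: "'a pforest" and b :: "'a branch"
  shows "(u, v) \<in> set (edges_f f) \<Longrightarrow> subseq [u, v] (verts_f f)"
    "(u, v) \<in> set (edges_b p b) \<Longrightarrow> subseq [u, v] (p # verts_b b)"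
proof (induct f and b arbitrary: and p rule: pforest_branch_induct)
  case (Tree w b g)
  show ?case
  proof (cases "(u, v) \<in> set (edges_b w b)")
    case True
    then have "subseq [u, v] (w # verts_b b)" using Tree(1) by blast
    then have "subseq [u, v] ((w # verts_b b) @ verts_f g)" by (rule subseq_rev_drop_many)
    then show ?thesis by simp
  next
    case False
    then have "subseq [u, v] ((w # verts_b b) @ verts_f g)" using Tree(2,3) by (intro list_emb_append2) auto
    then show ?thesis by simp
  qed
next
  case (Tip g w)
  show ?case
  proof (cases "(u, v) = (p, w)")
    case False
    then have "subseq [u, v] (w # verts_f g)" using Tip by (intro list_emb_Cons) auto
    then show ?thesis unfolding verts_b.simps by (rule list_emb_Cons)
  qed (auto simp: subseq_singleton_left)
next
  case (Node w bs)
  show ?case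
  proof (cases "(u, v) = (p, w)")
    case True
    then show ?thesis by (auto simp: subseq_singleton_left)
  next
    case False
    then obtain b where b: "b \<in> set bs" "(u, v) \<in> set (edges_b w b)" using Node(2) by auto
    then have "subseq [u, v] (w # verts_b b)" using Node(1) by blast
    also have "subseq \<dots> (w # concat (map verts_b bs))" using subseq_concat_map[OF b(1)] by simp
    finally show ?thesis unfolding verts_b.simps by (rule list_emb_Cons)
  qed
qed auto

definition position :: "'a list \<Rightarrow> 'a \<Rightarrow> nat" where
  "position xs x = length (takeWhile (\<lambda>y. y \<noteq> x) xs)"

lemma position_less: "distinct xs \<Longrightarrow> subseq [x, y] xs \<Longrightarrow> position xs x < position xs y"
proof (induct xs)
  case (Cons z zs)
  show ?case
  proof (cases "x = z")
    case True
    then have "y \<in> set zs" using Cons(3) by (simp add: subseq_singleton_left)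
    then show ?thesis using True Cons(2) by (auto simp: position_def)
  next
    case False
    then have s: "subseq [x, y] zs" using Cons(3) by simp
    have "y \<in> set zs" by (rule list_emb_set[OF s, of y]) auto
    then have "z \<noteq> x" "z \<noteq> y" using Cons(2) False by auto
    moreover have "position zs x < position zs y" using Cons(1) Cons(2) s by simp
    ultimately show ?thesis by (simp add: position_def)
  qed
qed simp

lemma nbrs_lengths:
  fixes f :: "'a pforest" and b :: "'a branch"
  shows "ok_f f \<Longrightarrow> (v, ns) \<in> set (nbrs_f f) \<Longrightarrow> (v \<in> set (leaves_f f) \<and> length ns = 1) \<or> (even (length ns) \<and> 4 \<le> length ns)"
    "ok_b b \<Longrightarrow> (v, ns) \<in> set (nbrs_b p b) \<Longrightarrow> (v \<in> set (leaves_b b) \<and> length ns = 1) \<or> (even (length ns) \<and> 4 \<le> length ns)"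
proof (induct f and b arbitrary: and p rule: pforest_branch_induct)
  case (Tree w b g)
  then show ?case using Tree(1)[of w] by auto
next
  case (Node w bs)
  show ?case
  proof (cases "(v, ns) = (w, p # map apex bs)")
    case False
    then obtain b where "b \<in> set bs" "(v, ns) \<in> set (nbrs_b w b)" using Node(3) by auto
    then show ?thesis using Node(1)[of b w] Node(2) by (auto simp: list_all_iff)
  qed (use Node(2) in auto)
qed auto

lemma leaf_nbrs:
  fixes f :: "'a pforest" and b :: "'a branch"
  shows "v \<in> set (leaves_f f) \<Longrightarrow> \<exists>w. (v, [w]) \<in> set (nbrs_f f)"
    "v \<in> set (leaves_b b) \<Longrightarrow> \<exists>w. (v, [w]) \<in> set (nbrs_b p b)"
proof (induct f and b arbitrary: and p rule: pforest_branch_induct)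
  case (Tree w b g)
  then show ?case using Tree(1)[of w] by auto
next
  case (Node w bs)
  then show ?case by fastforce
qed auto

lemma verts_reach:
  fixes f :: "'a pforest" and b :: "'a branch"
  shows "v \<in> set (verts_f f) \<Longrightarrow> \<exists>u \<in> set (openers_f f). (u, v) \<in> (set (edges_f f))\<^sup>*"
    "v \<in> set (verts_b b) \<Longrightarrow> \<exists>u \<in> insert p (set (openers_b b)). (u, v) \<in> (set (edges_b p b))\<^sup>*"
proof (induct f and b arbitrary: and p rule: pforest_branch_induct)
  case (Tree w b g)
  have mono: "(set (edges_b w b))\<^sup>* \<subseteq> (set (edges_f (Tree w b g)))\<^sup>*"
    "(set (edges_f g))\<^sup>* \<subseteq> (set (edges_f (Tree w b g)))\<^sup>*"
    by (intro rtrancl_mono; auto)+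
  consider "v = w" | "v \<in> set (verts_b b)" | "v \<in> set (verts_f g)" using Tree(3) by auto
  then show ?case
  proof cases
    case 2
    then show ?thesis using Tree(1)[of w] mono(1) by fastforce
  next
    case 3
    then show ?thesis using Tree(2) mono(2) by fastforce
  qed auto
next
  case (Tip g w)
  have mono: "(set (edges_f g))\<^sup>* \<subseteq> (set (edges_b p (Tip g w)))\<^sup>*"
    by (intro rtrancl_mono; auto)
  show ?case
  proof (cases "v = w")
    case True
    then have "(p, v) \<in> (set (edges_b p (Tip g w)))\<^sup>*" by auto
    then show ?thesis by blast
  next
    case False
    then show ?thesis using Tip mono by fastforce
  qed
next
  case (Node w bs)
  have pw: "(p, w) \<in> (set (edges_b p (Node w bs)))\<^sup>*" by auto
  show ?case
  proof (cases "v = w")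
    case True
    then show ?thesis using pw by blast
  next
    case False
    then obtain b where b: "b \<in> set bs" "v \<in> set (verts_b b)" using Node(2) by auto
    then obtain u where u: "u \<in> insert w (set (openers_b b))" "(u, v) \<in> (set (edges_b w b))\<^sup>*" using Node(1) by blast
    have "(set (edges_b w b))\<^sup>* \<subseteq> (set (edges_b p (Node w bs)))\<^sup>*" using b(1) by (intro rtrancl_mono) auto
    then have uv: "(u, v) \<in> (set (edges_b p (Node w bs)))\<^sup>*" using u(2) by blast
    show ?thesis
    proof (cases "u = w")
      case True
      then have "(p, v) \<in> (set (edges_b p (Node w bs)))\<^sup>*" using pw uv by (meson rtrancl_trans)
      then show ?thesis by blast
    next
      case False
      then have "u \<in> set (openers_b (Node w bs))" using u(1) b(1) by auto
      then show ?thesis using uv by blast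
    qed
  qed
qed auto

text \<open>On positions in the list, \<open>r\<close> adds 1 modulo the length.\<close>

lemma rotate1_cyclic_on:
  assumes "map r ns = rotate1 ns" "ns \<noteq> []"
  shows "cyclic_on r (set ns)"
proof -
  let ?k = "length ns"
  have step: "r (ns ! i) = ns ! (Suc i mod ?k)" if "i < ?k" for i
  proof -
    have "r (ns ! i) = rotate1 ns ! i" using assms(1) that by (metis nth_map)
    then show ?thesis using that by (simp add: nth_rotate1)
  qed
  have pow: "(r ^^ i) (ns ! 0) = ns ! (i mod ?k)" for i
  proof (induct i)
    case 0
    then show ?case using assms(2) by simp
  next
    case (Suc i)
    then show ?case using step[of "i mod ?k"] assms(2) by (simp add: mod_Suc_eq)
  qed
  have "set ns = orbit r (ns ! 0)"
  proof
    show "orbit r (ns ! 0) \<subseteq> set ns"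
    proof
      fix x assume "x \<in> orbit r (ns ! 0)"
      then obtain i where "x = ns ! (i mod ?k)" unfolding orbit_altdef using pow by blast
      then show "x \<in> set ns" using assms(2) by simp
    qed
    show "set ns \<subseteq> orbit r (ns ! 0)"
    proof
      fix x assume "x \<in> set ns"
      then obtain i where i: "i < ?k" "x = ns ! i" by (metis in_set_conv_nth)
      \<comment> \<open>An orbit consists of positive iterates only, so a full turn is added in
        order to include position 0.\<close>
      have "(r ^^ (i + ?k)) (ns ! 0) = ns ! ((i + ?k) mod ?k)" by (rule pow)
      then have "x = (r ^^ (i + ?k)) (ns ! 0)" using i by simp
      moreover have "0 < i + ?k" using assms(2) by simp
      ultimately show "x \<in> orbit r (ns ! 0)" unfolding orbit_altdef by blast
    qed
  qed
  moreover have "ns ! 0 \<in> set ns" using assms(2) by simp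
  ultimately show ?thesis by (intro cyclic_on_singleI)
qed

text \<open>At a vertex of the cycle with the largest \<open>d\<close>, both neighbours along the
  cycle would be its parent; in a cycle of length at least 3 they are different.\<close>

lemma unique_parent_acyclic:
  assumes wf: "pair_wf_digraph G" and d: "\<And>u v. (u, v) \<in> E \<Longrightarrow> d u < (d v :: nat)"
    and G: "parcs G = E \<union> E\<inverse>" and p: "\<And>u u' v. (u, v) \<in> E \<Longrightarrow> (u', v) \<in> E \<Longrightarrow> u = u'"
    and c: "pre_digraph.cycle (with_proj G) c"
  shows "length c \<le> 2"
proof (rule ccontr)
  interpret pair_wf_digraph G by fact
  assume "\<not> length c \<le> 2"
  define m where "m = length c"
  have m: "3 \<le> m" using \<open>\<not> length c \<le> 2\<close> by (simp add: m_def)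
  obtain u where u: "awalk u c u" "distinct (tl (pawalk_verts u c))" using c unfolding cycle_def by blast
  define W where "W = pawalk_verts u c"
  have W: "length W = Suc m" "W ! 0 = x \<and> W ! m = y \<and> (\<forall>t < m. c ! t = (W ! t, W ! Suc t))"
    if "pcas x c y" "W = pawalk_verts x c" "m = length c" for x y c W m
    using that
  proof (induct c arbitrary: x W m)
    case (Cons e es)
    { case 1 show ?case using Cons(1)[of "snd e"] 1 by (cases e) auto }
    { case 2
      have IH: "pawalk_verts (snd e) es ! 0 = snd e \<and> pawalk_verts (snd e) es ! length es = y \<and>
          (\<forall>t < length es. es ! t = (pawalk_verts (snd e) es ! t, pawalk_verts (snd e) es ! Suc t))"
        using Cons(2)[of "snd e"] 2 by simp
      have "(e # es) ! t = (W ! t, W ! Suc t)" if "t < m" for t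
        using 2 IH that by (cases t) auto
      then show ?case using 2 IH by simp }
  qed auto
  have "pcas u c u" using u(1) unfolding awalk_def by simp
  note W1 = W(1)[OF this W_def m_def] and W2 = W(2)[OF this W_def m_def]
  have arc: "(W ! t, W ! Suc t) \<in> E \<union> E\<inverse>" if "t < m" for t
  proof -
    have "c ! t \<in> set c" using that m_def by simp
    then have "c ! t \<in> parcs G" using u(1) unfolding awalk_def by auto
    then show ?thesis using W2 that G by simp
  qed
  have inj: "inj_on ((!) W) {1..m}"
  proof -
    have "distinct (tl W)" using u(2) by (simp add: W_def)
    then have "W ! Suc i \<noteq> W ! Suc j" if "i < m" "j < m" "i \<noteq> j" for i j
      using that W1 by (simp add: distinct_conv_nth nth_tl)
    then show ?thesis by (auto simp: inj_on_def) (metis One_nat_def Suc_le_D Suc_le_lessD)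
  qed
  let ?M = "(\<lambda>t. d (W ! t)) ` {1..m}"
  have M: "finite ?M" "?M \<noteq> {}" using m by auto
  then obtain j where "j \<in> {1..m}" "d (W ! j) = Max ?M" using Max_in[OF M] by (metis imageE)
  then have j: "j \<in> {1..m}" "\<And>t. t \<in> {1..m} \<Longrightarrow> d (W ! t) \<le> d (W ! j)"
    using Max_ge[OF M(1)] by auto
  have E: "(W ! t, W ! j) \<in> E" if "(W ! t, W ! j) \<in> E \<union> E\<inverse>" "t \<in> {1..m}" for t
    using that d[of "W ! j" "W ! t"] j(2)[of t] by auto
  \<comment> \<open>The closed walk repeats its start, \<open>W ! 0 = W ! m\<close>, so positions
    run cyclically over \<open>{1..m}\<close>; \<open>a\<close> and \<open>b\<close> are the
    neighbours of \<open>j\<close>.\<close>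
  define a where "a = (if j = 1 then m else j - 1)"
  define b where "b = (if j = m then 1 else Suc j)"
  have ab: "a \<in> {1..m}" "b \<in> {1..m}" "a \<noteq> b" using j(1) m by (auto simp: a_def b_def)
  have "(W ! a, W ! j) \<in> E \<union> E\<inverse>"
    using arc[of "j - 1"] j(1) W2 by (auto simp: a_def)
  moreover have "(W ! b, W ! j) \<in> E \<union> E\<inverse>"
    using arc[of j] arc[of 0] j(1) W2 m by (auto simp: b_def)
  ultimately have "W ! a = W ! b" using E ab p by blast
  then show False using inj_onD[OF inj _ ab(1,2)] ab(3) by blast
qed

lemma distinct_edges:
  assumes "distinct (verts_f f)"
  shows "distinct (map snd (edges_f f))" "(u, v) \<in> set (edges_f f) \<Longrightarrow> (u', v) \<in> set (edges_f f) \<Longrightarrow> u = u'"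
    "(u, v) \<in> set (edges_f f) \<Longrightarrow> position (verts_f f) u < position (verts_f f) v"
proof -
  have "mset (verts_f f) = mset (openers_f f @ map snd (edges_f f))" by (simp add: mset_verts_edges(1))
  then have "distinct (openers_f f @ map snd (edges_f f))" using assms by (metis mset_eq_imp_distinct_iff)
  then show d: "distinct (map snd (edges_f f))" by simp
  show "u = u'" if "(u, v) \<in> set (edges_f f)" "(u', v) \<in> set (edges_f f)"
    using d that by (metis distinct_map inj_onD prod.inject snd_conv)
  show "position (verts_f f) u < position (verts_f f) v" if "(u, v) \<in> set (edges_f f)"
    using position_less[OF assms edges_subseq(1)[OF that]] .
qed

section \<open>The map drawn by a parse tree\<close>

locale drawing =
  fixes n :: nat and F :: "'a disk_graph" and f :: "'a pforest"
  assumes drawn: "draws n F f" and ok: "ok_f f" and n_ge: "1 \<le> n"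
begin

lemmas D = drawsD[OF drawn]

lemma arcs_edges: "parcs (gr F) = set (edges_f f) \<union> (set (edges_f f))\<inverse>"
  using D(3) arcs_of_nbrs(1) by metis

lemma graph: "pair_graph (gr F)"
proof -
  have sub: "u \<in> pverts (gr F) \<and> v \<in> pverts (gr F)" if uv: "(u, v) \<in> parcs (gr F)" for u v
  proof -
    obtain ns where ns: "(u, ns) \<in> set (nbrs_f f)" "v \<in> set ns"
      using uv unfolding D(3) arcs_of_def by blast
    then have "u \<in> set (map fst (nbrs_f f))" by force
    then show ?thesis using nbrs_closed(1)[OF ns(1)] ns(2) unfolding D(2) map_fst_nbrs by blast
  qed
  have irr: "u \<noteq> v" if "(u, v) \<in> parcs (gr F)" for u v
    using that distinct_edges(3)[OF D(1)] unfolding arcs_edges by force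
  have "finite (parcs (gr F))" unfolding arcs_edges by simp
  moreover have "finite (pverts (gr F))" unfolding D(2) by simp
  moreover have "symmetric (with_proj (gr F))"
    unfolding symmetric_def with_proj_simps arcs_edges by (auto simp: sym_def)
  ultimately show ?thesis using sub irr by unfold_locales (auto simp: case_prod_beta)
qed

sublocale G: pair_graph "gr F" by (rule graph)

lemma boundary_eq: "boundary n F = set (leaves_f f)"
  unfolding boundary_def D(4)[symmetric] by (simp add: atLeastLessThanSuc_atLeastAtMost del: upt_Suc)

lemma deg_eq: "(v, ns) \<in> set (nbrs_f f) \<Longrightarrow> deg F v = length ns"
proof -
  assume v: "(v, ns) \<in> set (nbrs_f f)"
  have "out_arcs (with_proj (gr F)) v = Pair v ` set ns"
    unfolding draws_nbrs(2)[OF drawn v] by (auto simp: out_arcs_def)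
  then show ?thesis
    using draws_nbrs(1)[OF drawn v] by (simp add: out_degree_def card_image inj_on_def distinct_card)
qed

lemma vertex_nbrs: "v \<in> pverts (gr F) \<Longrightarrow> \<exists>ns. (v, ns) \<in> set (nbrs_f f)"
proof -
  assume "v \<in> pverts (gr F)"
  then have "v \<in> set (map fst (nbrs_f f))" unfolding D(2) map_fst_nbrs .
  then show ?thesis by force
qed

lemma deg_leaf: "v \<in> boundary n F \<Longrightarrow> deg F v = 1"
  using leaf_nbrs(1)[of v f] deg_eq unfolding boundary_eq by fastforce

lemma deg_node: "v \<in> internal n F \<Longrightarrow> even (deg F v) \<and> 4 \<le> deg F v"
  using vertex_nbrs[of v] nbrs_lengths(1)[OF ok, of v] deg_eq[of v]
  unfolding internal_def boundary_eq by force

lemma openers_leaves: "set (openers_f f) \<subseteq> set (leaves_f f)"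
  using arg_cong[OF mset_leaves(1)[of f], of set_mset] by auto

lemma reach_boundary: "v \<in> pverts (gr F) \<Longrightarrow> \<exists>w \<in> boundary n F. v \<rightarrow>\<^sup>*\<^bsub>with_proj (gr F)\<^esub> w"
proof -
  assume v: "v \<in> pverts (gr F)"
  then obtain u where u: "u \<in> set (openers_f f)" "(u, v) \<in> (set (edges_f f))\<^sup>*"
    using verts_reach(1)[OF v[unfolded D(2)]] by blast
  have ub: "u \<in> boundary n F" using u(1) openers_leaves unfolding boundary_eq by blast
  then have "u \<in> set (verts_f f)" using set_leaves_verts(1)[of f] unfolding boundary_eq by blast
  then have "u \<in> pverts (gr F)" unfolding D(2) .
  then have r: "u \<rightarrow>\<^sup>*\<^bsub>with_proj (gr F)\<^esub> u" by (rule G.reachable_refl)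
  have "u \<rightarrow>\<^sup>*\<^bsub>with_proj (gr F)\<^esub> v" using u(2)
  proof (induct rule: rtrancl_induct)
    case base
    show ?case by (rule r)
  next
    case (step y z)
    then have "(y, z) \<in> parcs (gr F)" unfolding arcs_edges by blast
    then show ?case by (rule G.reachable_adj_trans[OF step(3)])
  qed
  then have "v \<rightarrow>\<^sup>*\<^bsub>with_proj (gr F)\<^esub> u" by (rule symmetric_reachable[OF G.sym_arcs])
  then show ?thesis using ub by blast
qed

text \<open>This makes tours, faces and \<open>euler_le\<close> available for the drawn map before
  its planarity is known.\<close>

sublocale disk_forest n F
proof
  show "length p \<le> 2" if "pre_digraph.cycle (with_proj (gr F)) p" for p
    by (rule unique_parent_acyclic[OF G.pair_wf_digraph distinct_edges(3)[OF D(1)] arcs_edges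
          distinct_edges(2)[OF D(1)] that])
  show "inj_on (leaf F) {1..n}"
    using distinct_leaves[OF D(1)] unfolding D(4)[symmetric]
    by (simp add: distinct_map atLeastLessThanSuc_atLeastAtMost del: upt_Suc)
  show "boundary n F \<subseteq> pverts (gr F)" unfolding boundary_eq D(2) by (rule set_leaves_verts(1))
  show "cyclic_on (rot F v) {w. (v, w) \<in> parcs (gr F)}" if v: "v \<in> pverts (gr F)" for v
  proof -
    obtain ns where ns: "(v, ns) \<in> set (nbrs_f f)" using vertex_nbrs[OF v] by blast
    have "ns \<noteq> []" using nbrs_lengths(1)[OF ok ns] by auto
    then show ?thesis using rotate1_cyclic_on[OF D(5)[OF ns]] draws_nbrs(2)[OF drawn ns] by simp
  qed
  show "1 \<le> n" by (rule n_ge)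
  show "deg F v = 1" if "v \<in> boundary n F" for v using that by (rule deg_leaf)
  show "4 \<le> deg F v" if "v \<in> internal n F" for v using deg_node[OF that] by blast
  show "\<exists>w \<in> boundary n F. v \<rightarrow>\<^sup>*\<^bsub>with_proj (gr F)\<^esub> w" if "v \<in> pverts (gr F)" for v
    using that by (rule reach_boundary)
qed

lemma good_of_nbrs:
  "ok_f g \<Longrightarrow> set (leaves_f g) \<subseteq> B \<Longrightarrow>
     \<forall>(v, ns) \<in> set (nbrs_f g). distinct ns \<and> set ns = N v \<and> map (rot F v) ns = rotate1 ns \<Longrightarrow> good_f g"
  "ok_b b \<Longrightarrow> set (leaves_b b) \<subseteq> B \<Longrightarrow>
     \<forall>(v, ns) \<in> set (nbrs_b p b). distinct ns \<and> set ns = N v \<and> map (rot F v) ns = rotate1 ns \<Longrightarrow> good_b p b"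
proof (induct g and b arbitrary: and p rule: pforest_branch_induct)
  case (Tree v b g)
  then show ?case using Tree(1)[of v] by auto
next
  case (Node v bs)
  have v: "distinct (p # map apex bs)" "set (p # map apex bs) = N v"
    "map (rot F v) (p # map apex bs) = rotate1 (p # map apex bs)"
    using Node(4) by simp_all
  have "card (N v) = Suc (length bs)" using v(1,2) distinct_card by fastforce
  then have "v \<notin> B" using deg_boundary[of v] Node(2) unfolding deg_card by auto
  moreover have "\<forall>b \<in> set bs. good_b v b"
  proof
    fix b assume b: "b \<in> set bs"
    show "good_b v b" by (rule Node(1)[OF b]) (use b Node(2-4) in \<open>auto simp: list_all_iff\<close>)
  qed
  ultimately show ?case using v unfolding good_b.simps by blast
qed auto

lemma good: "good_f f"
proof (rule good_of_nbrs(1)[OF ok])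
  show "set (leaves_f f) \<subseteq> B" by (simp add: boundary_eq)
  show "\<forall>(v, ns) \<in> set (nbrs_f f). distinct ns \<and> set ns = N v \<and> map (rot F v) ns = rotate1 ns"
    using draws_nbrs[OF drawn] D(5) by auto
qed

lemma card_verts_edges: "card V = length (openers_f f) + length (edges_f f)" "card A = 2 * length (edges_f f)"
proof -
  have "length (verts_f f) = length (openers_f f) + length (edges_f f)"
    using arg_cong[OF mset_verts_edges(1)[of f], of size] by simp
  then show "card V = length (openers_f f) + length (edges_f f)"
    unfolding D(2) using distinct_card[OF D(1)] by simp
  have de: "distinct (edges_f f)" using distinct_edges(1)[OF D(1)] by (simp add: distinct_map)
  have "set (edges_f f) \<inter> (set (edges_f f))\<inverse> = {}"
  proof (rule equals0I)
    fix e assume "e \<in> set (edges_f f) \<inter> (set (edges_f f))\<inverse>"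
    then have "(fst e, snd e) \<in> set (edges_f f)" "(snd e, fst e) \<in> set (edges_f f)" by auto
    from this[THEN distinct_edges(3)[OF D(1)]] show False by simp
  qed
  then have "card A = card (set (edges_f f)) + card ((set (edges_f f))\<inverse>)"
    unfolding arcs_edges by (intro card_Un_disjoint) auto
  then show "card A = 2 * length (edges_f f)" using distinct_card[OF de] by simp
qed

lemma n_eq: "n = length (openers_f f) + length (tips_f f)"
proof -
  have "length (leaves_f f) = n" using arg_cong[OF D(4), of length] by (simp del: upt_Suc)
  then show ?thesis using arg_cong[OF mset_leaves(1)[of f], of size] by simp
qed

end

lemma own_nonempty: "ok_b b \<Longrightarrow> own b \<noteq> []"
proof (induct b rule: branch_induct)
  case (Node v bs)
  then show ?case by (cases bs) (auto simp: list_all_iff)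
qed simp

text \<open>
  The faces of the capped map correspond to the gaps: the outermost one is \<open>None\<close>, and the gap closed by
  the leaf \<open>v\<close> of a \<open>Tip\<close> is \<open>Some v\<close>. The sets \<open>sides\<close> label each arc with the gap along which it runs,
  where \<open>nx\<close> is the gap met after the branch; the arc from a branch back to its parent is added by the parent.
\<close>

abbreviation "first_gap b \<equiv> Some (hd (own b))"

fun sides_f :: "'a option \<Rightarrow> 'a pforest \<Rightarrow> (('a option \<times> 'a option) \<times> 'a option) set"
  and sides_b :: "'a \<Rightarrow> 'a option \<Rightarrow> 'a branch \<Rightarrow> (('a option \<times> 'a option) \<times> 'a option) set"
  and sides_bs :: "'a \<Rightarrow> 'a option \<Rightarrow> 'a branch list \<Rightarrow> (('a option \<times> 'a option) \<times> 'a option) set" where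
  "sides_f e Empty = {}"
| "sides_f e (Tree v b g) = {((None, Some v), first_gap b), ((Some v, None), e), ((Some (apex b), Some v), e)}
     \<union> sides_b v e b \<union> sides_f e g"
| "sides_b p nx (Tip g v) = {((Some p, Some v), Some v), ((None, Some v), nx), ((Some v, None), Some v)}
     \<union> sides_f (Some v) g"
| "sides_b p nx (Node v bs) = {((Some p, Some v), Some (hd (concat (map own bs))))} \<union> sides_bs v nx bs"
| "sides_bs v nx [] = {}"
| "sides_bs v nx (b # bs) = {((Some (apex b), Some v), if bs = [] then nx else first_gap (hd bs))}
     \<union> sides_b v (if bs = [] then nx else first_gap (hd bs)) b \<union> sides_bs v nx bs"

text \<open>For each leaf, the labels of the arcs leading to and coming from the vertex \<open>None\<close> of the cap.\<close>

fun tour_f :: "'a option \<Rightarrow> 'a pforest \<Rightarrow> ('a \<times> 'a option \<times> 'a option) list"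
  and tour_b :: "'a option \<Rightarrow> 'a branch \<Rightarrow> ('a \<times> 'a option \<times> 'a option) list"
  and tour_bs :: "'a option \<Rightarrow> 'a branch list \<Rightarrow> ('a \<times> 'a option \<times> 'a option) list" where
  "tour_f e Empty = []"
| "tour_f e (Tree v b g) = (v, e, first_gap b) # tour_b e b @ tour_f e g"
| "tour_b nx (Tip g v) = tour_f (Some v) g @ [(v, Some v, nx)]"
| "tour_b nx (Node v bs) = tour_bs nx bs"
| "tour_bs nx [] = []"
| "tour_bs nx (b # bs) = tour_b (if bs = [] then nx else first_gap (hd bs)) b @ tour_bs nx bs"

text \<open>The arc from the cap into a leaf and the arc from the next leaf to the cap are
  consecutive in a face, so their labels have to agree.\<close>

fun linked :: "'b \<Rightarrow> ('a \<times> 'b \<times> 'b) list \<Rightarrow> 'b \<Rightarrow> bool" where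
  "linked s [] t \<longleftrightarrow> s = t"
| "linked s ((v, i, j) # xs) t \<longleftrightarrow> i = s \<and> linked j xs t"

lemma linked_append: "linked s xs m \<Longrightarrow> linked m ys t \<Longrightarrow> linked s (xs @ ys) t"
  by (induct s xs m rule: linked.induct) auto

lemma linked_nth:
  "linked s xs t \<Longrightarrow> i < length xs \<Longrightarrow> fst (snd (xs ! i)) = (if i = 0 then s else snd (snd (xs ! (i - 1))))"
proof (induct s xs t arbitrary: i rule: linked.induct)
  case (2 s v a b xs t)
  then show ?case by (cases i) (auto split: if_splits)
qed simp

lemma linked_last: "linked s xs t \<Longrightarrow> xs \<noteq> [] \<Longrightarrow> snd (snd (last xs)) = t"
  by (induct s xs t rule: linked.induct) auto

text \<open>A branch leads from the gap closed by its first own leaf to the gap \<open>nx\<close>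
  behind it, a forest from the gap around it back to the same gap.\<close>

lemma linked_tour:
  fixes f :: "'a pforest" and b :: "'a branch" and e nx :: "'a option"
  shows
  "ok_f f \<Longrightarrow> linked e (tour_f e f) e"
  "ok_b b \<Longrightarrow> linked (first_gap b) (tour_b nx b) nx"
proof (induct f and b arbitrary: e and nx rule: pforest_branch_induct)
  case (Tree v b g)
  then show ?case by (auto intro: linked_append)
next
  case (Tip g v)
  then show ?case using linked_append[of "Some v" "tour_f (Some v) g" "Some v" "[(v, Some v, nx)]" nx] by simp
next
  case (Node v bs)
  have "linked (Some (hd (concat (map own bs)))) (tour_bs nx bs) nx" if "bs \<noteq> []" "list_all ok_b bs"
    using that Node(1)
  proof (induct bs)
    case (Cons b bs)
    have o: "hd (concat (map own (b # bs))) = hd (own b)" using own_nonempty[of b] Cons(3) by simp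
    show ?case
    proof (cases "bs = []")
      case True
      then show ?thesis using Cons(3) Cons(4)[of b nx] o by simp
    next
      case False
      have "linked (Some (hd (concat (map own bs)))) (tour_bs nx bs) nx"
        using Cons(1)[OF False] Cons(3,4) by simp
      moreover have "hd (concat (map own bs)) = hd (own (hd bs))"
        using False own_nonempty[of "hd bs"] Cons(3) by (cases bs) auto
      moreover have "linked (first_gap b) (tour_b (first_gap (hd bs)) b) (first_gap (hd bs))"
        using Cons(3) Cons(4)[of b "first_gap (hd bs)"] by simp
      ultimately show ?thesis using False o by (auto intro: linked_append)
    qed
  qed simp
  then show ?case using Node(2) by fastforce
qed simp

lemma leaves_tour:
  fixes f :: "'a pforest" and b :: "'a branch" and bs :: "'a branch list" and e nx :: "'a option"
  shows
  "map fst (tour_f e f) = leaves_f f" "map fst (tour_b nx b) = leaves_b b"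
  "map fst (tour_bs nx bs) = concat (map leaves_b bs)"
  by (induct e f and nx b and nx bs rule: tour_f_tour_b_tour_bs.induct) auto

lemma sides_out:
  fixes f :: "'a pforest" and b :: "'a branch" and bs :: "'a branch list" and e nx :: "'a option"
  shows
  "((Some v, None), l) \<in> sides_f e f \<longleftrightarrow> (\<exists>j. (v, l, j) \<in> set (tour_f e f))"
  "((Some v, None), l) \<in> sides_b p nx b \<longleftrightarrow> (\<exists>j. (v, l, j) \<in> set (tour_b nx b))"
  "((Some v, None), l) \<in> sides_bs p nx bs \<longleftrightarrow> (\<exists>j. (v, l, j) \<in> set (tour_bs nx bs))"
  by (induct e f and p nx b and p nx bs rule: sides_f_sides_b_sides_bs.induct) auto

lemma sides_in:
  fixes f :: "'a pforest" and b :: "'a branch" and bs :: "'a branch list" and e nx :: "'a option"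
  shows
  "((None, Some v), l) \<in> sides_f e f \<longleftrightarrow> (\<exists>i. (v, i, l) \<in> set (tour_f e f))"
  "((None, Some v), l) \<in> sides_b p nx b \<longleftrightarrow> (\<exists>i. (v, i, l) \<in> set (tour_b nx b))"
  "((None, Some v), l) \<in> sides_bs p nx bs \<longleftrightarrow> (\<exists>i. (v, i, l) \<in> set (tour_bs nx bs))"
  by (induct e f and p nx b and p nx bs rule: sides_f_sides_b_sides_bs.induct) auto

text \<open>This is what tells faces apart: a tip that is not also an opener sends to the cap an arc
  with no label but the gap that the tip closes.\<close>

lemma tour_tips:
  fixes f :: "'a pforest" and b :: "'a branch" and bs :: "'a branch list" and e nx :: "'a option"
  shows
  "(v, l, j) \<in> set (tour_f e f) \<Longrightarrow> v \<in> set (openers_f f) \<or> v \<in> set (tips_f f) \<and> l = Some v"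
  "(v, l, j) \<in> set (tour_b nx b) \<Longrightarrow> v \<in> set (openers_b b) \<or> v \<in> set (tips_b b) \<and> l = Some v"
  "(v, l, j) \<in> set (tour_bs nx bs) \<Longrightarrow> (\<exists>b \<in> set bs. v \<in> set (openers_b b) \<or> v \<in> set (tips_b b) \<and> l = Some v)"
  by (induct e f and nx b and nx bs rule: tour_f_tour_b_tour_bs.induct) auto

lemma tips_tour:
  fixes f :: "'a pforest" and b :: "'a branch" and bs :: "'a branch list" and e nx :: "'a option"
  shows
  "v \<in> set (tips_f f) \<Longrightarrow> \<exists>j. (v, Some v, j) \<in> set (tour_f e f)"
  "v \<in> set (tips_b b) \<Longrightarrow> \<exists>j. (v, Some v, j) \<in> set (tour_b nx b)"
  "b \<in> set bs \<Longrightarrow> v \<in> set (tips_b b) \<Longrightarrow> \<exists>j. (v, Some v, j) \<in> set (tour_bs nx bs)"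
  by (induct e f and nx b and nx bs arbitrary: and and b rule: tour_f_tour_b_tour_bs.induct) fastforce+

lemma sides_entry: "own b \<noteq> [] \<Longrightarrow> ((Some p, Some (apex b)), first_gap b) \<in> sides_b p nx b"
  by (cases b) auto

context drawing
begin

text \<open>Treats the arcs that do not end in the cap. A face leaving the branch continues on the
  arc back to \<open>p\<close>; its label \<open>nx\<close> is recorded by the parent, hence the
  insertion.\<close>

lemma sides_closed:
  "good_f g \<Longrightarrow> ((u, Some w), l) \<in> sides_f e g \<Longrightarrow> (\<psi> (u, Some w), l) \<in> sides_f e g"
  "good_b p b \<Longrightarrow> (p, apex b) \<in> A \<Longrightarrow> ((u, Some w), l) \<in> sides_b p nx b \<Longrightarrow>
     (\<psi> (u, Some w), l) \<in> insert ((Some (apex b), Some p), nx) (sides_b p nx b)"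
proof (induct g and b arbitrary: e u w l and p nx u w l rule: pforest_branch_induct)
  case (Tree v b g)
  have v: "v \<in> B" "(v, apex b) \<in> A" "good_b v b" "good_f g" using Tree(3) by auto
  have nb: "nb v = apex b" using nb_eq v by blast
  have o: "own b \<noteq> []" using tour v by blast
  have entry: "((Some v, Some (apex b)), first_gap b) \<in> sides_b v e b" by (rule sides_entry[OF o])
  consider "(u, Some w) = (None, Some v)" "l = first_gap b" | "(u, Some w) = (Some (apex b), Some v)" "l = e"
    | "((u, Some w), l) \<in> sides_b v e b" | "((u, Some w), l) \<in> sides_f e g"
    using Tree(4) by auto
  then show ?case
  proof cases
    case 1
    then show ?thesis using psi_simps(3)[of v] nb entry by simp
  next
    case 2
    then show ?thesis using psi_simps(1)[OF v(1), of "apex b"] by simp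
  next
    case 3
    then show ?thesis using Tree(1)[OF v(3,2)] by auto
  next
    case 4
    then show ?thesis using Tree(2)[OF v(4)] by auto
  qed
next
  case (Tip g v)
  have v: "v \<in> B" "(p, v) \<in> A" "good_f g" using Tip(2,3) by auto
  have nb: "nb v = p" using nb_eq v arc_sym by blast
  consider "(u, Some w) = (Some p, Some v)" "l = Some v" | "(u, Some w) = (None, Some v)" "l = nx"
    | "((u, Some w), l) \<in> sides_f (Some v) g"
    using Tip(4) by auto
  then show ?case
  proof cases
    case 1
    then show ?thesis using psi_simps(1)[OF v(1), of p] by simp
  next
    case 2
    then show ?thesis using psi_simps(3)[of v] nb by simp
  next
    case 3
    then show ?thesis using Tip(1)[OF v(3)] by auto
  qed
next
  case (Node v bs)
  have v: "v \<notin> B" using Node(2) by simp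
  have pv: "(p, v) \<in> A" using Node(3) by simp
  note c = good_children[OF Node(2) pv]
  have ch: "good_b v b \<and> (v, apex b) \<in> A" if "b \<in> set bs" for b
    using Node(2) that by auto
  have own: "own b \<noteq> []" if "b \<in> set bs" for b
    using tour ch[OF that] by blast
  have bs: "bs \<noteq> []" using c(1) by auto
  have first: "((Some v, Some (apex (hd bs))), Some (hd (concat (map own bs)))) \<in> sides_bs v nx bs"
    using bs own[of "hd bs"] sides_entry[of "hd bs" v] by (cases bs) auto
  \<comment> \<open>Induction over the remaining children: by the rotation each subbranch hands the
    face on to the next one, and the last to the parent.\<close>
  have inner: "(\<psi> (u, Some w), l) \<in> insert ((Some v, Some p), nx) (sides_bs v nx bs)"
    if "((u, Some w), l) \<in> sides_bs v nx bs"
    using bs that c(3,4) Node(1) ch own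
  proof (induct bs)
    case (Cons b bs)
    let ?nx = "if bs = [] then nx else first_gap (hd bs)"
    consider "(u, Some w) = (Some (apex b), Some v)" "l = ?nx" | "((u, Some w), l) \<in> sides_b v ?nx b"
      | "((u, Some w), l) \<in> sides_bs v nx bs" "bs \<noteq> []"
      using Cons(3) by (cases bs) auto
    then show ?case
    proof cases
      case 1
      then have psi: "\<psi> (u, Some w) = (Some v, Some (rot F v (apex b)))"
        using psi_simps(2)[OF v] by simp
      show ?thesis
      proof (cases "bs = []")
        case True
        then show ?thesis using psi 1 Cons(4) by simp
      next
        case False
        then obtain b' bs' where b': "bs = b' # bs'" by (cases bs) auto
        have "((Some v, Some (apex b')), first_gap b') \<in> sides_b v nx' b'" for nx'
          by (rule sides_entry[OF Cons.prems(7)]) (simp add: b')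
        then have "((Some v, Some (apex b')), first_gap b') \<in> sides_bs v nx bs" unfolding b' by simp
        moreover have "rot F v (apex b) = apex b'" using b' Cons.prems(4) by simp
        moreover have "l = first_gap b'" using 1(2) b' by simp
        ultimately have "(\<psi> (u, Some w), l) \<in> sides_bs v nx bs" using psi by (simp only:)
        then show ?thesis by simp
      qed
    next
      case 2
      have "(\<psi> (u, Some w), l) \<in> insert ((Some (apex b), Some v), ?nx) (sides_b v ?nx b)"
        using Cons.prems(5,6) 2 by simp
      then show ?thesis by auto
    next
      case 3
      have "(\<psi> (u, Some w), l) \<in> insert ((Some v, Some p), nx) (sides_bs v nx bs)"
        using Cons.prems(3-) 3 by (intro Cons.hyps) (auto simp: successively_Cons)
      then show ?thesis by auto
    qed
  qed simp
  show ?case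
  proof (cases "(u, Some w) = (Some p, Some v) \<and> l = Some (hd (concat (map own bs)))")
    case True
    then show ?thesis using psi_simps(2)[OF v, of p] c(2) first by simp
  next
    case False
    then have "((u, Some w), l) \<in> sides_bs v nx bs" using Node(4) by auto
    then show ?thesis using inner by auto
  qed
qed simp

lemma sides_step:
  assumes "a \<in> C" "(a, l) \<in> sides_f None f"
  shows "(\<psi> a, l) \<in> sides_f None f"
proof -
  obtain u w where a: "a = (u, w)" by force
  show ?thesis
  proof (cases w)
    case (Some w')
    then show ?thesis using sides_closed(1)[OF good] assms(2) a by simp
  next
    case None
    then obtain v where v: "u = Some v" "v \<in> B" using assms(1) a by (cases u) auto
    let ?io = "tour_f None f"
    have lk: "linked None ?io None" by (rule linked_tour(1)[OF ok])
    have io: "map fst ?io = map (leaf F) [1..<Suc n]" using leaves_tour(1) D(4) by metis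
    have len: "length ?io = n" using arg_cong[OF io, of length] by (simp del: upt_Suc)
    have nth: "fst (?io ! i) = leaf F (Suc i)" if "i < n" for i
      using arg_cong[OF io, of "\<lambda>xs. xs ! i"] that len by (simp del: upt_Suc)
    obtain j where "(v, l, j) \<in> set ?io" using assms(2) unfolding a None v(1) sides_out by blast
    then obtain i where i: "i < n" "?io ! i = (v, l, j)" using len by (metis in_set_conv_nth)
    have vi: "v = leaf F (Suc i)" using nth[OF i(1)] i(2) by simp
    have l: "l = (if i = 0 then None else snd (snd (?io ! (i - 1))))"
      using linked_nth[OF lk, of i] i len by simp
    \<comment> \<open>Entry \<open>i\<close> of the tour belongs to leaf \<open>i + 1\<close>. The
      first leaf is cyclically preceded by the last one, and the labels match there because the tour
      is linked from \<open>None\<close> to \<open>None\<close>.\<close>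
    define k where "k = (if i = 0 then n - 1 else i - 1)"
    have k: "k < n" "prv (Suc i) = Suc k" using i(1) by (auto simp: k_def prv_def)
    have "snd (snd (?io ! k)) = l"
    proof (cases "i = 0")
      case True
      have "?io \<noteq> []" using i(1) len by auto
      then show ?thesis using linked_last[OF lk] True l len by (simp add: k_def last_conv_nth)
    qed (use l in \<open>simp add: k_def\<close>)
    then have "?io ! k = (leaf F (Suc k), fst (snd (?io ! k)), l)" using nth[OF k(1)] by (metis prod.collapse)
    then have "(leaf F (Suc k), fst (snd (?io ! k)), l) \<in> set ?io" using k(1) len by (metis nth_mem)
    then have "((None, Some (leaf F (Suc k))), l) \<in> sides_f None f" unfolding sides_in by blast
    moreover have "\<psi> a = (None, Some (leaf F (Suc k)))"
      using psi_simps(4)[of "Suc i"] i(1) k(2) by (simp add: a None v(1) vi)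
    ultimately show ?thesis by simp
  qed
qed

lemma sides_face:
  assumes "b \<in> face a" "a \<in> C" "(a, l) \<in> sides_f None f"
  shows "b \<in> C \<and> (b, l) \<in> sides_f None f"
  using assms(1)
proof (induct rule: orbit.induct)
  case base
  then show ?case using sides_step[OF assms(2,3)] psi_C assms(2) by blast
next
  case (step b)
  then show ?case using sides_step psi_C by blast
qed

text \<open>Each gap is represented by an arc into the cap bearing its label: the arc of its tip, or
  of leaf 1 for the outermost gap. Labels are constant along faces and the arc of a tip has only
  one, so different gaps lie on different faces.\<close>

lemma card_faces: "Suc (length (tips_f f)) \<le> card (faces (cap_graph n F) (cap_rot n F))"
proof -
  have "mset (leaves_f f) = mset (openers_f f @ tips_f f)" by (simp add: mset_leaves(1))
  then have d: "distinct (openers_f f @ tips_f f)"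
    using distinct_leaves[OF D(1)] by (metis mset_eq_imp_distinct_iff)
  have tipsB: "v \<in> B" if "v \<in> set (tips_f f)" for v
    using arg_cong[OF mset_leaves(1)[of f], of set_mset] that unfolding boundary_eq by auto
  define rep :: "'a option \<Rightarrow> 'a option \<times> 'a option" where "rep x = (case x of None \<Rightarrow> (Some (leaf F 1), None) | Some v \<Rightarrow> (Some v, None))" for x
  let ?X = "insert None (Some ` set (tips_f f))"
  have one: "1 \<in> {1..n}" using n_pos by simp
  have repC: "rep x \<in> C" if "x \<in> ?X" for x
    using that tipsB leaf_boundary[OF one] by (auto simp: rep_def)
  have repL: "(rep x, x) \<in> sides_f None f" if "x \<in> ?X" for x
  proof (cases x)
    case None
    let ?io = "tour_f None f"
    have lk: "linked None ?io None" by (rule linked_tour(1)[OF ok])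
    have io: "map fst ?io = map (leaf F) [1..<Suc n]" using leaves_tour(1) D(4) by metis
    have len: "0 < length ?io" using arg_cong[OF io, of length] n_pos by (simp del: upt_Suc)
    have "fst (?io ! 0) = leaf F 1"
      using arg_cong[OF io, of "\<lambda>xs. xs ! 0"] len n_pos by (simp del: upt_Suc)
    moreover have "fst (snd (?io ! 0)) = None" using linked_nth[OF lk len] by simp
    ultimately have "(leaf F 1, None, snd (snd (?io ! 0))) \<in> set ?io"
      using nth_mem[OF len] by (metis prod.collapse)
    then show ?thesis unfolding rep_def None option.case sides_out by blast
  next
    case (Some v)
    then have "v \<in> set (tips_f f)" using that by auto
    then show ?thesis unfolding rep_def Some option.case sides_out by (rule tips_tour(1))
  qed
  have key: "y = Some v" if "Some v \<in> ?X" "y \<in> ?X" "face (rep (Some v)) = face (rep y)" for v y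
  proof -
    have "rep (Some v) \<in> face (rep y)" using face_self[OF repC[OF that(1)]] that(3) by simp
    then have "((Some v, None), y) \<in> sides_f None f"
      using sides_face[OF _ repC[OF that(2)] repL[OF that(2)]] by (simp add: rep_def)
    then obtain j where "(v, y, j) \<in> set (tour_f None f)" unfolding sides_out by blast
    from tour_tips(1)[OF this] have "v \<in> set (openers_f f) \<or> y = Some v" by blast
    moreover have "v \<in> set (tips_f f)" using that(1) by auto
    then have "v \<notin> set (openers_f f)" using d by auto
    ultimately show ?thesis by blast
  qed
  have "inj_on (\<lambda>x. face (rep x)) ?X"
  proof (rule inj_onI)
    fix x y assume xy: "x \<in> ?X" "y \<in> ?X" "face (rep x) = face (rep y)"
    show "x = y"
    proof (cases x)
      case None
      show ?thesis
      proof (cases y)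
        case (Some v)
        then show ?thesis using key[of v x] xy by simp
      qed (simp add: None)
    next
      case (Some v)
      then show ?thesis using key[of v y] xy by simp
    qed
  qed
  moreover have "(\<lambda>x. face (rep x)) ` ?X \<subseteq> faces (cap_graph n F) (cap_rot n F)"
  proof -
    have "faces (cap_graph n F) (cap_rot n F) = face ` C" unfolding faces_def \<psi>_def by simp
    then show ?thesis using repC by blast
  qed
  moreover have "finite (faces (cap_graph n F) (cap_rot n F))" unfolding faces_eq by simp
  ultimately have "card ?X \<le> card (faces (cap_graph n F) (cap_rot n F))" by (metis card_inj_on_le)
  moreover have "card ?X = Suc (length (tips_f f))"
    using d distinct_card[of "tips_f f"] by (simp add: card_image)
  ultimately show ?thesis by simp
qed

text \<open>With \<open>t\<close> openers there are \<open>t\<close> more vertices than edges, and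
  \<open>n\<close> is \<open>t\<close> plus the number of tips; the faces found give at least 2, and
  \<open>euler_le\<close> is the other half.\<close>

lemma euler: "euler_char (cap_graph n F) (cap_rot n F) = 2"
  using euler_le card_faces card_verts_edges n_eq unfolding euler_formula by simp

theorem planar: "planar_forest n F"
  unfolding planar_forest_def
  using graph acyclic inj_leaf boundary_sub deg_boundary reach_boundary cyclic_rot euler by blast

end

section \<open>Homeomorphism types are shapes\<close>

text \<open>Leaves have one neighbour and contribute the truncated difference
  \<open>1 - 3 = 0\<close>, so the sum may run over all vertices.\<close>

lemma dim_nbrs:
  fixes f :: "'a pforest" and b :: "'a branch"
  shows "dim_f f = (\<Sum>x\<leftarrow>nbrs_f f. length (snd x) - 3)" "dim_b b = (\<Sum>x\<leftarrow>nbrs_b p b. length (snd x) - 3)"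
proof (induct f and b arbitrary: and p rule: pforest_branch_induct)
  case (Tree v b g)
  then show ?case using Tree(1)[of v] by simp
next
  case (Node v bs)
  have "(\<Sum>b\<leftarrow>bs. dim_b b) = (\<Sum>x\<leftarrow>concat (map (nbrs_b v) bs). length (snd x) - 3)"
    using Node by (induct bs) auto
  then show ?case by simp
qed auto

lemma (in drawing) og:
  assumes "n = 2 * k"
  shows "og_forest k F"
  using planar deg_node unfolding og_forest_def assms by blast

lemma (in drawing) odim:
  assumes "n = 2 * k"
  shows "odim k F = dim_f f"
proof -
  let ?I = "internal n F"
  have fin: "finite ?I" using finite_V by (simp add: internal_def)
  have sub: "S \<subseteq> V" if "S \<in> G.sccs_verts" for S
    using G.sccs_verts_subsets[OF that] by simp
  have "odim k F = (\<Sum>S \<in> G.sccs_verts. \<Sum>v \<in> S \<inter> ?I. deg F v - 3)"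
    by (simp add: odim_def odim_tree_def assms)
  also have "\<dots> = (\<Sum>v \<in> (\<Union>S \<in> G.sccs_verts. S \<inter> ?I). deg F v - 3)"
  proof (rule sum.UNION_disjoint[symmetric])
    show "finite G.sccs_verts" by (rule G.finite_sccs_verts)
    show "\<forall>S \<in> G.sccs_verts. finite (S \<inter> ?I)" using fin by simp
    show "\<forall>S \<in> G.sccs_verts. \<forall>T \<in> G.sccs_verts. S \<noteq> T \<longrightarrow> S \<inter> ?I \<inter> (T \<inter> ?I) = {}"
      using G.sccs_verts_disjoint by blast
  qed
  also have "(\<Union>S \<in> G.sccs_verts. S \<inter> ?I) = ?I"
  proof -
    have "v \<in> \<Union> G.sccs_verts" if "v \<in> V" for v
      using G.scc_of_in_sccs_verts[of v] G.in_scc_of_self[of v] that by auto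
    then show ?thesis unfolding internal_def by blast
  qed
  also have "(\<Sum>v \<in> ?I. deg F v - 3) = (\<Sum>v \<in> V. deg F v - 3)"
    by (rule sum.mono_neutral_left[OF finite_V]) (auto simp: internal_def deg_leaf)
  also have "\<dots> = (\<Sum>v\<leftarrow>verts_f f. deg F v - 3)"
    unfolding D(2) using D(1) by (simp add: sum.distinct_set_conv_list)
  also have "\<dots> = (\<Sum>x\<leftarrow>nbrs_f f. deg F (fst x) - 3)"
    unfolding map_fst_nbrs(1)[symmetric] by (simp add: comp_def)
  also have "\<dots> = (\<Sum>x\<leftarrow>nbrs_f f. length (snd x) - 3)"
    by (intro arg_cong[of _ _ sum_list] map_cong refl) (auto simp: deg_eq)
  also have "\<dots> = dim_f f" by (rule dim_nbrs(1)[symmetric])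
  finally show ?thesis .
qed

lemma (in disk_forest) good_ok:
  assumes "\<And>v. v \<in> internal n F \<Longrightarrow> even (deg F v)"
  shows "good_f f \<Longrightarrow> ok_f f" "good_b p b \<Longrightarrow> ok_b b"
proof (induct f and b arbitrary: and p rule: pforest_branch_induct)
  case (Node v bs)
  have "(v, p) \<in> A" using Node(2) by auto
  then have v: "v \<in> internal n F" using Node(2) arc_verts by (auto simp: internal_def)
  have "set (p # map apex bs) = N v" "distinct (p # map apex bs)" using Node(2) unfolding good_b.simps by blast+
  then have "card (N v) = Suc (length bs)" using distinct_card by fastforce
  then have "even (Suc (length bs))" "4 \<le> Suc (length bs)"
    using assms[OF v] deg_internal[OF v] unfolding deg_card by simp_all
  moreover have "list_all ok_b bs" using Node(1,2) by (auto simp: list_all_iff)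
  ultimately show ?case by simp
qed auto

lemma og_forest_drawing:
  assumes "og_forest k F" "1 \<le> k"
  shows "\<exists>f. draws (2 * k) F f \<and> ok_f f"
proof -
  note p = assms(1)[unfolded og_forest_def planar_forest_def]
  have "planar_disk_forest (2 * k) F"
  proof (intro planar_disk_forest.intro disk_forest.intro planar_disk_forest_axioms.intro)
    show "pair_graph (gr F)" "inj_on (leaf F) {1..2 * k}" "boundary (2 * k) F \<subseteq> pverts (gr F)"
      "euler_char (cap_graph (2 * k) F) (cap_rot (2 * k) F) = 2" "1 \<le> 2 * k"
      using p assms(2) by (elim conjE; simp)+
    show "length q \<le> 2" if "pre_digraph.cycle (with_proj (gr F)) q" for q
      using p that by (elim conjE) (drule spec[of _ q], simp)
    show "deg F v = 1" if "v \<in> boundary (2 * k) F" for v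
      using p that by (elim conjE) (rule bspec)
    show "\<exists>w \<in> boundary (2 * k) F. v \<rightarrow>\<^sup>*\<^bsub>with_proj (gr F)\<^esub> w" if "v \<in> pverts (gr F)" for v
      using p that by (elim conjE) (rule bspec)
    show "cyclic_on (rot F v) {w. (v, w) \<in> parcs (gr F)}" if "v \<in> pverts (gr F)" for v
      using p that by (elim conjE) (rule bspec)
    show "4 \<le> deg F v" if "v \<in> internal (2 * k) F" for v
      using bspec[OF conjunct2[OF p] that] by simp
  qed
  then interpret planar_disk_forest "2 * k" F .
  obtain f where f: "draws (2 * k) F f" "good_f f" using exists_drawing by blast
  have "even (deg F v)" if "v \<in> internal (2 * k) F" for v
    using bspec[OF conjunct2[OF p] that] by simp
  then have "ok_f f" using f(2) by (rule good_ok(1))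
  then show ?thesis using f(1) by blast
qed

lemma exists_graph:
  assumes "distinct (verts_f f)" "length (leaves_f f) = n"
  shows "\<exists>F. draws n F f"
proof -
  \<comment> \<open>The rotation is read off by pairing each neighbour list with its rotated copy;
    both lookups are unambiguous because vertices and neighbours are distinct.\<close>
  define r where "r v w = (let ns = the (map_of (nbrs_f f) v) in the (map_of (zip ns (rotate1 ns)) w))" for v w
  let ?F = "\<lparr>gr = \<lparr>pverts = set (verts_f f), parcs = arcs_of (nbrs_f f)\<rparr>, rot = r, leaf = \<lambda>i. leaves_f f ! (i - 1)\<rparr>"
  have "map (r v) ns = rotate1 ns" if ns: "(v, ns) \<in> set (nbrs_f f)" for v ns
  proof -
    have "map_of (nbrs_f f) v = Some ns" using assms(1) ns by (simp add: map_fst_nbrs)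
    then have "r v w = the (map_of (zip ns (rotate1 ns)) w)" for w by (simp add: r_def)
    moreover have "distinct ns" using distinct_nbrs(1)[OF assms(1) ns] .
    ultimately show ?thesis by (intro nth_equalityI) (simp_all add: map_of_zip_nth)
  qed
  moreover have "map (\<lambda>i. leaves_f f ! (i - 1)) [1..<Suc n] = leaves_f f"
    using assms(2) by (intro nth_equalityI) (simp_all del: upt_Suc)
  ultimately have "draws n ?F f" unfolding draws_def using assms(1) by auto
  then show ?thesis ..
qed

section \<open>Shapes as a complete invariant\<close>

definition shapes :: "nat \<Rightarrow> nat \<Rightarrow> unit pforest set" where
  "shapes k r = {s. ok_f s \<and> length (leaves_f s) = 2 * k \<and> dim_f s = r}"

definition shape_of :: "nat \<Rightarrow> nat disk_graph \<Rightarrow> unit pforest" where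
  "shape_of k F = map_pforest (\<lambda>_. ()) (THE f. draws (2 * k) F f \<and> ok_f f)"

lemma shape_of_eq: "draws (2 * k) F f \<Longrightarrow> ok_f f \<Longrightarrow> shape_of k F = map_pforest (\<lambda>_. ()) f"
  unfolding shape_of_def using draws_unique by (metis (mono_tags, lifting) the_equality)

lemma shape_of_image:
  assumes "1 \<le> k"
  shows "shape_of k ` og_forests k r = shapes k r"
proof
  show "shape_of k ` og_forests k r \<subseteq> shapes k r"
  proof
    fix s assume "s \<in> shape_of k ` og_forests k r"
    then obtain F where F: "s = shape_of k F" "og_forest k F" "odim k F = r" by (auto simp: og_forests_def)
    obtain f where f: "draws (2 * k) F f" "ok_f f" using og_forest_drawing[OF F(2) assms] by blast
    interpret drawing "2 * k" F f by unfold_locales (use f assms in auto)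
    have "length (leaves_f f) = 2 * k" using arg_cong[OF D(4), of length] by (simp del: upt_Suc)
    then show "s \<in> shapes k r" using odim[OF refl] f F(3) by (simp add: shapes_def F(1) shape_of_eq)
  qed
  show "shapes k r \<subseteq> shape_of k ` og_forests k r"
  proof
    fix s assume s: "s \<in> shapes k r"
    obtain f :: "nat pforest" where f: "map_pforest (\<lambda>_. ()) f = s" "verts_f f = [0..<0 + length (verts_f s)]"
      using exists_labelling(1)[of s 0] by blast
    have ok: "ok_f f" and len: "length (leaves_f f) = 2 * k" and dim: "dim_f f = r"
      using s ok_map(1)[of "\<lambda>_. ()" f] leaves_map(1)[of "\<lambda>_. ()" f] dim_map(1)[of "\<lambda>_. ()" f]
      unfolding f(1) shapes_def by auto
    obtain F where F: "draws (2 * k) F f" using exists_graph[OF _ len] f(2) by auto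
    interpret drawing "2 * k" F f by unfold_locales (use F ok assms in auto)
    have "F \<in> og_forests k r" using og[OF refl] odim[OF refl] dim by (simp add: og_forests_def)
    moreover have "s = shape_of k F" using shape_of_eq[OF F ok] f(1) by simp
    ultimately show "s \<in> shape_of k ` og_forests k r" by blast
  qed
qed

text \<open>An isomorphism carries the parse of one forest to a parse of the other, which is unique.
  Conversely, equal shapes differ by a relabelling of vertices, and that relabelling is the
  isomorphism.\<close>

lemma homeomorphic_iff_shape:
  assumes "1 \<le> k" "og_forest k F" "og_forest k F'"
  shows "homeomorphic_forests (2 * k) F F' \<longleftrightarrow> shape_of k F = shape_of k F'"
proof -
  obtain f where f: "draws (2 * k) F f" "ok_f f" using og_forest_drawing[OF assms(2,1)] by blast
  obtain f' where f': "draws (2 * k) F' f'" "ok_f f'" using og_forest_drawing[OF assms(3,1)] by blast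
  show ?thesis unfolding shape_of_eq[OF f] shape_of_eq[OF f']
  proof
    assume "homeomorphic_forests (2 * k) F F'"
    then obtain \<phi> where "forest_iso (2 * k) \<phi> F F'" unfolding homeomorphic_forests_def by blast
    then have "draws (2 * k) F' (map_pforest \<phi> f)" by (rule draws_forest_iso[OF f(1)])
    then have "f' = map_pforest \<phi> f" by (rule draws_unique[OF f'(1)]) (use f f' in auto)
    then show "map_pforest (\<lambda>_. ()) f = map_pforest (\<lambda>_. ()) f'" by (simp add: pforest.map_comp comp_def)
  next
    assume "map_pforest (\<lambda>_. ()) f = map_pforest (\<lambda>_. ()) f'"
    then obtain \<phi> where "f' = map_pforest \<phi> f" using same_shape_relabel drawsD(1)[OF f(1)] by blast
    then have "forest_iso (2 * k) \<phi> F F'" using draws_same_shape[OF f(1)] f'(1) by blast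
    then show "homeomorphic_forests (2 * k) F F'" unfolding homeomorphic_forests_def by blast
  qed
qed

lemma quotient_kernel:
  fixes h :: "'a \<Rightarrow> 'b"
  assumes "\<And>x y. x \<in> X \<Longrightarrow> y \<in> X \<Longrightarrow> R x y \<longleftrightarrow> h x = h y"
  shows "bij_betw (\<lambda>s. {x \<in> X. h x = s}) (h ` X) (X // {(x, y) \<in> X \<times> X. R x y})"
proof (rule bij_betw_imageI)
  show "inj_on (\<lambda>s. {x \<in> X. h x = s}) (h ` X)" by (rule inj_onI) blast
  have "{(x, y) \<in> X \<times> X. R x y} `` {x} = {y \<in> X. h y = h x}" if "x \<in> X" for x
    using assms[OF that] that by auto
  then show "(\<lambda>s. {x \<in> X. h x = s}) ` h ` X = X // {(x, y) \<in> X \<times> X. R x y}"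
    unfolding quotient_def by (auto simp: image_image)
qed

theorem og_forest_types_shapes:
  assumes "1 \<le> k"
  shows "bij_betw (\<lambda>s. {F \<in> og_forests k r. shape_of k F = s}) (shapes k r) (og_forest_types k r)"
proof -
  have "homeomorphic_forests (2 * k) F F' \<longleftrightarrow> shape_of k F = shape_of k F'"
    if "F \<in> og_forests k r" "F' \<in> og_forests k r" for F F'
    using homeomorphic_iff_shape[OF assms] that by (simp add: og_forests_def)
  from quotient_kernel[of "og_forests k r" "homeomorphic_forests (2 * k)" "shape_of k", OF this] show ?thesis
    unfolding og_forest_types_def shape_of_image[OF assms] .
qed

section \<open>Lagrange inversion and the tree series\<close>

text \<open>Since \<open>b\<close> has no constant term, \<open>b ^ i\<close> starts in degree
  \<open>i\<close>, so only finitely many terms of the composition reach the coefficient at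
  \<open>n\<close>.\<close>

lemma fps_compose_mult_nth:
  fixes a b c :: "'a :: comm_ring_1 fps"
  assumes "fps_nth b 0 = 0"
  shows "fps_nth ((a oo b) * c) n = (\<Sum>i = 0..n. fps_nth a i * fps_nth (b ^ i * c) n)"
proof -
  have z: "fps_nth (b ^ i) j = 0" if "j < i" for i j
    using startsby_zero_power_prefix[OF assms] that by blast
  have "fps_nth ((a oo b) * c) n = (\<Sum>j = 0..n. \<Sum>i = 0..n. fps_nth a i * fps_nth (b ^ i) j * fps_nth c (n - j))"
    unfolding fps_mult_nth fps_compose_nth sum_distrib_right
    by (intro sum.cong refl sum.mono_neutral_left) (auto simp: z)
  also have "\<dots> = (\<Sum>i = 0..n. \<Sum>j = 0..n. fps_nth a i * fps_nth (b ^ i) j * fps_nth c (n - j))"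
    by (rule sum.swap)
  also have "\<dots> = (\<Sum>i = 0..n. fps_nth a i * fps_nth (b ^ i * c) n)"
    by (intro sum.cong refl) (simp add: fps_mult_nth sum_distrib_left mult.assoc)
  finally show ?thesis .
qed

text \<open>With \<open>h = fps_X * inverse \<phi>\<close> this is the residue of
  \<open>h' / h ^ (m + 1)\<close>, written without negative powers: for positive \<open>m\<close>
  the quotient is a derivative and has residue 0, for \<open>m = 0\<close> it is a logarithmic
  derivative with residue 1.\<close>

lemma lagrange_residue:
  fixes \<phi> :: "'a :: field_char_0 fps"
  assumes "fps_nth \<phi> 0 \<noteq> 0"
  shows "fps_nth (\<phi> ^ Suc m * fps_deriv (fps_X * inverse \<phi>)) m = (if m = 0 then 1 else 0)"
proof -
  have inv: "\<phi> * inverse \<phi> = 1" using inverse_mult_eq_1'[OF assms] by simp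
  have d: "fps_deriv (fps_X * inverse \<phi>) = inverse \<phi> - fps_X * fps_deriv \<phi> * inverse \<phi> * inverse \<phi>"
    by (simp add: fps_inverse_deriv[OF assms] power2_eq_square mult.assoc)
  have ring: "(a * b) * (c - x * y * c * c) = b * (a * c) - x * y * b * c * (a * c)" for a b c x y :: "'a fps"
    by (simp add: algebra_simps)
  have "\<phi> ^ Suc m * fps_deriv (fps_X * inverse \<phi>) =
      \<phi> ^ m * (\<phi> * inverse \<phi>) - fps_X * fps_deriv \<phi> * \<phi> ^ m * inverse \<phi> * (\<phi> * inverse \<phi>)"
    unfolding d power_Suc by (rule ring)
  then have e: "\<phi> ^ Suc m * fps_deriv (fps_X * inverse \<phi>) = \<phi> ^ m - fps_X * fps_deriv \<phi> * \<phi> ^ m * inverse \<phi>"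
    unfolding inv by simp
  show ?thesis
  proof (cases m)
    case 0
    then show ?thesis unfolding e by (simp add: mult.assoc)
  next
    case (Suc k)
    have "\<phi> ^ m * inverse \<phi> = \<phi> ^ k * (\<phi> * inverse \<phi>)" by (simp add: Suc mult_ac)
    then have 1: "fps_deriv \<phi> * \<phi> ^ m * inverse \<phi> = fps_deriv \<phi> * \<phi> ^ k" unfolding inv by (simp add: mult.assoc)
    have "fps_deriv (\<phi> ^ m) = fps_const (of_nat m) * (fps_deriv \<phi> * \<phi> ^ k)"
      using fps_deriv_power[of \<phi> m] by (simp only: Suc diff_Suc_1 mult.assoc)
    then have "of_nat m * fps_nth (fps_deriv \<phi> * \<phi> ^ k) k = of_nat m * fps_nth (\<phi> ^ m) m"
      unfolding Suc using arg_cong[of _ _ "\<lambda>f. fps_nth f k"] by (metis Suc_eq_plus1 fps_deriv_nth fps_mult_left_const_nth)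
    moreover have "(of_nat m :: 'a) \<noteq> 0" using Suc by (simp del: of_nat_Suc)
    ultimately have 3: "fps_nth (fps_deriv \<phi> * \<phi> ^ k) k = fps_nth (\<phi> ^ m) m" by (metis mult_left_cancel)
    have 2: "fps_X * fps_deriv \<phi> * \<phi> ^ m * inverse \<phi> = fps_X * (fps_deriv \<phi> * \<phi> ^ k)"
      using 1 by (simp only: mult.assoc)
    show ?thesis unfolding e 2 using 3 Suc by (simp del: power_Suc)
  qed
qed

text \<open>Differentiating \<open>?g oo ?h = fps_X\<close> and weighting with
  \<open>\<phi> ^ n\<close> leaves, in degree \<open>n - 1\<close>, a single coefficient of the
  derivative of \<open>?g\<close>; all others vanish by \<open>lagrange_residue\<close>.\<close>

theorem lagrange_inversion:
  fixes \<phi> :: "'a :: field_char_0 fps"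
  assumes "fps_nth \<phi> 0 \<noteq> 0" "1 \<le> n"
  shows "fps_nth (fps_inv (fps_X * inverse \<phi>)) n = 1 / of_nat n * fps_nth (\<phi> ^ n) (n - 1)"
proof -
  let ?h = "fps_X * inverse \<phi>" let ?g = "fps_inv ?h"
  have h: "fps_nth ?h 0 = 0" "fps_nth ?h 1 \<noteq> 0" using assms(1) by simp_all
  have inv: "\<phi> * inverse \<phi> = 1" using inverse_mult_eq_1'[OF assms(1)] by simp
  obtain m where m: "n = Suc m" using assms(2) by (cases n) auto
  have "fps_deriv (?g oo ?h) = 1" unfolding fps_inv[OF h] by simp
  then have "(fps_deriv ?g oo ?h) * fps_deriv ?h = 1" using fps_compose_deriv[OF h(1)] by metis
  then have "fps_nth (\<phi> ^ n) m = fps_nth ((fps_deriv ?g oo ?h) * (\<phi> ^ n * fps_deriv ?h)) m"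
    by (metis (no_types, lifting) mult.commute mult.left_commute mult_1)
  also have "\<dots> = (\<Sum>i = 0..m. fps_nth (fps_deriv ?g) i * fps_nth (?h ^ i * (\<phi> ^ n * fps_deriv ?h)) m)"
    by (rule fps_compose_mult_nth[OF h(1)])
  also have "\<dots> = (\<Sum>i = 0..m. fps_nth (fps_deriv ?g) i * (if i = m then 1 else 0))"
  proof (intro sum.cong refl arg_cong2[of _ _ _ _ "(*)"])
    fix i assume i: "i \<in> {0..m}"
    have "n = i + Suc (m - i)" using i m by simp
    then have "\<phi> ^ n = \<phi> ^ i * \<phi> ^ Suc (m - i)" by (metis power_add)
    then have "?h ^ i * (\<phi> ^ n * fps_deriv ?h) = fps_X ^ i * (\<phi> * inverse \<phi>) ^ i * (\<phi> ^ Suc (m - i) * fps_deriv ?h)"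
      by (simp only: power_mult_distrib mult_ac)
    then have "fps_nth (?h ^ i * (\<phi> ^ n * fps_deriv ?h)) m = fps_nth (\<phi> ^ Suc (m - i) * fps_deriv ?h) (m - i)"
      unfolding inv using i by (simp only: power_one mult_1_right fps_X_power_mult_nth) simp
    then show "fps_nth (?h ^ i * (\<phi> ^ n * fps_deriv ?h)) m = (if i = m then 1 else 0)"
      using lagrange_residue[OF assms(1), of "m - i"] i by simp
  qed
  also have "\<dots> = of_nat n * fps_nth ?g n" by (simp add: m mult_delta_right)
  finally show ?thesis using m by (simp add: field_simps del: of_nat_Suc power_Suc)
qed

text \<open>Negative binomial series: multiplying by the linear factor lowers \<open>m\<close> by
  one, which is Pascal's rule on coefficients.\<close>

lemma inverse_linear_power:
  fixes c :: "'a :: field"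
  shows "inverse ((1 - fps_const c * fps_X) ^ Suc m) = Abs_fps (\<lambda>i. of_nat ((m + i) choose i) * c ^ i)"
proof -
  let ?A = "\<lambda>m. Abs_fps (\<lambda>i. of_nat ((m + i) choose i) * c ^ i)" let ?L = "1 - fps_const c * fps_X"
  have 0: "?L * ?A 0 = 1"
  proof (rule fps_ext)
    fix i show "fps_nth (?L * ?A 0) i = fps_nth 1 i"
      by (cases i) (simp_all add: left_diff_distrib mult.assoc)
  qed
  have S: "?L * ?A (Suc m) = ?A m" for m
  proof (rule fps_ext)
    fix i show "fps_nth (?L * ?A (Suc m)) i = fps_nth (?A m) i"
      by (cases i) (simp_all add: left_diff_distrib mult.assoc algebra_simps)
  qed
  have "?L ^ Suc m * ?A m = 1" for m
  proof (induct m)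
    case (Suc m)
    have "?L ^ Suc (Suc m) * ?A (Suc m) = ?L ^ Suc m * (?L * ?A (Suc m))" by (simp only: power_Suc mult_ac)
    then show ?case by (simp only: S Suc)
  qed (simp only: power_Suc power_0 mult_1_right 0)
  then show ?thesis by (intro fps_inverse_unique) simp
qed

text \<open>Absorption connects the coefficients in the definition of \<open>G_tree\<close> (left)
  with those that Lagrange inversion yields (right).\<close>

lemma choose_identity:
  assumes "1 \<le> i" "1 \<le> j" "j \<le> i"
  shows "(2 * i + 1) * (((2 * i + j) choose (2 * i + 1)) * (i choose j)) = i * (((2 * i + j) choose j) * ((i - 1) choose (j - 1)))"
proof -
  have a: "j * (i choose j) = i * ((i - 1) choose (j - 1))"
    using assms binomial_absorption[of "j - 1" "i"] by simp
  have "(2 * i + 1) * ((2 * i + j) choose (2 * i + 1)) = j * ((2 * i + j) choose (2 * i))"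
    using binomial_absorb_comp[of "2 * i + j" "2 * i"] binomial_absorption[of "2 * i" "2 * i + j"] by simp
  also have "(2 * i + j) choose (2 * i) = (2 * i + j) choose j"
    using binomial_symmetric[of "2 * i" "2 * i + j"] by simp
  finally have "(2 * i + 1) * (((2 * i + j) choose (2 * i + 1)) * (i choose j)) = ((2 * i + j) choose j) * (j * (i choose j))"
    by (simp add: mult_ac)
  then show ?thesis unfolding a by (simp add: mult_ac)
qed

section \<open>The series of planted trees\<close>

abbreviation qvar :: "rat fls" where "qvar \<equiv> fls_X"

text \<open>The tree series is \<open>x T\<close>, where \<open>T\<close> is the compositional inverse of
  \<open>y (1 - (q^2 + q) y^2) / (1 - q^2 y^2)\<close>: planted trees satisfy
  \<open>T = x + q T^3 + q^3 T^5 + q^5 T^7 + ...\<close>.\<close>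

definition tree_kernel :: xq_series where
  "tree_kernel = (1 - fps_const (qvar\<^sup>2) * fps_X\<^sup>2) * inverse (1 - fps_const (qvar\<^sup>2 + qvar) * fps_X\<^sup>2)"

definition planted :: xq_series where
  "planted = fps_inv (fps_X * inverse tree_kernel)"

lemma tree_kernel_0 [simp]: "fps_nth tree_kernel 0 = 1"
  by (simp add: tree_kernel_def power2_eq_square)

lemma planted_inverse:
  "(fps_X * inverse tree_kernel) oo planted = fps_X" "planted oo (fps_X * inverse tree_kernel) = fps_X"
  unfolding planted_def by (rule fps_inv_right fps_inv; simp)+

lemma fps_compose_sq_nth:
  "fps_nth (a oo fps_X\<^sup>2) m = (if even m then fps_nth a (m div 2) else (0 :: 'a :: comm_ring_1))"
proof -
  have "fps_nth (a oo fps_X\<^sup>2) m = (\<Sum>i = 0..m. fps_nth a i * (if m = 2 * i then 1 else 0))"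
    unfolding fps_compose_nth by (simp add: power_mult[symmetric])
  also have "\<dots> = (if even m then fps_nth a (m div 2) else 0)"
  proof (cases "even m")
    case True
    then obtain k where "m = 2 * k" by blast
    then show ?thesis by (simp add: mult_delta_right)
  next
    case False
    then have "m \<noteq> 2 * i" for i by auto
    then show ?thesis using False by simp
  qed
  finally show ?thesis .
qed

lemma tree_kernel_power_nth:
  assumes "1 \<le> i"
  shows "fps_nth (tree_kernel ^ (2 * i + 1)) (2 * i) =
    (\<Sum>j = 1..i. of_nat ((2 * i + j) choose j) * of_nat ((i - 1) choose (j - 1)) * qvar ^ (2 * i - j))"
proof -
  let ?L = "1 - fps_const (qvar\<^sup>2) * fps_X :: xq_series"
  \<comment> \<open>With \<open>y\<close> for the square of the variable,
    \<open>(1 - q^2 y) / (1 - (q^2 + q) y) = 1 / (1 - w)\<close> for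
    \<open>w = q y / (1 - q^2 y)\<close>. Powers of the kernel thus expand in powers of
    \<open>w\<close>, and \<open>j\<close> in the final sum is the exponent of
    \<open>w\<close>.\<close>
  define w where "w = fps_const qvar * fps_X * inverse ?L"
  have w0: "fps_nth w 0 = 0" by (simp add: w_def mult.assoc)
  have L0: "fps_nth ?L 0 \<noteq> 0" by simp
  have Li: "?L * inverse ?L = 1" using inverse_mult_eq_1'[OF L0] .
  define \<rho> where "\<rho> = ?L * inverse (1 - fps_const (qvar\<^sup>2 + qvar) * fps_X)"
  have "1 - w = ?L * inverse ?L - fps_const qvar * fps_X * inverse ?L" unfolding Li w_def ..
  also have "\<dots> = (?L - fps_const qvar * fps_X) * inverse ?L" by (rule left_diff_distrib[symmetric])
  also have "?L - fps_const qvar * fps_X = 1 - fps_const (qvar\<^sup>2 + qvar) * fps_X"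
    by (simp add: algebra_simps flip: fps_const_add)
  finally have "inverse (1 - w) = inverse (1 - fps_const (qvar\<^sup>2 + qvar) * fps_X) * inverse (inverse ?L)"
    by (simp add: fps_inverse_mult)
  then have rho: "inverse (1 - w) = \<rho>" by (simp add: \<rho>_def mult.commute)
  have "tree_kernel = \<rho> oo fps_X\<^sup>2"
    unfolding tree_kernel_def \<rho>_def
    by (simp add: fps_compose_mult_distrib fps_inverse_compose fps_compose_sub_distrib power2_eq_square)
  then have "tree_kernel ^ (2 * i + 1) = \<rho> ^ (2 * i + 1) oo fps_X\<^sup>2"
    using fps_compose_power[of "fps_X\<^sup>2" \<rho> "2 * i + 1"] by (simp only: fps_X_power_nth) simp
  then have "fps_nth (tree_kernel ^ (2 * i + 1)) (2 * i) = fps_nth (\<rho> ^ Suc (2 * i)) i"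
    by (simp only: fps_compose_sq_nth) simp
  also have "\<rho> ^ Suc (2 * i) = inverse ((1 - fps_const 1 * fps_X) ^ Suc (2 * i)) oo w"
  proof -
    have "inverse ((1 - fps_const 1 * fps_X) ^ Suc (2 * i)) oo w = inverse ((1 - fps_const 1 * fps_X) ^ Suc (2 * i) oo w)"
      by (rule fps_inverse_compose[OF w0]) (simp add: fps_power_zeroth)
    also have "(1 - fps_const 1 * fps_X) ^ Suc (2 * i) oo w = (1 - w) ^ Suc (2 * i)"
      unfolding fps_compose_power[OF w0, symmetric] using w0
      by (simp add: fps_compose_sub_distrib)
    finally show ?thesis unfolding rho[symmetric] by (simp only: fps_inverse_power)
  qed
  also have "fps_nth \<dots> i = (\<Sum>j = 0..i. of_nat ((2 * i + j) choose j) * fps_nth (w ^ j) i)"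
    unfolding inverse_linear_power fps_compose_nth by simp
  also have "\<dots> = (\<Sum>j = 1..i. of_nat ((2 * i + j) choose j) * fps_nth (w ^ j) i)"
    using assms by (simp add: sum.atLeast_Suc_atMost)
  also have "\<dots> = (\<Sum>j = 1..i. of_nat ((2 * i + j) choose j) * of_nat ((i - 1) choose (j - 1)) * qvar ^ (2 * i - j))"
  proof (intro sum.cong refl)
    fix j assume j: "j \<in> {1..i}"
    then obtain j' where j': "j = Suc j'" by (cases j) auto
    have "w ^ j = fps_const (qvar ^ j) * (fps_X ^ j * inverse (?L ^ Suc j'))"
      by (simp only: w_def power_mult_distrib j' fps_inverse_power fps_const_power mult.assoc)
    then have "fps_nth (w ^ j) i = qvar ^ j * (of_nat ((j' + (i - j)) choose (i - j)) * (qvar\<^sup>2) ^ (i - j))"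
      unfolding inverse_linear_power using j by (simp add: fps_X_power_mult_nth)
    also have "(j' + (i - j)) choose (i - j) = (i - 1) choose (j - 1)"
      using binomial_symmetric[of "j - 1" "i - 1"] j j' by simp
    also have "qvar ^ j * (of_nat ((i - 1) choose (j - 1)) * (qvar\<^sup>2) ^ (i - j)) = of_nat ((i - 1) choose (j - 1)) * qvar ^ (2 * i - j)"
    proof -
      have "j \<le> i" using j by simp
      then have "j + 2 * (i - j) = 2 * i - j" by linarith
      then have "qvar ^ j * (qvar\<^sup>2) ^ (i - j) = qvar ^ (2 * i - j)" by (metis power_add power_mult)
      then show ?thesis by (simp add: mult.left_commute)
    qed
    finally show "of_nat ((2 * i + j) choose j) * fps_nth (w ^ j) i =
      of_nat ((2 * i + j) choose j) * of_nat ((i - 1) choose (j - 1)) * qvar ^ (2 * i - j)" by (simp add: mult.assoc)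
  qed
  finally show ?thesis .
qed

lemma planted_nth:
  fixes i :: nat
  shows
  "fps_nth planted (2 * i + 1) = (if i = 0 then 1 else
     (\<Sum>j = 1..i. (1 / of_nat i) * of_nat ((2 * i + j) choose (2 * i + 1)) * of_nat (i choose j) * qvar ^ (2 * i - j)))"
proof (cases "i = 0")
  case True
  then show ?thesis using lagrange_inversion[of tree_kernel 1] by (simp add: planted_def)
next
  case False
  have cross: "1 / a * x = 1 / b * y" if "a \<noteq> 0" "b \<noteq> 0" "a * y = b * x" for a b x y :: "rat fls"
    using that by (simp add: field_simps)
  have "fps_nth planted (2 * i + 1) = 1 / of_nat (2 * i + 1) * fps_nth (tree_kernel ^ (2 * i + 1)) (2 * i)"
    using lagrange_inversion[of tree_kernel "2 * i + 1"] unfolding planted_def by simp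
  also have "\<dots> = (\<Sum>j = 1..i. 1 / of_nat (2 * i + 1) *
      (of_nat ((2 * i + j) choose j) * of_nat ((i - 1) choose (j - 1)) * qvar ^ (2 * i - j)))"
    using False by (subst tree_kernel_power_nth) (simp_all add: sum_distrib_left)
  also have "\<dots> = (\<Sum>j = 1..i. (1 / of_nat i) * of_nat ((2 * i + j) choose (2 * i + 1)) * of_nat (i choose j) * qvar ^ (2 * i - j))"
  proof (intro sum.cong refl)
    fix j assume j: "j \<in> {1..i}"
    have "(of_nat ((2 * i + 1) * (((2 * i + j) choose (2 * i + 1)) * (i choose j))) :: rat fls) =
      of_nat (i * (((2 * i + j) choose j) * ((i - 1) choose (j - 1))))"
      using choose_identity[of i j] j by simp
    then have "of_nat (2 * i + 1) * (of_nat ((2 * i + j) choose (2 * i + 1)) * of_nat (i choose j)) =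
      (of_nat i * (of_nat ((2 * i + j) choose j) * of_nat ((i - 1) choose (j - 1))) :: rat fls)"
      by (simp only: of_nat_mult)
    then have "1 / of_nat (2 * i + 1) * (of_nat ((2 * i + j) choose j) * of_nat ((i - 1) choose (j - 1))) =
      (1 / of_nat i) * (of_nat ((2 * i + j) choose (2 * i + 1)) * of_nat (i choose j) :: rat fls)"
      by (intro cross) (use False in \<open>simp_all del: of_nat_add of_nat_mult of_nat_Suc\<close>)
    then show "1 / of_nat (2 * i + 1) * (of_nat ((2 * i + j) choose j) * of_nat ((i - 1) choose (j - 1)) * qvar ^ (2 * i - j)) =
      (1 / of_nat i) * of_nat ((2 * i + j) choose (2 * i + 1)) * of_nat (i choose j) * qvar ^ (2 * i - j)"
      by (simp only: mult.assoc[symmetric])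
  qed
  finally show ?thesis using False by simp
qed

text \<open>The kernel is a series in the square of the variable, so the odd coefficient that
  Lagrange inversion asks for is 0.\<close>

lemma planted_nth_even: "fps_nth planted (2 * i) = 0"
proof (cases i)
  case 0
  then show ?thesis by (simp add: planted_def fps_inv_def)
next
  case (Suc i')
  have "tree_kernel = ((1 - fps_const (qvar\<^sup>2) * fps_X) * inverse (1 - fps_const (qvar\<^sup>2 + qvar) * fps_X)) oo fps_X\<^sup>2"
    unfolding tree_kernel_def
    by (simp add: fps_compose_mult_distrib fps_inverse_compose fps_compose_sub_distrib power2_eq_square)
  then have "\<exists>\<rho>. tree_kernel ^ (2 * i) = \<rho> oo fps_X\<^sup>2"
    using fps_compose_power[of "fps_X\<^sup>2 :: xq_series"] by (simp add: power2_eq_square) metis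
  then have "fps_nth (tree_kernel ^ (2 * i)) (2 * i - 1) = 0"
    using Suc by (auto simp: fps_compose_sq_nth simp del: power_Suc)
  then show ?thesis using lagrange_inversion[of tree_kernel "2 * i"] Suc unfolding planted_def by simp
qed

lemma G_tree_planted: "G_tree = fps_X * planted"
proof (rule fps_ext)
  fix m :: nat
  define c where "c i = (\<Sum>j = 1..i. (1 / of_nat i) * of_nat ((2 * i + j) choose (2 * i + 1)) * of_nat (i choose j) * qvar ^ (2 * i - j))" for i :: nat
  have G: "G_tree = fps_X\<^sup>2 * (1 + (Abs_fps c oo fps_X\<^sup>2))"
    unfolding G_tree_def c_def by simp
  have c0: "c 0 = 0" by (simp add: c_def)
  have p: "fps_nth planted (2 * i + 1) = (if i = 0 then 1 else c i)" for i
    unfolding planted_nth c_def ..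
  have "m = 0 \<or> (\<exists>i. m = 2 * i + 1) \<or> (\<exists>i. m = 2 * i + 2)" by presburger
  then consider "m = 0" | i where "m = 2 * i + 1" | i where "m = 2 * i + 2" by blast
  then show "fps_nth G_tree m = fps_nth (fps_X * planted) m"
  proof cases
    case 1
    then show ?thesis by (simp add: G fps_X_power_mult_nth)
  next
    case (2 i)
    have "fps_nth (fps_X * planted) m = 0" using planted_nth_even[of i] 2 by simp
    moreover have "fps_nth G_tree m = 0"
      unfolding G fps_X_power_mult_nth fps_add_nth fps_compose_sq_nth using 2 by simp
    ultimately show ?thesis by simp
  next
    case (3 i)
    have "fps_nth G_tree m = (if i = 0 then 1 else 0) + c i"
      unfolding G fps_X_power_mult_nth fps_add_nth fps_compose_sq_nth using 3 by simp
    moreover have "fps_nth (fps_X * planted) m = (if i = 0 then 1 else c i)" using p[of i] 3 by simp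
    ultimately show ?thesis using c0 by simp
  qed
qed

text \<open>The equation for \<open>U\<close> says that \<open>fps_X * inverse tree_kernel\<close>
  takes \<open>U\<close> to \<open>fps_X * F\<close>, so \<open>U\<close> is \<open>planted\<close>
  at \<open>fps_X * F\<close>. Hence \<open>G_tree\<close> at \<open>fps_X * F\<close> is
  \<open>F - 1\<close>, and \<open>fps_X * F\<close> is the inverse series that defines
  \<open>G_forest\<close>.\<close>

theorem G_forest_unique:
  fixes F U :: xq_series
  assumes F: "F = 1 + fps_X * F * U"
    and U: "(U - fps_X * F) * (1 - fps_const (qvar\<^sup>2) * U\<^sup>2) = fps_const qvar * U ^ 3" "fps_nth U 0 = 0"
  shows "G_forest = F"
proof -
  define Y where "Y = fps_X * F"
  have Y0: "fps_nth Y 0 = 0" by (simp add: Y_def)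
  let ?h = "fps_X * inverse tree_kernel"
  let ?N = "1 - fps_const (qvar\<^sup>2 + qvar) * fps_X\<^sup>2 :: xq_series" and ?D = "1 - fps_const (qvar\<^sup>2) * fps_X\<^sup>2 :: xq_series"
  have D0: "fps_nth ?D 0 \<noteq> 0" "fps_nth ?N 0 \<noteq> 0" by (simp_all add: power2_eq_square)
  have "inverse tree_kernel = inverse ?D * ?N"
    unfolding tree_kernel_def fps_inverse_mult using D0(2) by simp
  then have "?h * ?D = fps_X * ?N * (?D * inverse ?D)" by (simp add: mult_ac)
  then have hD: "?h * ?D = fps_X * ?N" unfolding inverse_mult_eq_1'[OF D0(1)] by simp
  have comp: "?D oo U = 1 - fps_const (qvar\<^sup>2) * U\<^sup>2" "?N oo U = 1 - fps_const (qvar\<^sup>2 + qvar) * U\<^sup>2"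
    using U(2) by (simp_all add: fps_compose_sub_distrib fps_compose_mult_distrib power2_eq_square)
  have "(?h oo U) * (?D oo U) = U * (?N oo U)"
    using arg_cong[OF hD, of "\<lambda>f. f oo U"] U(2) by (simp add: fps_compose_mult_distrib)
  also have "\<dots> = Y * (?D oo U)"
  proof -
    have ring: "u * (1 - (a + b) * u\<^sup>2) = (u - y) * (1 - a * u\<^sup>2) - b * u ^ 3 + y * (1 - a * u\<^sup>2)"
      for a b u y :: xq_series by (simp add: algebra_simps power2_eq_square power3_eq_cube)
    have "fps_const (qvar\<^sup>2 + qvar) = fps_const (qvar\<^sup>2) + fps_const qvar" by simp
    then have "U * (?N oo U) = U * (1 - (fps_const (qvar\<^sup>2) + fps_const qvar) * U\<^sup>2)" unfolding comp by (simp only:)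
    also have "\<dots> = Y * (1 - fps_const (qvar\<^sup>2) * U\<^sup>2)"
      unfolding ring[of U _ _ Y] U(1)[folded Y_def] by (simp only: diff_self add_0_left)
    finally show ?thesis unfolding comp .
  qed
  finally have "(?h oo U) * (?D oo U) = Y * (?D oo U)" .
  moreover have "fps_nth (?D oo U) 0 \<noteq> 0" unfolding comp using U(2) by (simp add: power2_eq_square)
  then have "?D oo U \<noteq> 0" by force
  ultimately have hU: "?h oo U = Y" by simp
  have "planted oo Y = (planted oo ?h) oo U"
    unfolding hU[symmetric] using U(2) by (intro fps_compose_assoc) simp_all
  then have pY: "planted oo Y = U" unfolding planted_inverse(2) using U(2) by simp
  have GY: "G_tree oo Y = Y * U"
    unfolding G_tree_planted using Y0 by (simp add: fps_compose_mult_distrib pY)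
  have F0: "fps_nth F 0 = 1" using arg_cong[OF F, of "\<lambda>f. fps_nth f 0"] by (simp add: mult.assoc)
  have FY: "F = 1 + Y * U" using F unfolding Y_def .
  have G0: "fps_nth (1 + G_tree) 0 \<noteq> 0" by (simp add: G_tree_planted)
  have "(fps_X / (1 + G_tree)) oo Y = (fps_X * inverse (1 + G_tree)) oo Y"
    using G0 by (simp add: fps_divide_unit)
  also have "\<dots> = Y * inverse ((1 + G_tree) oo Y)"
    using Y0 G0 by (simp add: fps_compose_mult_distrib fps_inverse_compose)
  also have "(1 + G_tree) oo Y = F" unfolding fps_compose_add_distrib GY using FY by simp
  also have "Y * inverse F = fps_X" unfolding Y_def using inverse_mult_eq_1'[of F] F0 by (simp add: mult.assoc)
  finally have *: "(fps_X / (1 + G_tree)) oo Y = fps_X" .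
  have XG0: "fps_nth (fps_X * G_forest) 0 = 0" "fps_nth (fps_X / (1 + G_tree)) 0 = 0"
    using G0 by (simp_all add: fps_divide_unit)
  have "fps_X * G_forest = (fps_X * G_forest) oo ((fps_X / (1 + G_tree)) oo Y)" unfolding * by simp
  also have "\<dots> = ((fps_X * G_forest) oo (fps_X / (1 + G_tree))) oo Y"
    using XG0 Y0 by (intro fps_compose_assoc)
  also have "\<dots> = Y" unfolding G_forest_inverse(2) using Y0 by simp
  finally show ?thesis unfolding Y_def by simp
qed

lemma G_forest_nth:
  "fps_nth G_forest m = 1 / of_nat (m + 1) * fps_nth ((1 + G_tree) ^ (m + 1)) m"
proof -
  have G0: "fps_nth (1 + G_tree) 0 \<noteq> 0" by (simp add: G_tree_planted)
  have "fps_nth G_forest m = fps_nth (fps_inv (fps_X * inverse (1 + G_tree))) (m + 1)"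
    unfolding G_forest_def using G0 by (simp add: fps_divide_unit)
  then show ?thesis using lagrange_inversion[OF G0, of "m + 1"] by simp
qed

section \<open>The generating function of shapes\<close>

text \<open>A sum over an infinite set is 0 by convention, so the sum and product rules for
  \<open>gf\<close> ask for finitely many objects of each size.\<close>

definition finite_levels :: "'s set \<Rightarrow> ('s \<Rightarrow> nat) \<Rightarrow> bool" where
  "finite_levels S sz \<longleftrightarrow> (\<forall>n. finite {s \<in> S. sz s = n})"

definition gf :: "'s set \<Rightarrow> ('s \<Rightarrow> nat) \<Rightarrow> ('s \<Rightarrow> 'r) \<Rightarrow> 'r :: comm_ring_1 fps" where
  "gf S sz wt = Abs_fps (\<lambda>n. \<Sum>s | s \<in> S \<and> sz s = n. wt s)"

lemma gf_Un:
  assumes "finite_levels S sz" "finite_levels T sz" "S \<inter> T = {}"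
  shows "gf (S \<union> T) sz wt = gf S sz wt + gf T sz wt"
proof (rule fps_ext)
  fix n
  have "{s. s \<in> S \<union> T \<and> sz s = n} = {s. s \<in> S \<and> sz s = n} \<union> {s. s \<in> T \<and> sz s = n}" by blast
  then show "fps_nth (gf (S \<union> T) sz wt) n = fps_nth (gf S sz wt + gf T sz wt) n"
    using assms unfolding gf_def finite_levels_def by (simp add: sum.union_disjoint disjoint_iff)
qed

lemma gf_image:
  assumes "inj_on h S" "\<And>s. s \<in> S \<Longrightarrow> sz (h s) = sz' s + d" "\<And>s. s \<in> S \<Longrightarrow> wt (h s) = c * wt' s"
  shows "gf (h ` S) sz wt = fps_const c * fps_X ^ d * gf S sz' wt'"
proof (rule fps_ext)
  fix n
  have "(\<Sum>s | s \<in> h ` S \<and> sz s = n. wt s) = (\<Sum>s | s \<in> S \<and> sz' s + d = n. wt (h s))"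
  proof (rule sum.reindex_cong[of h])
    show "inj_on h {s. s \<in> S \<and> sz' s + d = n}" using assms(1) by (auto simp: inj_on_def)
    show "{s. s \<in> h ` S \<and> sz s = n} = h ` {s. s \<in> S \<and> sz' s + d = n}" using assms(2) by auto
  qed simp
  also have "\<dots> = (if n < d then 0 else c * (\<Sum>s | s \<in> S \<and> sz' s = n - d. wt' s))"
  proof (cases "n < d")
    case True
    then have "{s. s \<in> S \<and> sz' s + d = n} = {}" by auto
    then show ?thesis using True by simp
  next
    case False
    then have "{s. s \<in> S \<and> sz' s + d = n} = {s. s \<in> S \<and> sz' s = n - d}" by auto
    then show ?thesis using False assms(3) by (simp add: sum_distrib_left)
  qed
  finally show "fps_nth (gf (h ` S) sz wt) n = fps_nth (fps_const c * fps_X ^ d * gf S sz' wt') n"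
    unfolding gf_def by (simp add: fps_X_power_mult_nth mult.assoc)
qed

lemma gf_Times:
  assumes "finite_levels S sz" "finite_levels T sz'"
  shows "gf (S \<times> T) (\<lambda>(a, b). sz a + sz' b) (\<lambda>(a, b). wt a * wt' b) = gf S sz wt * gf T sz' wt'"
proof (rule fps_ext)
  fix n
  let ?A = "\<lambda>i. {s. s \<in> S \<and> sz s = i}" and ?B = "\<lambda>i. {s. s \<in> T \<and> sz' s = i}"
  have "{p. p \<in> S \<times> T \<and> (case p of (a, b) \<Rightarrow> sz a + sz' b) = n} = (\<Union>i \<in> {0..n}. ?A i \<times> ?B (n - i))"
    by auto
  moreover have "(\<Sum>p \<in> (\<Union>i \<in> {0..n}. ?A i \<times> ?B (n - i)). case p of (a, b) \<Rightarrow> wt a * wt' b) =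
      (\<Sum>i \<in> {0..n}. \<Sum>p \<in> ?A i \<times> ?B (n - i). case p of (a, b) \<Rightarrow> wt a * wt' b)"
    by (rule sum.UNION_disjoint) (use assms in \<open>auto simp: finite_levels_def\<close>)
  moreover have "(\<Sum>p \<in> ?A i \<times> ?B (n - i). case p of (a, b) \<Rightarrow> wt a * wt' b) = sum wt (?A i) * sum wt' (?B (n - i))" for i
    by (simp add: sum_product sum.cartesian_product)
  ultimately show "fps_nth (gf (S \<times> T) (\<lambda>(a, b). sz a + sz' b) (\<lambda>(a, b). wt a * wt' b)) n = fps_nth (gf S sz wt * gf T sz' wt') n"
    unfolding gf_def by (simp add: fps_mult_nth)
qed

lemma finite_levels_image:
  assumes "finite_levels S sz'" "\<And>s. s \<in> S \<Longrightarrow> sz (h s) = sz' s + d"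
  shows "finite_levels (h ` S) sz"
  unfolding finite_levels_def
proof
  fix n
  have "{t \<in> h ` S. sz t = n} \<subseteq> h ` {s \<in> S. sz' s = n - d}" using assms(2) by auto
  then show "finite {t \<in> h ` S. sz t = n}"
    using assms(1) finite_subset unfolding finite_levels_def by blast
qed

lemma finite_levels_Times:
  assumes "finite_levels S sz" "finite_levels T sz'"
  shows "finite_levels (S \<times> T) (\<lambda>(a, b). sz a + sz' b)"
  unfolding finite_levels_def
proof
  fix n
  have "{p \<in> S \<times> T. (case p of (a, b) \<Rightarrow> sz a + sz' b) = n} \<subseteq>
      (\<Union>i \<le> n. {s \<in> S. sz s = i}) \<times> (\<Union>i \<le> n. {s \<in> T. sz' s = i})" by auto
  then show "finite {p \<in> S \<times> T. (case p of (a, b) \<Rightarrow> sz a + sz' b) = n}"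
    by (rule finite_subset) (use assms in \<open>simp add: finite_levels_def\<close>)
qed

section \<open>The grammar equations\<close>

definition ok_forests :: "unit pforest set" where "ok_forests = {f. ok_f f}"
definition ok_branches :: "unit branch set" where "ok_branches = {b. ok_b b}"
definition ok_children :: "unit branch list set" where
  "ok_children = {bs. odd (length bs) \<and> 3 \<le> length bs \<and> list_all ok_b bs}"

abbreviation "size_f f \<equiv> length (leaves_f f)"
abbreviation "size_b b \<equiv> length (leaves_b b)"
abbreviation "size_bs bs \<equiv> sum_list (map (\<lambda>b. length (leaves_b b)) bs)"

lemma size_b_pos: "ok_b b \<Longrightarrow> 1 \<le> size_b b"
proof (induct b rule: pforest_branch_induct(2)[where P = "\<lambda>_. True"])
  case (Node v bs)
  then obtain a cs where bs: "bs = a # cs" by (cases bs) auto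
  then have "1 \<le> size_b a" using Node by simp
  then show ?case by (simp add: bs)
qed auto

lemma size_bs_ge: "list_all ok_b bs \<Longrightarrow> length bs \<le> size_bs bs"
  by (induct bs) (use size_b_pos in force)+

text \<open>Each of the other subbranches has at least one leaf. With three or more of them a
  subbranch is strictly smaller than its node, which carries the induction in
  \<open>finite_shapes\<close>.\<close>

lemma size_bs_elem: "list_all ok_b bs \<Longrightarrow> b \<in> set bs \<Longrightarrow> size_b b + length bs \<le> Suc (size_bs bs)"
proof (induct bs)
  case (Cons a bs)
  show ?case
  proof (cases "b = a")
    case True
    then show ?thesis using size_bs_ge[of bs] Cons(2) by simp
  next
    case False
    then have "size_b b + length bs \<le> Suc (size_bs bs)" using Cons by simp
    then show ?thesis using size_b_pos[of a] Cons(2) by simp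
  qed
qed simp

lemma length_leaves_Node: "size_b (Node v bs) = size_bs bs"
  by (simp add: length_concat comp_def)

lemma finite_shapes:
  "finite {f :: unit pforest. ok_f f \<and> size_f f = n} \<and> finite {b :: unit branch. ok_b b \<and> size_b b = n}"
proof (induct n rule: less_induct)
  case (less n)
  define F where "F = (\<Union>i \<in> {..<n}. {f :: unit pforest. ok_f f \<and> size_f f = i})"
  define T where "T = (\<Union>i \<in> {..<n}. {b :: unit branch. ok_b b \<and> size_b b = i})"
  have fin: "finite F" "finite T" using less by (simp_all add: F_def T_def)
  have "{f :: unit pforest. ok_f f \<and> size_f f = n} \<subseteq> insert Empty ((\<lambda>(b, g). Tree () b g) ` (T \<times> F))"
  proof
    fix f :: "unit pforest" assume f: "f \<in> {f. ok_f f \<and> size_f f = n}"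
    show "f \<in> insert Empty ((\<lambda>(b, g). Tree () b g) ` (T \<times> F))"
    proof (cases f)
      case (Tree v b g)
      then have "(b, g) \<in> T \<times> F" using f by (auto simp: T_def F_def)
      then show ?thesis using Tree by force
    qed simp
  qed
  then have 1: "finite {f :: unit pforest. ok_f f \<and> size_f f = n}"
    by (rule finite_subset) (use fin in simp)
  have "{b :: unit branch. ok_b b \<and> size_b b = n} \<subseteq>
      (\<lambda>g. Tip g ()) ` F \<union> Node () ` {bs. set bs \<subseteq> T \<and> length bs \<le> n}"
  proof
    fix b :: "unit branch" assume b: "b \<in> {b. ok_b b \<and> size_b b = n}"
    show "b \<in> (\<lambda>g. Tip g ()) ` F \<union> Node () ` {bs. set bs \<subseteq> T \<and> length bs \<le> n}"
    proof (cases b)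
      case (Tip g v)
      then have "g \<in> F" using b by (auto simp: F_def)
      then show ?thesis using Tip by force
    next
      case (Node v bs)
      have ok: "list_all ok_b bs" "3 \<le> length bs" and sz: "size_bs bs = n"
        using b length_leaves_Node[of v bs] by (simp_all add: Node)
      have "c \<in> T" if "c \<in> set bs" for c
        using size_bs_elem[OF ok(1) that] ok that sz by (auto simp: T_def list_all_iff)
      moreover have "length bs \<le> n" using size_bs_ge[OF ok(1)] sz by simp
      ultimately show ?thesis using Node by auto
    qed
  qed
  then have "finite {b :: unit branch. ok_b b \<and> size_b b = n}"
    by (rule finite_subset) (intro finite_UnI finite_imageI fin finite_lists_length_le)
  then show ?case using 1 by blast
qed

lemma finite_levels_shapes:
  "finite_levels ok_forests size_f" "finite_levels ok_branches size_b" "finite_levels ok_children size_bs"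
proof -
  show "finite_levels ok_forests size_f" "finite_levels ok_branches size_b"
    using finite_shapes by (simp_all add: finite_levels_def ok_forests_def ok_branches_def)
  have "finite {bs \<in> ok_children. size_bs bs = n}" for n
  proof -
    have "Node () ` {bs \<in> ok_children. size_bs bs = n} \<subseteq> {b. ok_b b \<and> size_b b = n}"
      by (auto simp: ok_children_def length_concat comp_def)
    then have "finite (Node () ` {bs \<in> ok_children. size_bs bs = n})"
      using finite_shapes finite_subset by blast
    then show ?thesis by (rule finite_imageD) (simp add: inj_on_def)
  qed
  then show "finite_levels ok_children size_bs" by (simp add: finite_levels_def)
qed

abbreviation "GF \<equiv> gf ok_forests size_f (\<lambda>f. qvar ^ dim_f f)"
abbreviation "GB \<equiv> gf ok_branches size_b (\<lambda>b. qvar ^ dim_b b)"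
abbreviation "GC \<equiv> gf ok_children size_bs (\<lambda>bs. qvar ^ (length bs - 2 + sum_list (map dim_b bs)))"

lemma GF_eq: "GF = 1 + fps_X * (GB * GF)"
proof -
  have S: "ok_forests = {Empty} \<union> (\<lambda>(b, g). Tree () b g) ` (ok_branches \<times> ok_forests)"
  proof (rule set_eqI)
    fix f show "f \<in> ok_forests \<longleftrightarrow> f \<in> {Empty} \<union> (\<lambda>(b, g). Tree () b g) ` (ok_branches \<times> ok_forests)"
      by (cases f) (auto simp: ok_forests_def ok_branches_def)
  qed
  have E: "gf {Empty :: unit pforest} size_f (\<lambda>f. qvar ^ dim_f f) = 1"
  proof (rule fps_ext)
    fix n
    have "{s. s \<in> {Empty :: unit pforest} \<and> size_f s = n} = (if n = 0 then {Empty} else {})" by auto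
    then show "fps_nth (gf {Empty :: unit pforest} size_f (\<lambda>f. qvar ^ dim_f f)) n = fps_nth 1 n" by (simp add: gf_def)
  qed
  let ?T = "(\<lambda>(b, g). Tree () b g) ` (ok_branches \<times> ok_forests)"
  have fl: "finite_levels ?T size_f"
    by (rule finite_levels_image[OF finite_levels_Times[OF finite_levels_shapes(2,1)], of _ _ 1]) auto
  have "gf ?T size_f (\<lambda>f. qvar ^ dim_f f) = fps_const 1 * fps_X ^ 1 *
      gf (ok_branches \<times> ok_forests) (\<lambda>(b, g). size_b b + size_f g) (\<lambda>(b, g). qvar ^ dim_b b * qvar ^ dim_f g)"
    by (rule gf_image) (auto simp: inj_on_def power_add)
  then have T: "gf ?T size_f (\<lambda>f. qvar ^ dim_f f) = fps_X * (GB * GF)"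
    unfolding gf_Times[OF finite_levels_shapes(2,1)] by simp
  have "finite_levels {Empty :: unit pforest} size_f" by (simp add: finite_levels_def)
  then have "gf ({Empty} \<union> ?T) size_f (\<lambda>f. qvar ^ dim_f f) = 1 + fps_X * (GB * GF)"
    unfolding E[symmetric] T[symmetric] by (rule gf_Un[OF _ fl]) auto
  then show ?thesis using S by simp
qed

lemma GB_eq: "GB = fps_X * GF + GC"
proof -
  have S: "ok_branches = (\<lambda>g. Tip g ()) ` ok_forests \<union> Node () ` ok_children"
  proof (rule set_eqI)
    fix b show "b \<in> ok_branches \<longleftrightarrow> b \<in> (\<lambda>g. Tip g ()) ` ok_forests \<union> Node () ` ok_children"
      by (cases b) (auto simp: ok_forests_def ok_branches_def ok_children_def)
  qed
  have fl: "finite_levels ((\<lambda>g. Tip g ()) ` ok_forests) size_b" "finite_levels (Node () ` ok_children) size_b"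
    by (rule finite_levels_image[OF finite_levels_shapes(1), of _ _ 1], simp)
      (rule finite_levels_image[OF finite_levels_shapes(3), of _ _ 0], simp add: length_concat comp_def)
  have 1: "gf ((\<lambda>g. Tip g ()) ` ok_forests) size_b (\<lambda>b. qvar ^ dim_b b) = fps_const 1 * fps_X ^ 1 * GF"
    by (rule gf_image) (auto simp: inj_on_def)
  have 2: "gf (Node () ` ok_children) size_b (\<lambda>b. qvar ^ dim_b b) = fps_const 1 * fps_X ^ 0 * GC"
    by (rule gf_image) (auto simp: inj_on_def length_concat comp_def)
  have "gf ((\<lambda>g. Tip g ()) ` ok_forests \<union> Node () ` ok_children) size_b (\<lambda>b. qvar ^ dim_b b) = fps_X * GF + GC"
    using gf_Un[OF fl, of "\<lambda>b. qvar ^ dim_b b"] unfolding 1 2 by auto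
  then show ?thesis unfolding S[symmetric] .
qed

text \<open>Splitting two subbranches off a longer list turns the series over all odd lengths into a
  linear equation: three subbranches weigh \<open>q\<close> to the power \<open>3 - 2\<close>, each
  further pair \<open>q\<close> squared.\<close>

lemma GC_eq: "GC = fps_const qvar * (GB * (GB * GB)) + fps_const (qvar\<^sup>2) * (GB * (GB * GC))"
proof -
  let ?h3 = "\<lambda>(a, b, c). [a, b, c]" and ?h2 = "\<lambda>(a, b, cs). a # b # cs"
  let ?S3 = "ok_branches \<times> ok_branches \<times> ok_branches" and ?S2 = "ok_branches \<times> ok_branches \<times> ok_children"
  let ?wt = "\<lambda>bs. qvar ^ (length bs - 2 + sum_list (map dim_b bs))"
  have S: "ok_children = ?h3 ` ?S3 \<union> ?h2 ` ?S2"
  proof (rule set_eqI)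
    fix bs :: "unit branch list"
    show "bs \<in> ok_children \<longleftrightarrow> bs \<in> ?h3 ` ?S3 \<union> ?h2 ` ?S2"
    proof
      assume bs: "bs \<in> ok_children"
      then obtain a b c cs where abc: "bs = a # b # c # cs"
        unfolding ok_children_def by (auto simp: numeral_3_eq_3 Suc_le_length_iff)
      show "bs \<in> ?h3 ` ?S3 \<union> ?h2 ` ?S2"
      proof (cases cs)
        case Nil
        then have "bs = ?h3 (a, b, c)" "(a, b, c) \<in> ?S3" using bs abc by (auto simp: ok_children_def ok_branches_def)
        then show ?thesis by blast
      next
        case (Cons d ds)
        then have "bs = ?h2 (a, b, c # cs)" "(a, b, c # cs) \<in> ?S2"
          using bs abc by (auto simp: ok_children_def ok_branches_def elim: oddE)
        then show ?thesis by blast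
      qed
    next
      assume "bs \<in> ?h3 ` ?S3 \<union> ?h2 ` ?S2"
      then show "bs \<in> ok_children" by (auto simp: ok_children_def ok_branches_def)
    qed
  qed
  note fB = finite_levels_shapes(2) and fC = finite_levels_shapes(3)
  note f3 = finite_levels_Times[OF fB finite_levels_Times[OF fB fB]]
  note f2 = finite_levels_Times[OF fB finite_levels_Times[OF fB fC]]
  have fl: "finite_levels (?h3 ` ?S3) size_bs" "finite_levels (?h2 ` ?S2) size_bs"
    by (rule finite_levels_image[OF f3, of _ _ 0], auto) (rule finite_levels_image[OF f2, of _ _ 0], auto)
  have "gf (?h3 ` ?S3) size_bs ?wt = fps_const qvar * fps_X ^ 0 *
      gf ?S3 (\<lambda>(a, p). size_b a + (case p of (b, c) \<Rightarrow> size_b b + size_b c))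
        (\<lambda>(a, p). qvar ^ dim_b a * (case p of (b, c) \<Rightarrow> qvar ^ dim_b b * qvar ^ dim_b c))"
    by (rule gf_image) (auto simp: inj_on_def power_add mult_ac)
  then have 3: "gf (?h3 ` ?S3) size_bs ?wt = fps_const qvar * (GB * (GB * GB))"
    unfolding gf_Times[OF fB finite_levels_Times[OF fB fB]] gf_Times[OF fB fB] by simp
  have "gf (?h2 ` ?S2) size_bs ?wt = fps_const (qvar\<^sup>2) * fps_X ^ 0 *
      gf ?S2 (\<lambda>(a, p). size_b a + (case p of (b, cs) \<Rightarrow> size_b b + size_bs cs))
        (\<lambda>(a, p). qvar ^ dim_b a * (case p of (b, cs) \<Rightarrow> qvar ^ dim_b b * ?wt cs))"
  proof (rule gf_image)
    fix s assume s: "s \<in> ?S2"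
    obtain a b cs where abc: "s = (a, b, cs)" by (cases s) auto
    \<comment> \<open>This keeps \<open>length cs - 2\<close> from truncating, so the two split-off
      subbranches contribute exactly \<open>qvar\<^sup>2\<close>.\<close>
    then have "2 \<le> length cs" using s by (auto simp: ok_children_def)
    then obtain k where "length cs = 2 + k" using le_Suc_ex by blast
    then show "?wt (?h2 s) = qvar\<^sup>2 * (case s of (a, p) \<Rightarrow> qvar ^ dim_b a * (case p of (b, cs) \<Rightarrow> qvar ^ dim_b b * ?wt cs))"
      unfolding abc by (simp add: power_add power2_eq_square mult_ac)
  qed (auto simp: inj_on_def)
  then have 2: "gf (?h2 ` ?S2) size_bs ?wt = fps_const (qvar\<^sup>2) * (GB * (GB * GC))"
    unfolding gf_Times[OF fB finite_levels_Times[OF fB fC]] gf_Times[OF fB fC] by simp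
  have "?h3 ` ?S3 \<inter> ?h2 ` ?S2 = {}" by (auto simp: ok_children_def)
  then have "gf (?h3 ` ?S3 \<union> ?h2 ` ?S2) size_bs ?wt = fps_const qvar * (GB * (GB * GB)) + fps_const (qvar\<^sup>2) * (GB * (GB * GC))"
    using gf_Un[OF fl, of ?wt] unfolding 2 3 by simp
  then show ?thesis unfolding S[symmetric] .
qed

theorem G_forest_GF: "G_forest = GF"
proof (rule G_forest_unique)
  show "GF = 1 + fps_X * GF * GB" using GF_eq by (simp only: mult_ac)
  have C: "GB - fps_X * GF = GC" using GB_eq by simp
  have ring: "a = b * (u * (u * u)) + c * (u * (u * a)) \<Longrightarrow> a * (1 - c * u\<^sup>2) = b * u ^ 3" for a b c u :: xq_series
    by (simp add: algebra_simps power2_eq_square power3_eq_cube)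
  show "(GB - fps_X * GF) * (1 - fps_const (qvar\<^sup>2) * GB\<^sup>2) = fps_const qvar * GB ^ 3"
    unfolding C by (rule ring[OF GC_eq])
  have "leaves_b b \<noteq> []" if "ok_b b" for b :: "unit branch" using size_b_pos[OF that] by auto
  then have "{b. b \<in> ok_branches \<and> size_b b = 0} = {}" by (auto simp: ok_branches_def)
  then show "fps_nth GB 0 = 0" unfolding gf_def by (simp only: fps_nth_Abs_fps sum.empty)
qed

lemma G_forest_coefficient:
  "fls_nth (fps_nth G_forest m) (int r) = of_nat (card {f :: unit pforest. ok_f f \<and> size_f f = m \<and> dim_f f = r})"
proof -
  let ?S = "{f :: unit pforest. f \<in> ok_forests \<and> size_f f = m}"
  have fin: "finite ?S" using finite_shapes by (simp add: ok_forests_def)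
  have "fls_nth (fps_nth G_forest m) (int r) = fls_nth (\<Sum>f \<in> ?S. qvar ^ dim_f f) (int r)"
    unfolding G_forest_GF gf_def by simp
  also have "\<dots> = (\<Sum>f \<in> ?S. fls_nth (qvar ^ dim_f f) (int r))"
    using fin by (induct rule: finite_induct) simp_all
  also have "\<dots> = (\<Sum>f \<in> ?S. if dim_f f = r then 1 else 0)"
    by (intro sum.cong refl) auto
  also have "\<dots> = of_nat (card {f \<in> ?S. dim_f f = r})"
    using fin by (simp add: sum.If_cases Int_def)
  also have "{f \<in> ?S. dim_f f = r} = {f :: unit pforest. ok_f f \<and> size_f f = m \<and> dim_f f = r}"
    by (auto simp: ok_forests_def)
  finally show ?thesis .
qed

section \<open>The algebraic equation\<close>

theorem G_forest_equation:
  fixes x Q :: xq_series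
  defines "x \<equiv> fps_X" and "Q \<equiv> fps_const fls_X"
  shows "(x ^ 4 - Q ^ 2 * x ^ 2) * G_forest ^ 4
      + ((2 * Q ^ 2 - 1) * x ^ 2 + Q * (Q + 1)) * G_forest ^ 3
      + (x ^ 2 - Q * (Q * (x ^ 2 + 3) + 3)) * G_forest ^ 2
      + 3 * Q * (Q + 1) * G_forest - Q * (Q + 1) = 0"
proof -
  define F U where "F = G_forest" and "U = GB"
  have "GF - 1 = fps_X * (GB * GF)" using GF_eq by (metis add_diff_cancel_left')
  then have F: "F - 1 = x * F * U" unfolding F_def U_def x_def G_forest_GF by (simp only: mult_ac)
  have ring1: "a * (1 - c * u\<^sup>2) = b * u ^ 3" if "a = b * (u * (u * u)) + c * (u * (u * a))" for a b c u :: xq_series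
    using that by (simp add: algebra_simps power2_eq_square power3_eq_cube)
  have C: "GB - fps_X * GF = GC" using GB_eq by simp
  have "(GB - fps_X * GF) * (1 - fps_const (qvar\<^sup>2) * GB\<^sup>2) = fps_const qvar * GB ^ 3"
    unfolding C by (rule ring1[OF GC_eq])
  then have U: "(U - x * F) * (1 - Q\<^sup>2 * U\<^sup>2) = Q * U ^ 3"
    unfolding F_def U_def x_def Q_def G_forest_GF by simp
  \<comment> \<open>Elimination of \<open>U\<close>: multiplied by \<open>(x * F) ^ 3\<close>, the
    branch equation contains \<open>U\<close> only inside \<open>x * F * U\<close>, which is
    \<open>F - 1\<close>.\<close>
  have "(x * F * U - (x * F)\<^sup>2) * ((x * F)\<^sup>2 - Q\<^sup>2 * (x * F * U)\<^sup>2) = (x * F) ^ 3 * ((U - x * F) * (1 - Q\<^sup>2 * U\<^sup>2))"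
    by (simp add: algebra_simps power2_eq_square power3_eq_cube)
  also have "\<dots> = Q * (x * F * U) ^ 3" unfolding U by (simp add: algebra_simps power3_eq_cube)
  finally have E: "(F - 1 - (x * F)\<^sup>2) * ((x * F)\<^sup>2 - Q\<^sup>2 * (F - 1)\<^sup>2) - Q * (F - 1) ^ 3 = 0"
    unfolding F[symmetric] by simp
  have "(x ^ 4 - Q ^ 2 * x ^ 2) * F ^ 4 + ((2 * Q ^ 2 - 1) * x ^ 2 + Q * (Q + 1)) * F ^ 3
      + (x ^ 2 - Q * (Q * (x ^ 2 + 3) + 3)) * F ^ 2 + 3 * Q * (Q + 1) * F - Q * (Q + 1)
    = - ((F - 1 - (x * F)\<^sup>2) * ((x * F)\<^sup>2 - Q\<^sup>2 * (F - 1)\<^sup>2) - Q * (F - 1) ^ 3)"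
    by (simp add: algebra_simps power2_eq_square power3_eq_cube power4_eq_xxxx)
  also have "\<dots> = 0" unfolding E by simp
  finally show ?thesis unfolding F_def .
qed

section \<open>Irreducibility of the quartic\<close>

abbreviation "q_embed \<equiv> (\<lambda>c :: rat poly. fps_to_fls (fps_of_poly c))"

lemma q_embed_hom: "q_embed (a + b) = q_embed a + q_embed b" "q_embed (a * b) = q_embed a * q_embed b"
  "q_embed (sum f S) = (\<Sum>i \<in> S. q_embed (f i))"
proof -
  show add: "q_embed (a + b) = q_embed a + q_embed b" for a b
    by (simp add: fps_of_poly_add)
  show "q_embed (a * b) = q_embed a * q_embed b"
    by (simp add: fps_of_poly_mult fls_times_fps_to_fls)
  show "q_embed (sum f S) = (\<Sum>i \<in> S. q_embed (f i))"
    by (induct S rule: infinite_finite_induct) (simp_all add: fps_of_poly_add)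
qed

definition xq_fps :: "rat poly poly \<Rightarrow> rat fls fps" where
  "xq_fps f = fps_of_poly (map_poly q_embed f)"

lemma xq_fps_nth: "fps_nth (xq_fps f) n = q_embed (coeff f n)"
  by (simp add: xq_fps_def coeff_map_poly)

lemma xq_fps_mult: "xq_fps (a * b) = xq_fps a * xq_fps b"
  by (rule fps_ext) (simp only: xq_fps_nth coeff_mult fps_mult_nth q_embed_hom atLeast0AtMost)

lemma xq_fps_add: "xq_fps (a + b) = xq_fps a + xq_fps b"
  by (rule fps_ext) (simp only: xq_fps_nth coeff_add fps_add_nth q_embed_hom)

lemma xq_poly_fps: "xq_poly f = fps_to_fls (xq_fps f)"
  unfolding xq_poly_def xq_fps_def ..

lemma xq_poly_hom: "xq_poly (a + b) = xq_poly a + xq_poly b" "xq_poly (a * b) = xq_poly a * xq_poly b"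
  by (simp_all add: xq_poly_fps xq_fps_mult xq_fps_add fls_times_fps_to_fls)

lemma xq_poly_0 [simp]: "xq_poly 0 = 0" and xq_poly_1 [simp]: "xq_poly 1 = 1"
  by (simp_all add: xq_poly_def)

lemma xq_poly_eq_0_iff [simp]: "xq_poly f = 0 \<longleftrightarrow> f = 0"
proof
  assume "xq_poly f = 0"
  then have "xq_fps f = 0" by (simp add: xq_poly_fps)
  then have "q_embed (coeff f n) = 0" for n by (metis xq_fps_nth fps_zero_nth)
  then have "coeff f n = 0" for n by simp
  then show "f = 0" by (simp add: poly_eq_iff)
qed simp

lemma xq_poly_sum: "xq_poly (sum h S) = (\<Sum>i \<in> S. xq_poly (h i))"
  by (induct S rule: infinite_finite_induct) (simp_all add: xq_poly_hom)

lemma map_xq_hom: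
  "map_poly xq_poly (a + b) = map_poly xq_poly a + map_poly xq_poly b"
  "map_poly xq_poly (a * b) = map_poly xq_poly a * map_poly xq_poly b"
  by (rule poly_eqI; simp add: coeff_map_poly xq_poly_hom coeff_mult xq_poly_sum)+

lemma degree_map_xq: "degree (map_poly xq_poly p) = degree p"
  by (rule degree_map_poly) simp

definition coef_Q :: "rat poly poly" where "coef_Q = [:[:0, 1:]:]"

definition coef_X :: "rat poly poly" where "coef_X = [:0, 1:]"

definition forest_poly :: "rat poly poly poly" where
  "forest_poly = [:- (coef_Q * (coef_Q + 1)), 3 * coef_Q * (coef_Q + 1),
     coef_X\<^sup>2 - coef_Q * (coef_Q * (coef_X\<^sup>2 + 3) + 3),
     (2 * coef_Q\<^sup>2 - 1) * coef_X\<^sup>2 + coef_Q * (coef_Q + 1), coef_X ^ 4 - coef_Q\<^sup>2 * coef_X\<^sup>2:]"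

lemma forest_poly_coeffs:
  "coeff forest_poly 0 = - (coef_Q * (coef_Q + 1))" "coeff forest_poly 1 = 3 * coef_Q * (coef_Q + 1)"
  "coeff forest_poly 2 = coef_X\<^sup>2 - coef_Q * (coef_Q * (coef_X\<^sup>2 + 3) + 3)"
  "coeff forest_poly 3 = (2 * coef_Q\<^sup>2 - 1) * coef_X\<^sup>2 + coef_Q * (coef_Q + 1)"
  "coeff forest_poly 4 = coef_X ^ 4 - coef_Q\<^sup>2 * coef_X\<^sup>2"
  by (simp_all add: forest_poly_def numeral_2_eq_2 numeral_3_eq_3 eval_nat_numeral)

text \<open>The point \<open>x = 1\<close>, \<open>q = -1/2\<close>, where the polynomial has no real root.\<close>

definition at_point :: "rat poly poly \<Rightarrow> rat" where
  "at_point r = poly (poly r [:1:]) (- 1 / 2)"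

lemma at_point_hom: "at_point (a + b) = at_point a + at_point b" "at_point (a * b) = at_point a * at_point b"
  by (simp_all add: at_point_def)

lemma at_point_coeffs:
  "at_point (coeff forest_poly 0) = 1 / 4" "at_point (coeff forest_poly 1) = - 3 / 4"
  "at_point (coeff forest_poly 2) = 3 / 2" "at_point (coeff forest_poly 3) = - 3 / 4"
  "at_point (coeff forest_poly 4) = 3 / 4"
  unfolding forest_poly_coeffs at_point_def coef_Q_def coef_X_def
  by (simp_all add: power2_eq_square power4_eq_xxxx)

lemma forest_poly_degree: "degree forest_poly = 4" "forest_poly \<noteq> 0"
proof -
  have "at_point (coeff forest_poly 4) \<noteq> 0" unfolding at_point_coeffs by simp
  then have c: "coeff forest_poly 4 \<noteq> 0" by (auto simp: at_point_def)
  then show "forest_poly \<noteq> 0" by auto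
  have "degree forest_poly \<le> 4" by (simp add: forest_poly_def)
  then show "degree forest_poly = 4" using le_degree[OF c] by simp
qed

text \<open>The leading coefficient does not vanish at the chosen point, so a linear factor would
  keep its degree there and give the rational root \<open>- A 0 / A 1\<close>.\<close>

lemma no_linear_factor:
  assumes "forest_poly = a * b" "degree a = 1" "degree b = 3"
  shows False
proof -
  define A B where "A i = at_point (coeff a i)" and "B i = at_point (coeff b i)" for i
  have za: "coeff a i = 0" if "1 < i" for i using that assms(2) by (simp add: coeff_eq_0)
  have zb: "coeff b i = 0" if "3 < i" for i using that assms(3) by (simp add: coeff_eq_0)
  have c: "coeff forest_poly 0 = coeff a 0 * coeff b 0"
    "coeff forest_poly 1 = coeff a 0 * coeff b 1 + coeff a 1 * coeff b 0"
    "coeff forest_poly 2 = coeff a 0 * coeff b 2 + coeff a 1 * coeff b 1"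
    "coeff forest_poly 3 = coeff a 0 * coeff b 3 + coeff a 1 * coeff b 2"
    "coeff forest_poly 4 = coeff a 1 * coeff b 3"
    unfolding assms(1) coeff_mult by (simp_all add: za zb eval_nat_numeral)
  have e: "1 / 4 = A 0 * B 0" "- 3 / 4 = A 0 * B 1 + A 1 * B 0" "3 / 2 = A 0 * B 2 + A 1 * B 1"
    "- 3 / 4 = A 0 * B 3 + A 1 * B 2" "3 / 4 = A 1 * B 3"
    using at_point_coeffs unfolding c at_point_hom A_def B_def by simp_all
  define t where "t = - A 0 / A 1"
  have "A 1 \<noteq> 0" using e(5) by auto
  then have t: "A 0 = - A 1 * t" by (simp add: t_def)
  have "3 / 4 * t ^ 4 + - 3 / 4 * t ^ 3 + 3 / 2 * t ^ 2 + - 3 / 4 * t + 1 / 4 =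
      (A 1 * B 3) * t ^ 4 + (A 0 * B 3 + A 1 * B 2) * t ^ 3 + (A 0 * B 2 + A 1 * B 1) * t ^ 2
      + (A 0 * B 1 + A 1 * B 0) * t + A 0 * B 0"
    by (simp only: e(1,3,5)[symmetric] e(2)[symmetric] e(4)[symmetric])
  also have "\<dots> = (A 0 + A 1 * t) * (B 0 + B 1 * t + B 2 * t ^ 2 + B 3 * t ^ 3)"
    by (simp add: algebra_simps eval_nat_numeral)
  also have "\<dots> = 0" unfolding t by simp
  finally have "3 * t ^ 4 - 3 * t ^ 3 + 6 * t ^ 2 - 3 * t + 1 = 0" by (simp add: field_simps)
  \<comment> \<open>Completing squares: \<open>3 * (t * (t - 1 / 2)) ^ 2\<close> absorbs the quartic
    and cubic terms and leaves \<open>21 / 4 * t ^ 2 - 3 * t + 1\<close>, whose minimum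
    \<open>4 / 7\<close> is taken at \<open>2 / 7\<close>.\<close>
  moreover have "3 * t ^ 4 - 3 * t ^ 3 + 6 * t ^ 2 - 3 * t + 1 =
      3 * (t * (t - 1 / 2)) ^ 2 + 21 / 4 * (t - 2 / 7) ^ 2 + 4 / 7"
    by (simp add: field_simps power2_eq_square eval_nat_numeral)
  moreover have "0 \<le> (t * (t - 1 / 2)) ^ 2" "0 \<le> (t - 2 / 7) ^ 2" by simp_all
  ultimately show False by linarith
qed

text \<open>At \<open>q = -1\<close> the polynomial is divisible by \<open>Y^3\<close>, while \<open>q + 1\<close> divides the
  constant coefficient only once: as in Eisenstein's criterion, one factor has degree at least 3.\<close>

lemma no_quadratic_factor:
  assumes "forest_poly = a * b" "degree a = 2" "degree b = 2"
  shows False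
proof -
  define \<pi> :: "rat poly poly" where "\<pi> = [:[:1, 1:]:]"
  have "prime_elem [:1, 1 :: rat:]" by (rule prime_elem_linear_field_poly) simp
  then have prime: "prime_elem \<pi>" unfolding \<pi>_def by (rule lift_prime_elem_poly)
  have pi: "\<pi> = coef_Q + 1" by (simp add: \<pi>_def coef_Q_def one_pCons)
  have Q: "\<not> \<pi> dvd coef_Q"
  proof
    assume "\<pi> dvd coef_Q"
    then have "[:1, 1:] dvd coeff coef_Q 0" unfolding \<pi>_def const_poly_dvd_iff by blast
    then have "[:- (- 1), 1:] dvd [:0, 1 :: rat:]" by (simp add: coef_Q_def)
    then show False unfolding poly_eq_0_iff_dvd[symmetric] by simp
  qed
  have dd: "\<not> \<pi> * \<pi> dvd coef_Q * (coef_Q + 1)"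
  proof
    assume "\<pi> * \<pi> dvd coef_Q * (coef_Q + 1)"
    then have "\<pi> dvd coef_Q" unfolding pi[symmetric] using prime by (simp add: prime_elem_def)
    then show False using Q by blast
  qed
  have d4: "\<not> \<pi> dvd coeff forest_poly 4"
  proof
    assume "\<pi> dvd coeff forest_poly 4"
    \<comment> \<open>The monomial \<open>x ^ 4\<close> of the leading coefficient is free of
      \<open>q\<close>, so its coefficient 1 cannot be divisible by \<open>q + 1\<close>.\<close>
    then have "[:1, 1:] dvd coeff (coeff forest_poly 4) 4" unfolding \<pi>_def const_poly_dvd_iff by blast
    moreover have "coeff (coeff forest_poly 4) 4 = 1"
      unfolding forest_poly_coeffs coef_X_def coef_Q_def by (simp add: eval_nat_numeral one_pCons)
    ultimately have "is_unit [:1, 1 :: rat:]" by simp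
    then show False by (simp add: is_unit_poly_iff)
  qed
  have za: "coeff a i = 0" if "2 < i" for i using that assms(2) by (simp add: coeff_eq_0)
  have zb: "coeff b i = 0" if "2 < i" for i using that assms(3) by (simp add: coeff_eq_0)
  have c: "coeff forest_poly 0 = coeff a 0 * coeff b 0"
    "coeff forest_poly 1 = coeff a 0 * coeff b 1 + coeff a 1 * coeff b 0"
    "coeff forest_poly 2 = coeff a 0 * coeff b 2 + coeff a 1 * coeff b 1 + coeff a 2 * coeff b 0"
    "coeff forest_poly 4 = coeff a 2 * coeff b 2"
    unfolding assms(1) coeff_mult by (simp_all add: za zb eval_nat_numeral)
  have p: "\<pi> dvd coeff forest_poly 0" "\<pi> dvd coeff forest_poly 1" unfolding forest_poly_coeffs pi by simp_all
  have "coeff forest_poly 2 = \<pi> * ((1 - coef_Q) * coef_X\<^sup>2 - 3 * coef_Q)"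
    unfolding forest_poly_coeffs pi by (simp add: algebra_simps power2_eq_square)
  then have p2: "\<pi> dvd coeff forest_poly 2" by simp
  \<comment> \<open>Since the prime does not divide \<open>b0\<close>, its divisibility climbs from
    \<open>a0\<close> to \<open>a1\<close> and \<open>a2\<close>, and so to the leading coefficient.
    Stated for arbitrary coefficients so as to apply to both orders of the factors.\<close>
  have imp: False
    if "\<pi> dvd a0" "\<not> \<pi> dvd b0" "\<pi> dvd a0 * b1 + a1 * b0" "\<pi> dvd a0 * b2 + a1 * b1 + a2 * b0" "\<not> \<pi> dvd a2 * b2"
    for a0 a1 a2 b0 b1 b2
  proof -
    have "\<pi> dvd a1 * b0" using that(1,3) by (simp add: dvd_add_right_iff)
    then have 1: "\<pi> dvd a1" using prime that(2) by (simp add: prime_elem_dvd_mult_iff)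
    then have "\<pi> dvd a0 * b2 + a1 * b1" using that(1) by simp
    then have "\<pi> dvd a2 * b0" using that(4) by (simp add: dvd_add_right_iff)
    then have "\<pi> dvd a2" using prime that(2) by (simp add: prime_elem_dvd_mult_iff)
    then show False using that(5) by simp
  qed
  have "\<pi> dvd coeff a 0 \<or> \<pi> dvd coeff b 0"
    using p(1) prime unfolding c by (simp add: prime_elem_dvd_mult_iff)
  moreover have "\<not> (\<pi> dvd coeff a 0 \<and> \<pi> dvd coeff b 0)"
  proof
    assume "\<pi> dvd coeff a 0 \<and> \<pi> dvd coeff b 0"
    then have "\<pi> * \<pi> dvd coeff forest_poly 0" unfolding c by (intro mult_dvd_mono) auto
    then show False using dd unfolding forest_poly_coeffs by (simp only: dvd_minus_iff)
  qed
  ultimately show False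
    using imp[of "coeff a 0" "coeff b 0" "coeff b 1" "coeff a 1" "coeff b 2" "coeff a 2"]
      imp[of "coeff b 0" "coeff a 0" "coeff a 1" "coeff b 1" "coeff a 2" "coeff b 2"] p p2 d4
    unfolding c by (auto simp: add_ac mult_ac)
qed

abbreviation "forest_root \<equiv> fps_to_fls G_forest"

definition eval_at :: "rat poly poly poly \<Rightarrow> rat fls fls" where
  "eval_at p = poly (map_poly xq_poly p) forest_root"

lemma eval_at_hom: "eval_at (a + b) = eval_at a + eval_at b" "eval_at (a * b) = eval_at a * eval_at b"
  by (simp_all add: eval_at_def map_xq_hom)

lemma eval_at_const: "eval_at [:c:] = xq_poly c"
  by (simp add: eval_at_def map_poly_pCons)

lemma xq_fps_vars: "xq_fps coef_X = fps_X" "xq_fps coef_Q = fps_const fls_X"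
proof -
  show "xq_fps coef_X = fps_X"
    by (rule fps_ext) (auto simp: xq_fps_nth coef_X_def coeff_pCons split: nat.splits)
  have "fps_of_poly [:0, 1 :: rat:] = fps_X" by (simp add: fps_of_poly_pCons)
  then show "xq_fps coef_Q = fps_const fls_X"
    by (intro fps_ext) (auto simp: xq_fps_nth coef_Q_def coeff_pCons split: nat.splits)
qed

lemma xq_fps_hom: "xq_fps (a - b) = xq_fps a - xq_fps b" "xq_fps (- a) = - xq_fps a" "xq_fps 1 = 1"
  "xq_fps (numeral n) = numeral n" "xq_fps (a ^ k) = xq_fps a ^ k"
proof -
  have 0: "xq_fps 0 = 0" by (simp add: xq_fps_def)
  have m: "xq_fps (- a) = - xq_fps a" for a
    using xq_fps_add[of a "- a"] 0 by (simp add: eq_neg_iff_add_eq_0 add.commute)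
  show "xq_fps (- a) = - xq_fps a" by (rule m)
  show "xq_fps (a - b) = xq_fps a - xq_fps b" using xq_fps_add[of a "- b"] m by simp
  show 1: "xq_fps 1 = 1" by (simp add: xq_fps_def)
  have "xq_fps (of_nat k) = of_nat k" for k
    by (induct k) (simp_all add: 0 1 xq_fps_add)
  from this[of "numeral n"] show "xq_fps (numeral n) = numeral n" by simp
  show "xq_fps (a ^ k) = xq_fps a ^ k" by (induct k) (simp_all add: 1 xq_fps_mult)
qed

text \<open>Moves \<open>G_forest_equation\<close> from power series into the field of Laurent
  series, where minimal polynomials make sense.\<close>

lemma eval_forest_poly: "eval_at forest_poly = 0"
proof -
  have "eval_at p = fps_to_fls (\<Sum>i \<le> degree p. xq_fps (coeff p i) * G_forest ^ i)" for p
  proof -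
    have "fps_to_fls (sum h S) = (\<Sum>i \<in> S. fps_to_fls (h i))" for h :: "nat \<Rightarrow> rat fls fps" and S
      by (induct S rule: infinite_finite_induct) simp_all
    moreover have "coeff (map_poly xq_poly p) i = xq_poly (coeff p i)" for i by (rule coeff_map_poly) simp
    ultimately show ?thesis unfolding eval_at_def poly_altdef
      by (simp add: degree_map_xq xq_poly_fps fls_times_fps_to_fls fps_to_fls_power)
  qed
  also have "(\<Sum>i \<le> degree forest_poly. xq_fps (coeff forest_poly i) * G_forest ^ i) = 0"
  proof -
    have s: "(\<Sum>i \<le> 4. h i) = h 4 + h 3 + h 2 + h 1 + h 0" for h :: "nat \<Rightarrow> xq_series"
      by (simp add: eval_nat_numeral add_ac)
    show ?thesis
      unfolding forest_poly_degree s forest_poly_coeffs xq_fps_hom xq_fps_add xq_fps_mult xq_fps_vars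
      using G_forest_equation by (simp add: add.assoc)
  qed
  finally show ?thesis by simp
qed

text \<open>By pseudo-division, an annihilating polynomial of least degree divides the quartic up to
  a scalar; Gauss's lemma on primitive parts then yields a factorisation with coefficients
  polynomial in \<open>x\<close> and \<open>q\<close>. Degrees 1 and 3 give a linear factor, degree
  2 a quadratic one.\<close>

theorem minimal_degree:
  assumes "p \<noteq> 0" "eval_at p = 0"
  shows "4 \<le> degree p"
proof (rule ccontr)
  assume "\<not> 4 \<le> degree p"
  define Pr where "Pr d \<longleftrightarrow> (\<exists>p. p \<noteq> 0 \<and> eval_at p = 0 \<and> degree p = d)" for d
  have ex: "Pr (degree p)" unfolding Pr_def using assms by blast
  define d where "d = (LEAST d. Pr d)"
  have "Pr d" unfolding d_def using ex by (rule LeastI)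
  then obtain g where g: "g \<noteq> 0" "eval_at g = 0" "degree g = d" unfolding Pr_def by blast
  have d4: "d < 4" using Least_le[of Pr, OF ex] \<open>\<not> 4 \<le> degree p\<close> unfolding d_def by linarith
  have min: "h = 0" if "eval_at h = 0" "degree h < d" for h
  proof (rule ccontr)
    assume "h \<noteq> 0"
    then have "Pr (degree h)" unfolding Pr_def using that(1) by blast
    then have "d \<le> degree h" unfolding d_def by (rule Least_le)
    then show False using that(2) by simp
  qed
  have d0: "d \<noteq> 0"
  proof
    assume "d = 0"
    then obtain c where "g = [:c:]" using g(3) by (metis degree_eq_zeroE)
    then show False using g(1,2) eval_at_const by simp
  qed
  obtain s r where sr: "pseudo_divmod forest_poly g = (s, r)" by force
  define c where "c = coeff g (degree g) ^ (Suc (degree forest_poly) - degree g)"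
  have ps: "smult c forest_poly = g * s + r" "r = 0 \<or> degree r < degree g"
    using pseudo_divmod[OF g(1) sr] unfolding c_def by auto
  have "c \<noteq> 0" using g(1) by (simp add: c_def)
  have "[:c:] * forest_poly = g * s + r" using ps(1) by simp
  from arg_cong[OF this, of eval_at]
  have "eval_at [:c:] * eval_at forest_poly = eval_at g * eval_at s + eval_at r" unfolding eval_at_hom .
  then have "eval_at r = 0" unfolding g(2) eval_forest_poly by simp
  then have "r = 0" using min[of r] ps(2) g(3) by blast
  then have e: "smult c forest_poly = g * s" using ps(1) by simp
  then have s0: "s \<noteq> 0" using \<open>c \<noteq> 0\<close> forest_poly_degree(2) by auto
  have "degree (g * s) = 4" unfolding e[symmetric] using \<open>c \<noteq> 0\<close> forest_poly_degree(1) by simp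
  then have deg: "degree g + degree s = 4" using g(1) s0 by (simp add: degree_mult_eq)
  \<comment> \<open>Primitive parts are multiplicative, but the scalar \<open>c\<close> leaves its
    unit factor behind; \<open>v\<close> cancels it.\<close>
  define u where "u = unit_factor c"
  have u: "u dvd 1" using \<open>c \<noteq> 0\<close> by (simp add: u_def)
  then obtain v where "1 = u * v" by (rule dvdE)
  then have v: "v * u = 1" by (simp add: mult.commute)
  have up: "smult u (primitive_part forest_poly) = primitive_part g * primitive_part s"
    using arg_cong[OF e, of primitive_part] unfolding primitive_part_smult primitive_part_mult u_def .
  have "smult v (primitive_part g * primitive_part s) = smult (v * u) (primitive_part forest_poly)"
    unfolding up[symmetric] by (simp only: smult_smult)
  then have pp: "primitive_part forest_poly = smult v (primitive_part g * primitive_part s)"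
    unfolding v by (simp only: smult_1_left)
  have "forest_poly = smult (content forest_poly) (primitive_part forest_poly)"
    by (rule content_times_primitive_part[symmetric])
  also have "\<dots> = smult (content forest_poly * v) (primitive_part g) * primitive_part s"
    unfolding pp by (simp only: mult_smult_left smult_smult)
  finally have fac: "forest_poly = smult (content forest_poly * v) (primitive_part g) * primitive_part s" .
  have "v \<noteq> 0" using v by auto
  then have "content forest_poly * v \<noteq> 0" using forest_poly_degree(2) by simp
  then have dg: "degree (smult (content forest_poly * v) (primitive_part g)) = d" "degree (primitive_part s) = 4 - d"
    using g(3) deg by simp_all
  consider "d = 1" | "d = 2" | "d = 3" using d0 d4 by linarith
  then show False
  proof cases
    case 1
    then show False using no_linear_factor[OF fac] dg by simp
  next
    case 2
    then show False using no_quadratic_factor[OF fac] dg by simp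
  next
    case 3
    have f: "forest_poly = primitive_part s * smult (content forest_poly * v) (primitive_part g)"
      using fac by (simp only: mult.commute)
    show False by (rule no_linear_factor[OF f]) (use dg 3 in linarith)+
  qed
qed

text \<open>Lets \<open>minimal_degree\<close>, proved for polynomial coefficients, speak about
  rational functions as coefficients.\<close>

lemma clear_denominators:
  assumes "p \<noteq> 0" "\<And>i. coeff p i \<in> rational_functions_xq"
  obtains h c where "c \<noteq> 0" "map_poly xq_poly h = smult (xq_poly c) p"
proof -
  have "\<forall>i. \<exists>a b. b \<noteq> 0 \<and> coeff p i = xq_poly a / xq_poly b"
    using assms(2) unfolding rational_functions_xq_def by blast
  then obtain a b where ab: "\<And>i. b i \<noteq> 0 \<and> coeff p i = xq_poly (a i) / xq_poly (b i)" by metis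
  let ?S = "{..degree p}"
  define c where "c = prod b ?S"
  define h where "h = (\<Sum>i \<in> ?S. monom (a i * prod b (?S - {i})) i)"
  have "c \<noteq> 0" using ab by (simp add: c_def)
  moreover have "map_poly xq_poly h = smult (xq_poly c) p"
  proof (rule poly_eqI)
    fix i
    have "coeff h i = (if i \<le> degree p then a i * prod b (?S - {i}) else 0)"
      by (simp add: h_def coeff_sum)
    moreover have "xq_poly c * coeff p i = xq_poly (a i * prod b (?S - {i}))" if "i \<le> degree p"
    proof -
      have "c = b i * prod b (?S - {i})" unfolding c_def using that by (simp add: prod.remove)
      then show ?thesis using ab[of i] by (simp add: xq_poly_hom)
    qed
    ultimately show "coeff (map_poly xq_poly h) i = coeff (smult (xq_poly c) p) i"
      by (simp add: coeff_map_poly coeff_eq_0)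
  qed
  ultimately show thesis using that by blast
qed

theorem G_forest_algebraic: "algebraic_of_degree rational_functions_xq 4 (fps_to_fls G_forest)"
  unfolding algebraic_of_degree_def
proof (intro conjI allI impI)
  have "xq_poly c \<in> rational_functions_xq" for c
    unfolding rational_functions_xq_def by (intro CollectI exI[of _ c] exI[of _ 1]) simp
  then have "\<forall>i. coeff (map_poly xq_poly forest_poly) i \<in> rational_functions_xq" by (simp add: coeff_map_poly)
  moreover have "poly (map_poly xq_poly forest_poly) (fps_to_fls G_forest) = 0"
    using eval_forest_poly by (simp add: eval_at_def)
  moreover have "degree (map_poly xq_poly forest_poly) = 4" "map_poly xq_poly forest_poly \<noteq> 0"
    using degree_map_xq[of forest_poly] forest_poly_degree(1) by auto
  ultimately show "\<exists>p. p \<noteq> 0 \<and> (\<forall>i. coeff p i \<in> rational_functions_xq) \<and> poly p (fps_to_fls G_forest) = 0 \<and> degree p = 4"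
    by blast
  fix p assume p: "p \<noteq> 0 \<and> (\<forall>i. coeff p i \<in> rational_functions_xq) \<and> poly p (fps_to_fls G_forest) = 0"
  then obtain h c where hc: "c \<noteq> 0" "map_poly xq_poly h = smult (xq_poly c) p"
    using clear_denominators[of p] by blast
  have "degree h = degree p" using arg_cong[OF hc(2), of degree] hc(1) by (simp add: degree_map_xq)
  moreover have "eval_at h = 0" unfolding eval_at_def hc(2) using p by simp
  moreover have "h \<noteq> 0" using hc p by auto
  ultimately show "4 \<le> degree p" using minimal_degree by metis
qed


theorem mainTheorem4:
  shows "(\<forall>k r. k \<ge> 1 \<longrightarrow>
            finite (og_forest_types k r) \<and>
            of_nat (card (og_forest_types k r)) = fls_nth (fps_nth G_forest (2 * k)) (int r))
       \<and> (\<forall>k\<ge>1. fps_nth G_forest (2 * k)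
                    = 1 / of_nat (2 * k + 1) * fps_nth ((1 + G_tree) ^ (2 * k + 1)) (2 * k))
       \<and> algebraic_of_degree rational_functions_xq 4 (fps_to_fls G_forest)
       \<and> (let x = fps_X; q = fps_const fls_X; G = G_forest in
            (x ^ 4 - q ^ 2 * x ^ 2) * G ^ 4
            + ((2 * q ^ 2 - 1) * x ^ 2 + q * (q + 1)) * G ^ 3
            + (x ^ 2 - q * (q * (x ^ 2 + 3) + 3)) * G ^ 2
            + 3 * q * (q + 1) * G - q * (q + 1) = 0)"
proof (intro conjI allI impI)
  fix k r :: nat
  assume k: "1 \<le> k"
  have "shapes k r \<subseteq> {f. ok_f f \<and> size_f f = 2 * k}" by (auto simp: shapes_def)
  then have fin: "finite (shapes k r)" using finite_shapes finite_subset by blast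
  note bij = og_forest_types_shapes[OF k, of r]
  show "finite (og_forest_types k r)" using fin bij_betw_finite[OF bij] by blast
  have "card (og_forest_types k r) = card (shapes k r)" using bij_betw_same_card[OF bij] by simp
  then show "of_nat (card (og_forest_types k r)) = fls_nth (fps_nth G_forest (2 * k)) (int r)"
    unfolding G_forest_coefficient shapes_def by simp
next
  fix k :: nat
  show "fps_nth G_forest (2 * k) = 1 / of_nat (2 * k + 1) * fps_nth ((1 + G_tree) ^ (2 * k + 1)) (2 * k)"
    by (rule G_forest_nth)
next
  show "algebraic_of_degree rational_functions_xq 4 (fps_to_fls G_forest)" by (rule G_forest_algebraic)
next
  show "let x = fps_X; q = fps_const fls_X; G = G_forest in
            (x ^ 4 - q ^ 2 * x ^ 2) * G ^ 4
            + ((2 * q ^ 2 - 1) * x ^ 2 + q * (q + 1)) * G ^ 3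
            + (x ^ 2 - q * (q * (x ^ 2 + 3) + 3)) * G ^ 2
            + 3 * q * (q + 1) * G - q * (q + 1) = 0"
    unfolding Let_def by (rule G_forest_equation)
qed

end
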